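(* Assume that $H_1'(w)$ has full row rank. Then the input-output data $u(0),\dots,u(T),y(0),\dots,y(T)$ are informative for quadratic stabilization if and only if there exists $\Phi\in\mathbb{S}^{qL}$ such that $$\Phi>\bar N\,|\,\bar N_{22}$$ and $$\begin{bmatrix}W\\ \begin{bmatrix}J^\top&0&I_{qL}\end{bmatrix}\end{bmatrix}^\top\begin{bmatrix}\begin{bmatrix}\Phi&0\\ 0&0\end{bmatrix}-\bar N&0\\ 0&-\Phi\end{bmatrix}\begin{bmatrix}W\\ \begin{bmatrix}J^\top&0&I_{qL}\end{bmatrix}\end{bmatrix}>0 .$$ Moreover, if $\Phi$ satisfies these two LMIs, then the controller with coefficient matrix $C$ defined by $$C^\top:=-\begin{bmatrix}J^\top&0&I_{qL}\end{bmatrix}\left(W^\top\left(\begin{bmatrix}\Phi&0\\ 0&0\end{bmatrix}-\bar N\right)W\right)^{-1}W^\top\begin{bmatrix}\Phi&0\\ 0&0\end{bmatrix}\begin{bmatrix}0_{q(L-1)\times m}\\ I_m\\ 0_{(p+qL)\times m}\end{bmatrix}$$ satisfies $$\begin{bmatrix}I_{qL}&0\\ 0&I_{qL}\\ \begin{bmatrix}J\\ -C\\ 0\end{bmatrix}^\top&I_{qL}\end{bmatrix}^\top\begin{bmatrix}\begin{bmatrix}\Phi&0\\ 0&0\end{bmatrix}-\bar N&0\\ 0&-\Phi\end{bmatrix}\begin{bmatrix}I_{qL}&0\\ 0&I_{qL}\\ \begin{bmatrix}J\\ -C\\ 0\end{bmatrix}^\top&I_{qL}\end{bmatrix}>0 .$$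 As a consequence, this controller stabilizes all systems compatible with the data, and the resulting closed loop systems have common Lyapunov function $Q_\Psi$ with $\Psi:=\Phi^{-1}$.
   Context: Notation: $\mathbb{S}^n$ is the set of real symmetric $n\times n$ matrices; $>0,\ \geq0,\ <0$ denote (semi)definiteness; $\dagger$ is the Moore-Penrose pseudo-inverse; $\mathbb{Z}_+$ is the set of nonnegative integers; $(\sigma\boldsymbol{f})(t)=\boldsymbol{f}(t+1)$. For a symmetric partitioned $\Pi$ put $\Pi\,|\,\Pi_{22}:=\Pi_{11}-\Pi_{12}\Pi_{22}^\dagger\Pi_{21}$ (generalized Schur complement). Systems: fix positive integers $m,p,L,T$ with $T\geq L$, and $q:=p+m$. The model class consists of systems $P(\sigma)\boldsymbol{y}=Q(\sigma)\boldsymbol{u}+\boldsymbol{v}$ with $P(\xi)=I\xi^L+P_{L-1}\xi^{L-1}+\cdots+P_0$, $Q(\xi)=Q_{L-1}\xi^{L-1}+\cdots+Q_0$, $P_i\in\mathbb{R}^{p\times p}$, $Q_i\in\mathbb{R}^{p\times m}$, $\boldsymbol{u}:\mathbb{Z}_+\to\mathbb{R}^m$, $\boldsymbol{y},\boldsymbol{v}:\mathbb{Z}_+\to\mathbb{R}^p$ ($\boldsymbol{v}$ is unknown noise). Put $\boldsymbol{w}=\begin{bmatrix}\boldsymbol{u}\\ \boldsymbol{y}\end{bmatrix}$, $R(\xi)=\begin{bmatrix}-Q(\xi)&P(\xi)\end{bmatrix}$, and let $R=\begin{bmatrix}-Q_0&P_0&-Q_1&P_1&\cdots&-Q_{L-1}&P_{L-1}\end{bmatrix}\in\mathbb{R}^{p\times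 qL}$ be the coefficient matrix. Controllers: $G(\sigma)\boldsymbol{u}=F(\sigma)\boldsymbol{y}$ with $G(\xi)=I\xi^L+G_{L-1}\xi^{L-1}+\cdots+G_0$, $F(\xi)=F_{L-1}\xi^{L-1}+\cdots+F_0$, $G_i\in\mathbb{R}^{m\times m}$, $F_i\in\mathbb{R}^{m\times p}$; coefficient matrix $C=\begin{bmatrix}G_0&-F_0&G_1&-F_1&\cdots&G_{L-1}&-F_{L-1}\end{bmatrix}\in\mathbb{R}^{m\times qL}$ and $C(\xi)=\begin{bmatrix}G(\xi)&-F(\xi)\end{bmatrix}$. The closed loop system is $\begin{bmatrix}C(\sigma)\\ R(\sigma)\end{bmatrix}\boldsymbol{w}=\begin{bmatrix}0\\ I_p\end{bmatrix}\boldsymbol{v}$. The controller stabilizes the system if for $\boldsymbol{v}=0$ all solutions $\boldsymbol{w}$ of the closed loop on $\mathbb{Z}_+$ tend to zero as $t\to\infty$. Noise model: $\Pi=\begin{bmatrix}\Pi_{11}&\Pi_{12}\\ \Pi_{21}&\Pi_{22}\end{bmatrix}\in\mathbb{S}^{p+T-L+1}$ is known, with $\Pi_{11}\in\mathbb{S}^p$, $\Pi_{22}\in\mathbb{S}^{T-L+1}$, $\Pi_{22}<0$ and $\Pi\,|\,\Pi_{22}\geq0$. The noise samples $V=\begin{bmatrix}v(0)&\cdots&v(T-L)\end{bmatrix}$ satisfy $\begin{bmatrix}I\\ V^\top\end{bmatrix}^\top\Pi\begin{bmatrix}I\\ V^\top\end{bmatrix}\geq0$. Data: $u(t)\in\mathbb{R}^m$,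 $y(t)\in\mathbb{R}^p$, $t=0,\dots,T$; $w(t)=\begin{bmatrix}u(t)\\ y(t)\end{bmatrix}$. $H_1'(w)\in\mathbb{R}^{qL\times(T-L+1)}$ is the block Hankel matrix whose $(i+1)$-th block row is $\begin{bmatrix}w(i)&w(i+1)&\cdots&w(T-L+i)\end{bmatrix}$, $i=0,\dots,L-1$, and $H_2'(w)=\begin{bmatrix}y(L)&\cdots&y(T)\end{bmatrix}$. Define $$N:=\begin{bmatrix}I&H_2'(w)\\ 0&H_1'(w)\end{bmatrix}\Pi\begin{bmatrix}I&H_2'(w)\\ 0&H_1'(w)\end{bmatrix}^\top\in\mathbb{S}^{p+qL}.$$ A system with coefficient matrix $R$ is compatible with the data if and only if $\begin{bmatrix}I\\ R^\top\end{bmatrix}^\top N\begin{bmatrix}I\\ R^\top\end{bmatrix}\geq0$. The data are generated by a true system in the model class, with noise satisfying the noise model, so the set of compatible $R$ is nonempty. Further define $$\bar N:=\begin{bmatrix}\begin{bmatrix}0&0&-I_p\end{bmatrix}&0\\ 0&I_{qL}\end{bmatrix}^\top N\begin{bmatrix}\begin{bmatrix}0&0&-I_p\end{bmatrix}&0\\ 0&I_{qL}\end{bmatrix}=\begin{bmatrix}\bar N_{11}&\bar N_{12}\\ \bar N_{21}&\bar N_{22}\end{bmatrix}\in\mathbb{S}^{2qL},$$ with $\begin{bmatrix}0&0&-I_p\end{bmatrix}\in\mathbb{R}^{p\times qL}$ (column blocks of sizes $q(L-1),m,p$) and all blocks $\bar N_{ij}\in\mathbb{R}^{qL\times qL}$.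 Let $J:=\begin{bmatrix}0_{q(L-1)\times q}&I_{q(L-1)}\end{bmatrix}\in\mathbb{R}^{q(L-1)\times qL}$ (void if $L=1$), and let $W\in\mathbb{R}^{2qL\times(2qL-m)}$ be $$W:=\begin{bmatrix}I_{q(L-1)}&0&0\\ 0&0_{m\times p}&0\\ 0&I_p&0\\ 0&0&I_{qL}\end{bmatrix}.$$ In $\begin{bmatrix}J^\top&0&I_{qL}\end{bmatrix}$ the zero block is $qL\times p$. Informativity: the data are informative for quadratic stabilization if there exist $C\in\mathbb{R}^{m\times qL}$ and $\Psi\in\mathbb{S}^{qL}$, $\Psi\geq0$, such that $$\begin{bmatrix}I_{qL}\\ -C\\ -R\end{bmatrix}^\top\left(\begin{bmatrix}0_q&0\\ 0&\Psi\end{bmatrix}-\begin{bmatrix}\Psi&0\\ 0&0_q\end{bmatrix}\right)\begin{bmatrix}I_{qL}\\ -C\\ -R\end{bmatrix}<0$$ holds for all $R$ compatible with the data. QDFs: for $\Psi\in\mathbb{S}^{qL}$ the quadratic difference form (QDF) is $Q_\Psi(\boldsymbol{w})(t)=\eta(t)^\top\Psi\eta(t)$, where $\eta(t)$ is the stacked vector of $\boldsymbol{w}(t),\dots,\boldsymbol{w}(t+L-1)$, and $Q_{\nabla\Psi}(\boldsymbol{w})(t)=Q_\Psi(\boldsymbol{w})(t+1)-Q_\Psi(\boldsymbol{w})(t)$. $Q_\Psi$ is a Lyapunov function for a closed loop system if, on the set of its solutions $\boldsymbol{w}$ with $\boldsymbol{v}=0$, $Q_\Psi(\boldsymbol{w})(t)\geq0$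 and $Q_{\nabla\Psi}(\boldsymbol{w})(t)\leq0$ for all $t$, and $Q_{\nabla\Psi}(\boldsymbol{w})$ is identically zero only if $\boldsymbol{w}=0$. *)

theory Defs
  imports
    Complex_Main
    "Jordan_Normal_Form.Matrix"
    "Jordan_Normal_Form.Gauss_Jordan_Elimination"
    "Jordan_Normal_Form.DL_Rank"
begin

section \<open>Real symmetric matrices\<close>

definition sym_mats :: "nat \<Rightarrow> real mat set" where
  "sym_mats n = {A \<in> carrier_mat n n. A\<^sup>T = A}"

definition pos_def :: "real mat \<Rightarrow> bool" where
  "pos_def A \<longleftrightarrow> A \<in> sym_mats (dim_row A) \<and>
     (\<forall>x \<in> carrier_vec (dim_row A). x \<noteq> 0\<^sub>v (dim_row A) \<longrightarrow> x \<bullet> (A *\<^sub>v x) > 0)"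

definition pos_semidef :: "real mat \<Rightarrow> bool" where
  "pos_semidef A \<longleftrightarrow> A \<in> sym_mats (dim_row A) \<and>
     (\<forall>x \<in> carrier_vec (dim_row A). x \<bullet> (A *\<^sub>v x) \<ge> 0)"

definition neg_def :: "real mat \<Rightarrow> bool" where
  "neg_def A \<longleftrightarrow> pos_def (- A)"

text \<open>Moore-Penrose pseudo-inverse, characterized by the four Penrose equations.\<close>

definition pinv :: "real mat \<Rightarrow> real mat" where
  "pinv A = (THE X. X \<in> carrier_mat (dim_col A) (dim_row A) \<and>
     A * X * A = A \<and> X * A * X = X \<and> (A * X)\<^sup>T = A * X \<and> (X * A)\<^sup>T = X * A)"

text \<open>Both operations below partition a square matrix such that the upper left block has
  size \<open>k \<times> k\<close>.\<close>

definition block22 :: "nat \<Rightarrow> real mat \<Rightarrow> real mat" where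
  "block22 k A = (case split_block A k k of (_, _, _, A22) \<Rightarrow> A22)"

definition schur_compl :: "nat \<Rightarrow> real mat \<Rightarrow> real mat" where
  "schur_compl k A =
     (case split_block A k k of (A11, A12, A21, A22) \<Rightarrow> A11 - A12 * pinv A22 * A21)"

text \<open>Only meaningful for invertible matrices.\<close>

definition mat_inv :: "real mat \<Rightarrow> real mat" where
  "mat_inv A = the (mat_inverse A)"

definition append_cols :: "'a :: zero mat \<Rightarrow> 'a mat \<Rightarrow> 'a mat" (infixr \<open>@\<^sub>c\<close> 65) where
  "A @\<^sub>c B = four_block_mat A B (0\<^sub>m 0 (dim_col A)) (0\<^sub>m 0 (dim_col B))"


section \<open>Systems, controllers and the closed loop\<close>

text \<open>A polynomial matrix is given by its family of coefficient matrices;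
  \<open>shift_op n A d f\<close> is \<open>A(\<sigma>) f\<close> for the polynomial matrix with \<open>n\<close> rows
  \<open>A(\<xi>) = \<Sum>i<d. A i \<xi>^i\<close>.\<close>

definition shift_op ::
  "nat \<Rightarrow> (nat \<Rightarrow> real mat) \<Rightarrow> nat \<Rightarrow> (nat \<Rightarrow> real vec) \<Rightarrow> nat \<Rightarrow> real vec" where
  "shift_op n A d f t = vec n (\<lambda>k. \<Sum>i<d. (A i *\<^sub>v f (t + i)) $ k)"

text \<open>The polynomial matrices are \<open>P(\<xi>) = I \<xi>^L + P\<^bsub>L-1\<^esub> \<xi>^(L-1) + \<dots> + P\<^sub>0\<close> and
  \<open>Q(\<xi>) = Q\<^bsub>L-1\<^esub> \<xi>^(L-1) + \<dots> + Q\<^sub>0\<close>; values of \<open>P\<close> beyond index \<open>L\<close> and of \<open>Q\<close> beyond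
  index \<open>L - 1\<close> are irrelevant.\<close>

definition system :: "nat \<Rightarrow> nat \<Rightarrow> nat \<Rightarrow> (nat \<Rightarrow> real mat) \<Rightarrow> (nat \<Rightarrow> real mat) \<Rightarrow> bool" where
  "system p m L P Q \<longleftrightarrow>
     (\<forall>i<L. P i \<in> carrier_mat p p \<and> Q i \<in> carrier_mat p m) \<and> P L = 1\<^sub>m p"

definition controller :: "nat \<Rightarrow> nat \<Rightarrow> nat \<Rightarrow> (nat \<Rightarrow> real mat) \<Rightarrow> (nat \<Rightarrow> real mat) \<Rightarrow> bool" where
  "controller p m L G F \<longleftrightarrow>
     (\<forall>i<L. G i \<in> carrier_mat m m \<and> F i \<in> carrier_mat m p) \<and> G L = 1\<^sub>m m"

definition system_eq ::
  "nat \<Rightarrow> nat \<Rightarrow> (nat \<Rightarrow> real mat) \<Rightarrow> (nat \<Rightarrow> real mat) \<Rightarrow>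
   (nat \<Rightarrow> real vec) \<Rightarrow> (nat \<Rightarrow> real vec) \<Rightarrow> (nat \<Rightarrow> real vec) \<Rightarrow> nat \<Rightarrow> bool" where
  "system_eq p L P Q u v y t \<longleftrightarrow> shift_op p P (Suc L) y t = shift_op p Q L u t + v t"

definition controller_eq ::
  "nat \<Rightarrow> nat \<Rightarrow> (nat \<Rightarrow> real mat) \<Rightarrow> (nat \<Rightarrow> real mat) \<Rightarrow>
   (nat \<Rightarrow> real vec) \<Rightarrow> (nat \<Rightarrow> real vec) \<Rightarrow> nat \<Rightarrow> bool" where
  "controller_eq m L G F u y t \<longleftrightarrow> shift_op m G (Suc L) u t = shift_op m F L y t"

text \<open>The block row matrix \<open>[B 0, B 1, \<dots>, B (L - 1)]\<close> for blocks of size \<open>r \<times> q\<close>.\<close>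

definition block_row :: "nat \<Rightarrow> nat \<Rightarrow> nat \<Rightarrow> (nat \<Rightarrow> real mat) \<Rightarrow> real mat" where
  "block_row r q L B = mat r (q * L) (\<lambda>(i, j). B (j div q) $$ (i, j mod q))"

definition system_coeff_mat ::
  "nat \<Rightarrow> nat \<Rightarrow> nat \<Rightarrow> (nat \<Rightarrow> real mat) \<Rightarrow> (nat \<Rightarrow> real mat) \<Rightarrow> real mat" where
  "system_coeff_mat p m L P Q = block_row p (p + m) L (\<lambda>i. (- Q i) @\<^sub>c P i)"

definition controller_coeff_mat ::
  "nat \<Rightarrow> nat \<Rightarrow> nat \<Rightarrow> (nat \<Rightarrow> real mat) \<Rightarrow> (nat \<Rightarrow> real mat) \<Rightarrow> real mat" where
  "controller_coeff_mat p m L G F = block_row m (p + m) L (\<lambda>i. G i @\<^sub>c (- F i))"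

definition closed_loop_solution ::
  "nat \<Rightarrow> nat \<Rightarrow> nat \<Rightarrow> (nat \<Rightarrow> real mat) \<Rightarrow> (nat \<Rightarrow> real mat) \<Rightarrow>
   (nat \<Rightarrow> real mat) \<Rightarrow> (nat \<Rightarrow> real mat) \<Rightarrow> (nat \<Rightarrow> real vec) \<Rightarrow> (nat \<Rightarrow> real vec) \<Rightarrow> bool" where
  "closed_loop_solution p m L P Q G F v w \<longleftrightarrow>
     (\<exists>u y. (\<forall>t. u t \<in> carrier_vec m \<and> y t \<in> carrier_vec p \<and> w t = u t @\<^sub>v y t) \<and>
            (\<forall>t. controller_eq m L G F u y t \<and> system_eq p L P Q u v y t))"

definition stabilizes ::
  "nat \<Rightarrow> nat \<Rightarrow> nat \<Rightarrow> (nat \<Rightarrow> real mat) \<Rightarrow> (nat \<Rightarrow> real mat) \<Rightarrow>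
   (nat \<Rightarrow> real mat) \<Rightarrow> (nat \<Rightarrow> real mat) \<Rightarrow> bool" where
  "stabilizes p m L G F P Q \<longleftrightarrow>
     (\<forall>w. closed_loop_solution p m L P Q G F (\<lambda>_. 0\<^sub>v p) w \<longrightarrow>
        (\<forall>k < p + m. (\<lambda>t. w t $ k) \<longlonglongrightarrow> 0))"


section \<open>Quadratic difference forms\<close>

text \<open>The vector obtained by stacking \<open>w t, \<dots>, w (t + L - 1)\<close>.\<close>

definition stacked :: "nat \<Rightarrow> nat \<Rightarrow> (nat \<Rightarrow> real vec) \<Rightarrow> nat \<Rightarrow> real vec" where
  "stacked q L w t = vec (q * L) (\<lambda>k. w (t + k div q) $ (k mod q))"

definition qdf :: "nat \<Rightarrow> nat \<Rightarrow> real mat \<Rightarrow> (nat \<Rightarrow> real vec) \<Rightarrow> nat \<Rightarrow> real" where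
  "qdf q L \<Psi> w t = stacked q L w t \<bullet> (\<Psi> *\<^sub>v stacked q L w t)"

definition qdf_diff :: "nat \<Rightarrow> nat \<Rightarrow> real mat \<Rightarrow> (nat \<Rightarrow> real vec) \<Rightarrow> nat \<Rightarrow> real" where
  "qdf_diff q L \<Psi> w t = qdf q L \<Psi> w (t + 1) - qdf q L \<Psi> w t"

definition lyapunov_function ::
  "nat \<Rightarrow> nat \<Rightarrow> nat \<Rightarrow> (nat \<Rightarrow> real mat) \<Rightarrow> (nat \<Rightarrow> real mat) \<Rightarrow>
   (nat \<Rightarrow> real mat) \<Rightarrow> (nat \<Rightarrow> real mat) \<Rightarrow> real mat \<Rightarrow> bool" where
  "lyapunov_function p m L P Q G F \<Psi> \<longleftrightarrow>
     \<Psi> \<in> sym_mats ((p + m) * L) \<and>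
     (\<forall>w. closed_loop_solution p m L P Q G F (\<lambda>_. 0\<^sub>v p) w \<longrightarrow>
        (\<forall>t. qdf (p + m) L \<Psi> w t \<ge> 0) \<and>
        (\<forall>t. qdf_diff (p + m) L \<Psi> w t \<le> 0) \<and>
        ((\<forall>t. qdf_diff (p + m) L \<Psi> w t = 0) \<longrightarrow> (\<forall>t. w t = 0\<^sub>v (p + m))))"


section \<open>Noise model, data and compatibility\<close>

text \<open>\<open>quad_form n PI V\<close> is \<open>[I; V\<^sup>T]\<^sup>T PI [I; V\<^sup>T]\<close> with identity matrix of size \<open>n\<close>.\<close>

definition quad_form :: "nat \<Rightarrow> real mat \<Rightarrow> real mat \<Rightarrow> real mat" where
  "quad_form n PI V = (1\<^sub>m n @\<^sub>r V\<^sup>T)\<^sup>T * PI * (1\<^sub>m n @\<^sub>r V\<^sup>T)"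

definition noise_model :: "nat \<Rightarrow> nat \<Rightarrow> nat \<Rightarrow> real mat \<Rightarrow> bool" where
  "noise_model p L T PI \<longleftrightarrow> PI \<in> sym_mats (p + (T - L + 1)) \<and>
     neg_def (block22 p PI) \<and> pos_semidef (schur_compl p PI)"

text \<open>The data \<open>u(0), \<dots>, u(T), y(0), \<dots>, y(T)\<close> are generated by the system, with some noise samples
  \<open>v(0), \<dots>, v(T - L)\<close> that satisfy the noise model.\<close>

definition generates_data ::
  "nat \<Rightarrow> nat \<Rightarrow> nat \<Rightarrow> real mat \<Rightarrow> (nat \<Rightarrow> real vec) \<Rightarrow> (nat \<Rightarrow> real vec) \<Rightarrow>
   (nat \<Rightarrow> real mat) \<Rightarrow> (nat \<Rightarrow> real mat) \<Rightarrow> bool" where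
  "generates_data p L T PI u y P Q \<longleftrightarrow>
     (\<exists>v. (\<forall>t \<le> T - L. v t \<in> carrier_vec p \<and> system_eq p L P Q u v y t) \<and>
          pos_semidef (quad_form p PI (mat_of_cols p (map v [0..<T - L + 1]))))"

definition hankel1 ::
  "nat \<Rightarrow> nat \<Rightarrow> nat \<Rightarrow> nat \<Rightarrow> (nat \<Rightarrow> real vec) \<Rightarrow> (nat \<Rightarrow> real vec) \<Rightarrow> real mat" where
  "hankel1 p m L T u y = mat ((p + m) * L) (T - L + 1)
     (\<lambda>(k, j). (u (k div (p + m) + j) @\<^sub>v y (k div (p + m) + j)) $ (k mod (p + m)))"

definition hankel2 :: "nat \<Rightarrow> nat \<Rightarrow> nat \<Rightarrow> (nat \<Rightarrow> real vec) \<Rightarrow> real mat" where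
  "hankel2 p L T y = mat_of_cols p (map y [L..<T + 1])"

definition N_mat ::
  "nat \<Rightarrow> nat \<Rightarrow> nat \<Rightarrow> nat \<Rightarrow> real mat \<Rightarrow> (nat \<Rightarrow> real vec) \<Rightarrow> (nat \<Rightarrow> real vec) \<Rightarrow> real mat" where
  "N_mat p m L T PI u y =
     (let S = four_block_mat (1\<^sub>m p) (hankel2 p L T y)
                             (0\<^sub>m ((p + m) * L) p) (hankel1 p m L T u y)
      in S * PI * S\<^sup>T)"

text \<open>If \<open>V = H2 + R H1\<close> are the noise samples that the system with coefficient matrix \<open>R\<close> needs to
  explain the data, then \<open>quad_form p N R = quad_form p PI V\<close>. So compatibility means that these
  samples satisfy the noise model.\<close>

definition compatible ::
  "nat \<Rightarrow> nat \<Rightarrow> nat \<Rightarrow> nat \<Rightarrow> real mat \<Rightarrow> (nat \<Rightarrow> real vec) \<Rightarrow> (nat \<Rightarrow> real vec) \<Rightarrow> real mat \<Rightarrow> bool"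
  where
  "compatible p m L T PI u y R \<longleftrightarrow> R \<in> carrier_mat p ((p + m) * L) \<and>
     pos_semidef (quad_form p (N_mat p m L T PI u y) R)"

definition informative_quadratic_stabilization ::
  "nat \<Rightarrow> nat \<Rightarrow> nat \<Rightarrow> nat \<Rightarrow> real mat \<Rightarrow> (nat \<Rightarrow> real vec) \<Rightarrow> (nat \<Rightarrow> real vec) \<Rightarrow> bool" where
  "informative_quadratic_stabilization p m L T PI u y \<longleftrightarrow>
     (let q = p + m in
      \<exists>C \<in> carrier_mat m (q * L). \<exists>\<Psi> \<in> sym_mats (q * L). pos_semidef \<Psi> \<and>
        (\<forall>R. compatible p m L T PI u y R \<longrightarrow>
           (let X = 1\<^sub>m (q * L) @\<^sub>r (- C) @\<^sub>r (- R) in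
            neg_def (X\<^sup>T * (diag_block_mat [0\<^sub>m q q, \<Psi>] - diag_block_mat [\<Psi>, 0\<^sub>m q q]) * X))))"


section \<open>The matrices of the LMIs\<close>

definition Nbar :: "nat \<Rightarrow> nat \<Rightarrow> nat \<Rightarrow> real mat \<Rightarrow> real mat" where
  "Nbar p m L N =
     (let q = p + m;
          E = diag_block_mat [0\<^sub>m p (q * (L - 1)) @\<^sub>c 0\<^sub>m p m @\<^sub>c (- 1\<^sub>m p), 1\<^sub>m (q * L)]
      in E\<^sup>T * N * E)"

definition J_mat :: "nat \<Rightarrow> nat \<Rightarrow> nat \<Rightarrow> real mat" where
  "J_mat p m L = (let q = p + m in 0\<^sub>m (q * (L - 1)) q @\<^sub>c 1\<^sub>m (q * (L - 1)))"

text \<open>The row blocks have sizes \<open>q (L - 1), m, p, q L\<close>, the column blocks \<open>q (L - 1), p, q L\<close>.\<close>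

definition W_mat :: "nat \<Rightarrow> nat \<Rightarrow> nat \<Rightarrow> real mat" where
  "W_mat p m L = (let q = p + m in
     diag_block_mat [1\<^sub>m (q * (L - 1)), 0\<^sub>m m p @\<^sub>r 1\<^sub>m p, 1\<^sub>m (q * L)])"

text \<open>\<open>[J\<^sup>T 0 I]\<close>\<close>

definition K_mat :: "nat \<Rightarrow> nat \<Rightarrow> nat \<Rightarrow> real mat" where
  "K_mat p m L = (let q = p + m in (J_mat p m L)\<^sup>T @\<^sub>c 0\<^sub>m (q * L) p @\<^sub>c 1\<^sub>m (q * L))"

end

theory Submission
  imports Defs
begin

text \<open>
A system with coefficient matrix \<open>R\<close> and a controller with coefficient matrix \<open>C\<close> form a linear closed
loop on states \<open>x = (w(t), \<dots>, w(t + L - 1))\<close>, whose transition matrix \<open>A\<close> consists of the block rows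
\<open>J\<close>, \<open>- C\<close> and \<open>- R\<close>. Informativity asks for one \<open>C\<close> and one \<open>\<Psi>\<close> with \<open>A\<^sup>T \<Psi> A < \<Psi>\<close> for all compatible
\<open>R\<close>. Three ideas turn this into the two LMIs.

\<^item> Duality (\<open>lyapunov_inequality_dual\<close>): for \<open>\<Phi> = \<Psi>\<^sup>-\<^sup>1\<close> the condition becomes \<open>A \<Phi> A\<^sup>T < \<Phi>\<close>, in which the
  unknown \<open>R\<close> enters through \<open>A\<^sup>T x = A\<^sub>0\<^sup>T x + R\<^sup>T [0, 0, -I] x\<close>, where \<open>A\<^sub>0\<close> is \<open>A\<close> with \<open>R = 0\<close>.

\<^item> S-lemma (\<open>strict_S_lemma\<close>, \<open>robust_decrease_imp_LMI\<close>): every pair \<open>(x, y)\<close> at which the form of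
  \<open>Nbar\<close> is nonnegative is of the form \<open>y = R\<^sup>T [0, 0, -I] x\<close> for a compatible \<open>R\<close>
  (\<open>compatible_interpolation\<close>). So the condition for all compatible \<open>R\<close> is an implication between two
  quadratic forms. By the strict S-lemma it is equivalent to one matrix inequality with a multiplier,
  and the multiplier is positive and can be normalized to \<open>1\<close> by scaling \<open>\<Phi>\<close>. The strictness survives
  because the unit sphere is compact, which turns the implication into one with a uniform margin.

\<^item> Elimination (\<open>robust_imp_LMIs\<close>, \<open>LMIs_imp_robust\<close>): the remaining inequality contains \<open>C\<close> only in the
  term \<open>[A\<^sub>0\<^sup>T, I]\<close>. Restricting it to the range of \<open>W\<close>, where \<open>C\<close> disappears, gives the second LMI, and
  dropping that term gives the first one. Conversely, \<open>C\<close> can be chosen such that \<open>[A\<^sub>0\<^sup>T, I]\<close> factors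
  through the orthogonal projection onto the range of \<open>W\<close> with respect to the inner product of
  \<open>[\<Phi>, 0; 0, 0] - Nbar\<close>. For this \<open>C\<close>, which is the one of the theorem, the restricted inequality
  implies the full one.

Positive definiteness is used throughout through quadratic forms evaluated at vectors, and Schur
complements through completing the square. Stability follows from the strict decrease of \<open>\<Psi>\<close> by
summing the decrease along a trajectory.
\<close>

section \<open>Quadratic forms of real matrices\<close>

definition qform :: "real mat \<Rightarrow> real vec \<Rightarrow> real" where
  "qform A x = x \<bullet> (A *\<^sub>v x)"

lemma sym_matsD:
  assumes "A \<in> sym_mats n"
  shows "A \<in> carrier_mat n n" "A\<^sup>T = A"
  using assms by (auto simp: sym_mats_def)

lemma scalar_prod_transpose:
  fixes A :: "real mat"
  assumes "A \<in> carrier_mat k n" "x \<in> carrier_vec k" "y \<in> carrier_vec n"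
  shows "x \<bullet> (A *\<^sub>v y) = (A\<^sup>T *\<^sub>v x) \<bullet> y"
  using transpose_vec_mult_scalar[OF assms(1,3,2)] assms
  by (metis comm_scalar_prod mult_mat_vec_carrier transpose_carrier_mat)

lemma sym_mats_scalar_prod:
  assumes "A \<in> sym_mats n" "x \<in> carrier_vec n" "y \<in> carrier_vec n"
  shows "x \<bullet> (A *\<^sub>v y) = y \<bullet> (A *\<^sub>v x)"
proof -
  have "x \<bullet> (A *\<^sub>v y) = (A *\<^sub>v x) \<bullet> y"
    using scalar_prod_transpose[of A n n x y] assms by (auto simp: sym_mats_def)
  thus ?thesis
    using assms by (metis comm_scalar_prod mult_mat_vec_carrier sym_matsD(1))
qed

lemma scalar_prod_self_nonneg: "0 \<le> (x :: real vec) \<bullet> x"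
  by (auto simp: scalar_prod_def intro!: sum_nonneg)

lemma scalar_prod_self_pos:
  fixes x :: "real vec"
  assumes "x \<in> carrier_vec n" "x \<noteq> 0\<^sub>v n"
  shows "0 < x \<bullet> x"
proof -
  obtain i where i: "i < n" "x $ i \<noteq> 0"
    using assms by (metis carrier_vecD eq_vecI index_zero_vec)
  have "0 < (\<Sum>j\<in>{0..<n}. x $ j * x $ j)"
    by (rule sum_pos2[of _ i]) (use i in \<open>auto simp: zero_less_mult_iff\<close>)
  thus ?thesis using assms by (auto simp: scalar_prod_def)
qed

lemma mult_mat_zero_vec [simp]:
  "A \<in> carrier_mat k n \<Longrightarrow> A *\<^sub>v 0\<^sub>v n = (0\<^sub>v k :: real vec)"
  by (intro eq_vecI) auto

lemma zero_mat_mult_vec [simp]: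
  "x \<in> carrier_vec n \<Longrightarrow> 0\<^sub>m k n *\<^sub>v x = (0\<^sub>v k :: real vec)"
  by (intro eq_vecI) auto

lemma qform_zero [simp]: "A \<in> carrier_mat n n \<Longrightarrow> qform A (0\<^sub>v n) = 0"
  by (auto simp: qform_def)

lemma qform_add:
  assumes "A \<in> sym_mats n" "x \<in> carrier_vec n" "y \<in> carrier_vec n"
  shows "qform A (x + y) = qform A x + 2 * (x \<bullet> (A *\<^sub>v y)) + qform A y"
proof -
  have A: "A \<in> carrier_mat n n" by (rule sym_matsD[OF assms(1)])
  show ?thesis
    using assms A sym_mats_scalar_prod[OF assms]
    by (simp add: qform_def mult_add_distrib_mat_vec[OF A] add_scalar_prod_distrib[of _ n]
        scalar_prod_add_distrib[of _ n])
qed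

lemma qform_smult:
  assumes "A \<in> carrier_mat n n" "x \<in> carrier_vec n"
  shows "qform A (c \<cdot>\<^sub>v x) = c\<^sup>2 * qform A x"
  using assms by (simp add: qform_def mult_mat_vec[OF assms] power2_eq_square)

lemma qform_diff:
  assumes "A \<in> sym_mats n" "x \<in> carrier_vec n" "y \<in> carrier_vec n"
  shows "qform A (x - y) = qform A x - 2 * (x \<bullet> (A *\<^sub>v y)) + qform A y"
proof -
  have A: "A \<in> carrier_mat n n" by (rule sym_matsD[OF assms(1)])
  have "x - y = x + (-1) \<cdot>\<^sub>v y" using assms by auto
  thus ?thesis
    using assms A qform_add[of A n x "(-1) \<cdot>\<^sub>v y"] qform_smult[OF A assms(3), of "-1"]
    by (simp add: mult_mat_vec[OF A assms(3)])
qed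

lemma qform_congruence:
  assumes "X \<in> carrier_mat k n" "S \<in> carrier_mat k k" "x \<in> carrier_vec n"
  shows "qform (X\<^sup>T * S * X) x = qform S (X *\<^sub>v x)"
proof -
  have "(X\<^sup>T * S * X) *\<^sub>v x = (X\<^sup>T * S) *\<^sub>v (X *\<^sub>v x)"
    by (rule assoc_mult_mat_vec[of _ n k _ n]) (use assms in auto)
  also have "\<dots> = X\<^sup>T *\<^sub>v (S *\<^sub>v (X *\<^sub>v x))"
    by (rule assoc_mult_mat_vec[of _ n k _ k]) (use assms in auto)
  finally have "(X\<^sup>T * S * X) *\<^sub>v x = X\<^sup>T *\<^sub>v (S *\<^sub>v (X *\<^sub>v x))" .
  moreover have "x \<bullet> (X\<^sup>T *\<^sub>v (S *\<^sub>v (X *\<^sub>v x))) = ((X\<^sup>T)\<^sup>T *\<^sub>v x) \<bullet> (S *\<^sub>v (X *\<^sub>v x))"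
    by (rule scalar_prod_transpose[of _ n k]) (use assms in auto)
  ultimately show ?thesis by (simp add: qform_def)
qed

lemma qform_minus_mat:
  assumes "A \<in> carrier_mat n n" "B \<in> carrier_mat n n" "x \<in> carrier_vec n"
  shows "qform (A - B) x = qform A x - qform B x"
  using assms
  by (simp add: qform_def minus_mult_distrib_mat_vec[OF assms] scalar_prod_minus_distrib[of _ n])

lemma qform_uminus_mat:
  assumes "A \<in> carrier_mat n n" "x \<in> carrier_vec n"
  shows "qform (- A) x = - qform A x"
  using assms by (simp add: qform_def)

lemma qform_smult_mat:
  assumes "A \<in> carrier_mat n n" "x \<in> carrier_vec n"
  shows "qform (c \<cdot>\<^sub>m A) x = c * qform A x"
proof -
  have "(c \<cdot>\<^sub>m A) *\<^sub>v x = c \<cdot>\<^sub>v (A *\<^sub>v x)"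
    using assms by (intro eq_vecI) auto
  thus ?thesis using assms by (simp add: qform_def)
qed

lemma congruence_sym_mats:
  assumes X: "X \<in> carrier_mat k n" and S: "S \<in> sym_mats k"
  shows "X\<^sup>T * S * X \<in> sym_mats n"
proof -
  have S': "S \<in> carrier_mat k k" "S\<^sup>T = S" using S by (auto simp: sym_mats_def)
  have "(X\<^sup>T * S * X)\<^sup>T = X\<^sup>T * (X\<^sup>T * S)\<^sup>T"
    by (rule transpose_mult[of _ n k]) (use X S' in auto)
  also have "(X\<^sup>T * S)\<^sup>T = S * X"
    using transpose_mult[of "X\<^sup>T" n k S k] X S' by auto
  also have "X\<^sup>T * (S * X) = X\<^sup>T * S * X"
    by (rule assoc_mult_mat[symmetric, of _ n k _ k _ n]) (use X S' in auto)
  finally show ?thesis using X S' by (auto simp: sym_mats_def)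
qed

lemma minus_sym_mats:
  assumes "A \<in> sym_mats n" "B \<in> sym_mats n"
  shows "A - B \<in> sym_mats n"
  using assms by (auto simp: sym_mats_def transpose_minus)

lemma uminus_sym_mats:
  assumes "A \<in> sym_mats n"
  shows "- A \<in> sym_mats n"
  using assms by (auto simp: sym_mats_def transpose_uminus)

lemma smult_sym_mats:
  assumes "A \<in> sym_mats n"
  shows "c \<cdot>\<^sub>m A \<in> sym_mats n"
proof -
  have "(c \<cdot>\<^sub>m A)\<^sup>T = c \<cdot>\<^sub>m A\<^sup>T" by (intro eq_matI) auto
  thus ?thesis using assms by (auto simp: sym_mats_def)
qed

lemma pos_def_iff:
  assumes "A \<in> carrier_mat n n"
  shows "pos_def A \<longleftrightarrow> A \<in> sym_mats n \<and> (\<forall>x\<in>carrier_vec n. x \<noteq> 0\<^sub>v n \<longrightarrow> qform A x > 0)"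
  using assms by (auto simp: pos_def_def qform_def)

lemma pos_semidef_iff:
  assumes "A \<in> carrier_mat n n"
  shows "pos_semidef A \<longleftrightarrow> A \<in> sym_mats n \<and> (\<forall>x\<in>carrier_vec n. qform A x \<ge> 0)"
  using assms by (auto simp: pos_semidef_def qform_def)

lemma neg_def_iff:
  assumes "A \<in> carrier_mat n n"
  shows "neg_def A \<longleftrightarrow> A \<in> sym_mats n \<and> (\<forall>x\<in>carrier_vec n. x \<noteq> 0\<^sub>v n \<longrightarrow> qform A x < 0)"
proof -
  have "- A \<in> sym_mats n \<longleftrightarrow> A \<in> sym_mats n"
    using uminus_sym_mats[of A n] uminus_sym_mats[of "- A" n] assms by auto
  thus ?thesis
    using pos_def_iff[of "- A" n] assms by (auto simp: neg_def_def qform_uminus_mat)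
qed

lemma pos_def_imp_qform_nonneg:
  assumes "pos_def A" "A \<in> carrier_mat n n" "x \<in> carrier_vec n"
  shows "qform A x \<ge> 0"
  using assms by (cases "x = 0\<^sub>v n") (auto simp: pos_def_iff less_imp_le)

section \<open>Inverses\<close>

lemma mat_inv_if_injective:
  fixes A :: "real mat"
  assumes A: "A \<in> carrier_mat n n"
    and inj: "\<And>x. x \<in> carrier_vec n \<Longrightarrow> A *\<^sub>v x = 0\<^sub>v n \<Longrightarrow> x = 0\<^sub>v n"
  shows "mat_inv A \<in> carrier_mat n n" "A * mat_inv A = 1\<^sub>m n" "mat_inv A * A = 1\<^sub>m n"
    "invertible_mat A"
proof -
  have "det A \<noteq> 0" using det_0_iff_vec_prod_zero_field[OF A] inj by auto
  hence "A \<in> Units (ring_mat TYPE(real) n ())" by (rule det_non_zero_imp_unit[OF A])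
  then obtain B where B: "mat_inverse A = Some B"
    using mat_inverse(1)[OF A, of "()"] by (cases "mat_inverse A") auto
  from mat_inverse(2)[OF A B] B
  show *: "mat_inv A \<in> carrier_mat n n" "A * mat_inv A = 1\<^sub>m n" "mat_inv A * A = 1\<^sub>m n"
    by (auto simp: mat_inv_def)
  show "invertible_mat A"
    using * A by (auto simp: invertible_mat_def inverts_mat_def)
qed

lemma inverse_mult_mat_vec:
  fixes A :: "real mat"
  assumes "A \<in> carrier_mat n n" "B \<in> carrier_mat n n" "A * B = 1\<^sub>m n" "x \<in> carrier_vec n"
  shows "A *\<^sub>v (B *\<^sub>v x) = x"
  using assms by (metis assoc_mult_mat_vec one_mult_mat_vec)

lemma pos_def_injective:
  assumes "pos_def A" "A \<in> carrier_mat n n" "x \<in> carrier_vec n" "A *\<^sub>v x = 0\<^sub>v n"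
  shows "x = 0\<^sub>v n"
  using assms by (force simp: pos_def_iff qform_def)

lemma pos_def_mat_inv:
  assumes "pos_def A" "A \<in> carrier_mat n n"
  shows "mat_inv A \<in> carrier_mat n n" "A * mat_inv A = 1\<^sub>m n" "mat_inv A * A = 1\<^sub>m n"
    "invertible_mat A"
proof -
  have inj: "\<And>x. x \<in> carrier_vec n \<Longrightarrow> A *\<^sub>v x = 0\<^sub>v n \<Longrightarrow> x = 0\<^sub>v n"
    by (rule pos_def_injective[OF assms])
  show "mat_inv A \<in> carrier_mat n n" by (rule mat_inv_if_injective(1)[OF assms(2)]) (rule inj)
  show "A * mat_inv A = 1\<^sub>m n" by (rule mat_inv_if_injective(2)[OF assms(2)]) (rule inj)
  show "mat_inv A * A = 1\<^sub>m n" by (rule mat_inv_if_injective(3)[OF assms(2)]) (rule inj)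
  show "invertible_mat A" by (rule mat_inv_if_injective(4)[OF assms(2)]) (rule inj)
qed

lemma sym_mats_inverse:
  assumes A: "A \<in> sym_mats n" and B: "B \<in> carrier_mat n n" "A * B = 1\<^sub>m n" "B * A = 1\<^sub>m n"
  shows "B \<in> sym_mats n"
proof -
  have A': "A \<in> carrier_mat n n" "A\<^sup>T = A" using A by (auto simp: sym_mats_def)
  have "B\<^sup>T = B\<^sup>T * (A * B)" using B by simp
  also have "\<dots> = B\<^sup>T * A * B" using A' B by (intro assoc_mult_mat[symmetric]) auto
  also have "B\<^sup>T * A = 1\<^sub>m n" using transpose_mult[of A n n B n] A' B by simp
  finally show ?thesis using B by (auto simp: sym_mats_def)
qed

lemma pos_def_inverse:
  assumes pd: "pos_def A" and A: "A \<in> carrier_mat n n"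
  shows "pos_def (mat_inv A)"
proof -
  note B = pos_def_mat_inv[OF pd A]
  have sym: "mat_inv A \<in> sym_mats n"
    using sym_mats_inverse[of A n "mat_inv A"] B pd A by (auto simp: pos_def_iff)
  have "qform (mat_inv A) x > 0" if x: "x \<in> carrier_vec n" "x \<noteq> 0\<^sub>v n" for x
  proof -
    let ?y = "mat_inv A *\<^sub>v x"
    have y: "?y \<in> carrier_vec n" "A *\<^sub>v ?y = x"
      using B x A by (auto intro: inverse_mult_mat_vec)
    hence "?y \<noteq> 0\<^sub>v n" using x(2) mult_mat_zero_vec[OF A] by metis
    hence "qform A ?y > 0" using pd A y by (auto simp: pos_def_iff)
    thus ?thesis using y x B by (simp add: qform_def comm_scalar_prod[of x n])
  qed
  thus ?thesis using sym B by (auto simp: pos_def_iff)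
qed

text \<open>The four Penrose equations determine the inverse of an invertible matrix, so the definite
description picks it: \<open>A X A = A\<close> alone forces \<open>X = A\<^sup>-\<^sup>1\<close>.\<close>

lemma pinv_eq_inverse:
  assumes A: "A \<in> carrier_mat n n" and B: "B \<in> carrier_mat n n" "A * B = 1\<^sub>m n" "B * A = 1\<^sub>m n"
  shows "pinv A = B"
  unfolding pinv_def
proof (rule the_equality)
  show "B \<in> carrier_mat (dim_col A) (dim_row A) \<and> A * B * A = A \<and> B * A * B = B \<and>
    (A * B)\<^sup>T = A * B \<and> (B * A)\<^sup>T = B * A"
    using A B by auto
next
  fix X
  assume "X \<in> carrier_mat (dim_col A) (dim_row A) \<and> A * X * A = A \<and> X * A * X = X \<and>
    (A * X)\<^sup>T = A * X \<and> (X * A)\<^sup>T = X * A"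
  hence X: "X \<in> carrier_mat n n" "A * X * A = A" using A by auto
  have "X = (B * A) * X * (A * B)" using X B by auto
  also have "\<dots> = B * (A * X) * (A * B)"
    using A B X by (subst assoc_mult_mat[of B n n A n X n]) auto
  also have "\<dots> = B * (A * X * (A * B))"
    using A B X by (intro assoc_mult_mat[of _ n n _ n _ n]) auto
  also have "A * X * (A * B) = A * X * A * B"
    using A B X by (intro assoc_mult_mat[symmetric, of _ n n _ n _ n]) auto
  also have "\<dots> = 1\<^sub>m n" using X B by simp
  finally show "X = B" using B by simp
qed

section \<open>Block matrices acting on split vectors\<close>

lemma append_cols_carrier [simp, intro]:
  "A \<in> carrier_mat r k \<Longrightarrow> B \<in> carrier_mat r l \<Longrightarrow> A @\<^sub>c B \<in> carrier_mat r (k + l)"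
  by (auto simp: append_cols_def)

lemma append_cols_mult_vec:
  fixes A B :: "real mat"
  assumes "A \<in> carrier_mat r k" "B \<in> carrier_mat r l" "x \<in> carrier_vec k" "y \<in> carrier_vec l"
  shows "(A @\<^sub>c B) *\<^sub>v (x @\<^sub>v y) = A *\<^sub>v x + B *\<^sub>v y"
proof -
  have "(A @\<^sub>c B) *\<^sub>v (x @\<^sub>v y) =
      (A *\<^sub>v x + B *\<^sub>v y) @\<^sub>v (0\<^sub>m 0 k *\<^sub>v x + 0\<^sub>m 0 l *\<^sub>v y)"
    unfolding append_cols_def using assms
    by (subst four_block_mat_mult_vec[of _ r k _ l _ 0]) auto
  thus ?thesis using assms by (intro eq_vecI) auto
qed

lemma diag_block_pair:
  assumes "A \<in> carrier_mat k k'" "B \<in> carrier_mat l l'"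
  shows "diag_block_mat [A, B] = four_block_mat A (0\<^sub>m k l') (0\<^sub>m l k') B"
  using assms by (intro eq_matI) auto

lemma diag_block_mult_vec:
  fixes A B :: "real mat"
  assumes "A \<in> carrier_mat k k'" "B \<in> carrier_mat l l'" "x \<in> carrier_vec k'" "y \<in> carrier_vec l'"
  shows "diag_block_mat [A, B] *\<^sub>v (x @\<^sub>v y) = (A *\<^sub>v x) @\<^sub>v (B *\<^sub>v y)"
  using assms
  by (simp add: diag_block_pair[of A k k' B l l'] four_block_mat_mult_vec[of _ k k' _ l' _ l]
      del: diag_block_mat.simps)

lemma diag_block_carrier:
  assumes "A \<in> carrier_mat k k'" "B \<in> carrier_mat l l'"
  shows "diag_block_mat [A, B] \<in> carrier_mat (k + l) (k' + l')"
  using assms by (auto simp: dim_diag_block_mat)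

lemma qform_diag_block:
  assumes "A \<in> carrier_mat k k" "B \<in> carrier_mat l l" "x \<in> carrier_vec k" "y \<in> carrier_vec l"
  shows "qform (diag_block_mat [A, B]) (x @\<^sub>v y) = qform A x + qform B y"
  using assms
  by (simp add: qform_def diag_block_mult_vec[of A k k B l l] scalar_prod_append[of _ k _ l]
      del: diag_block_mat.simps)

lemma diag_block_sym_mats:
  assumes "A \<in> sym_mats k" "B \<in> sym_mats l"
  shows "diag_block_mat [A, B] \<in> sym_mats (k + l)"
  using assms
  by (auto simp: sym_mats_def diag_block_pair[of A k k B l l] transpose_four_block_mat[of _ k k _ l _ l]
      simp del: diag_block_mat.simps)

lemma vec_split:
  assumes "v \<in> carrier_vec (k + l)"
  obtains x y where "x \<in> carrier_vec k" "y \<in> carrier_vec l" "v = x @\<^sub>v y"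
  using assms vec_first_last_append[OF assms] by (metis vec_first_carrier vec_last_carrier)

lemma append_vec_0: "0\<^sub>v k @\<^sub>v 0\<^sub>v l = 0\<^sub>v (k + l)"
  by (auto simp: append_vec_def)

lemma append_vec_eq_0_iff:
  assumes "x \<in> carrier_vec k" "y \<in> carrier_vec l"
  shows "x @\<^sub>v y = 0\<^sub>v (k + l) \<longleftrightarrow> x = 0\<^sub>v k \<and> y = 0\<^sub>v l"
  using append_vec_eq[of x k "0\<^sub>v k" y "0\<^sub>v l"] assms by (simp add: append_vec_0)

lemma append_vec_assoc: "(x @\<^sub>v y) @\<^sub>v z = x @\<^sub>v (y @\<^sub>v z)"
  by (rule eq_vecI) (auto simp: nat_less_iff)

lemma append_rows_transpose:
  fixes A B :: "real mat"
  assumes "A \<in> carrier_mat k n" "B \<in> carrier_mat l n"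
  shows "(A @\<^sub>r B)\<^sup>T = A\<^sup>T @\<^sub>c B\<^sup>T"
  using assms unfolding append_rows_def append_cols_def
  by (subst transpose_four_block_mat[of _ k n _ 0 _ l]) auto

lemma append_rows_transpose_mult_vec:
  fixes A B :: "real mat"
  assumes "A \<in> carrier_mat k n" "B \<in> carrier_mat l n" "x \<in> carrier_vec k" "y \<in> carrier_vec l"
  shows "(A @\<^sub>r B)\<^sup>T *\<^sub>v (x @\<^sub>v y) = A\<^sup>T *\<^sub>v x + B\<^sup>T *\<^sub>v y"
  using assms by (simp add: append_rows_transpose[of A k n B l] append_cols_mult_vec[of _ n k _ l])

text \<open>The second LMI and the inequality satisfied by the designed controller have the shape on the left.
This turns them into inequalities between quadratic forms.\<close>

lemma pos_def_stacked_congruence_iff: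
  assumes M: "M \<in> sym_mats k" and P: "P \<in> sym_mats l"
    and A: "A \<in> carrier_mat k n" and B: "B \<in> carrier_mat l n"
  shows "pos_def ((A @\<^sub>r B)\<^sup>T * diag_block_mat [M, - P] * (A @\<^sub>r B)) \<longleftrightarrow>
    (\<forall>z\<in>carrier_vec n. z \<noteq> 0\<^sub>v n \<longrightarrow> qform M (A *\<^sub>v z) - qform P (B *\<^sub>v z) > 0)"
proof -
  have X: "A @\<^sub>r B \<in> carrier_mat (k + l) n" using A B by auto
  have S: "diag_block_mat [M, - P] \<in> sym_mats (k + l)"
    by (rule diag_block_sym_mats[OF M uminus_sym_mats[OF P]])
  note XSX = congruence_sym_mats[OF X S]
  have "qform ((A @\<^sub>r B)\<^sup>T * diag_block_mat [M, - P] * (A @\<^sub>r B)) z =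
      qform M (A *\<^sub>v z) - qform P (B *\<^sub>v z)" if z: "z \<in> carrier_vec n" for z
    using qform_congruence[OF X sym_matsD(1)[OF S] z] sym_matsD(1)[OF M] sym_matsD(1)[OF P] A B z
    by (simp add: mat_mult_append[OF A B z] qform_diag_block[of _ k _ l] qform_uminus_mat[of _ l]
        del: diag_block_mat.simps)
  thus ?thesis
    using XSX unfolding pos_def_iff[OF sym_matsD(1)[OF XSX]] by auto
qed

section \<open>Completing the square\<close>

text \<open>Negative definiteness of the lower right block, phrased without the block: this is the form in
which the property passes from \<open>PI\<close> to \<open>N\<close> and from \<open>N\<close> to \<open>Nbar\<close>, because each of these forms is
the previous one composed with a linear map.\<close>

lemma neg_def_block22_iff:
  assumes S: "S \<in> sym_mats (k + l)"
  shows "neg_def (block22 k S) \<longleftrightarrow>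
    (\<forall>y\<in>carrier_vec l. y \<noteq> 0\<^sub>v l \<longrightarrow> qform S (0\<^sub>v k @\<^sub>v y) < 0)"
proof -
  have Sc: "S \<in> carrier_mat (k + l) (k + l)" and St: "S\<^sup>T = S" using sym_matsD[OF S] by auto
  obtain A B C D where split: "split_block S k k = (A, B, C, D)" by (cases "split_block S k k") auto
  note blk = split_block[OF split, of l l]
  have c: "A \<in> carrier_mat k k" "B \<in> carrier_mat k l" "C \<in> carrier_mat l k" "D \<in> carrier_mat l l"
    and S_eq: "S = four_block_mat A B C D"
    using blk Sc by auto
  have D_eq: "block22 k S = D" by (simp add: block22_def split)
  have "D $$ (j, i) = D $$ (i, j)" if "i < l" "j < l" for i j
    using arg_cong[OF St[unfolded S_eq], of "\<lambda>M. M $$ (k + i, k + j)"] that c by simp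
  hence "D\<^sup>T = D" using c by (intro eq_matI) auto
  hence "D \<in> sym_mats l" using c by (simp add: sym_mats_def)
  moreover have "qform S (0\<^sub>v k @\<^sub>v y) = qform D y" if "y \<in> carrier_vec l" for y
    unfolding qform_def S_eq using c that
    by (simp add: four_block_mat_mult_vec[of _ k k _ l _ l] scalar_prod_append[of _ k _ l])
  ultimately show ?thesis unfolding D_eq neg_def_iff[OF c(4)] by auto
qed

text \<open>Eliminating \<open>y\<close> from the quadratic form of a symmetric matrix whose lower right block \<open>D\<close> is
negative definite: with \<open>S = [A, B; C, D]\<close> and \<open>Z = - D\<^sup>-\<^sup>1 C\<close>, the mixed terms are absorbed into
\<open>y - Z x\<close>, and the Schur complement is what remains in \<open>x\<close>. As \<open>D\<close> is invertible, its pseudo-inverse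
is its inverse. Every later statement about a generalized Schur complement is read off from this
identity.\<close>

lemma schur_complete_square:
  assumes S: "S \<in> sym_mats (k + l)" and neg: "neg_def (block22 k S)"
  obtains Z where "Z \<in> carrier_mat l k" "block22 k S \<in> carrier_mat l l"
    "schur_compl k S \<in> sym_mats k"
    "\<And>x y. x \<in> carrier_vec k \<Longrightarrow> y \<in> carrier_vec l \<Longrightarrow>
       qform S (x @\<^sub>v y) = qform (schur_compl k S) x + qform (block22 k S) (y - Z *\<^sub>v x)"
proof -
  have Sc: "S \<in> carrier_mat (k + l) (k + l)" and St: "S\<^sup>T = S" using sym_matsD[OF S] by auto
  obtain A B C D where split: "split_block S k k = (A, B, C, D)" by (cases "split_block S k k") auto
  note blk = split_block[OF split, of l l]
  have c: "A \<in> carrier_mat k k" "B \<in> carrier_mat k l" "C \<in> carrier_mat l k" "D \<in> carrier_mat l l"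
    and S_eq: "S = four_block_mat A B C D"
    using blk Sc by auto
  have D_eq: "block22 k S = D" by (simp add: block22_def split)
  have At: "A\<^sup>T = A" and Bt: "B\<^sup>T = C" and Dt: "D\<^sup>T = D"
  proof -
    have *: "A $$ (i, j) = A $$ (j, i)" if "i < k" "j < k" for i j
      using arg_cong[OF St[unfolded S_eq], of "\<lambda>M. M $$ (i, j)"] that c by simp
    show "A\<^sup>T = A" using c by (intro eq_matI) (auto simp: *)
    have *: "B $$ (j, i) = C $$ (i, j)" if "i < l" "j < k" for i j
      using arg_cong[OF St[unfolded S_eq], of "\<lambda>M. M $$ (k + i, j)"] that c by simp
    show "B\<^sup>T = C" using c by (intro eq_matI) (auto simp: *)
    have *: "D $$ (j, i) = D $$ (i, j)" if "i < l" "j < l" for i j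
      using arg_cong[OF St[unfolded S_eq], of "\<lambda>M. M $$ (k + i, k + j)"] that c by simp
    show "D\<^sup>T = D" using c by (intro eq_matI) (auto simp: *)
  qed
  have Ds: "D \<in> sym_mats l" using Dt c by (simp add: sym_mats_def)
  have inj: "x = 0\<^sub>v l" if "x \<in> carrier_vec l" "D *\<^sub>v x = 0\<^sub>v l" for x
    using neg that c unfolding D_eq by (force simp: neg_def_iff[of D l] qform_def)
  define E where "E = mat_inv D"
  have E: "E \<in> carrier_mat l l" "D * E = 1\<^sub>m l" "E * D = 1\<^sub>m l"
    using mat_inv_if_injective[OF c(4) inj] by (auto simp: E_def)
  have schur: "schur_compl k S = A - B * E * C"
    unfolding schur_compl_def split using pinv_eq_inverse[OF c(4) E] by simp
  have Es: "E \<in> sym_mats l" by (rule sym_mats_inverse[OF Ds E])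
  have BEC: "B * E * C \<in> sym_mats k"
    using congruence_sym_mats[OF c(3) Es] Bt c by (metis transpose_transpose)
  define Z where "Z = - (E * C)"
  have Z: "Z \<in> carrier_mat l k" using E c by (auto simp: Z_def)
  have "qform S (x @\<^sub>v y) = qform (schur_compl k S) x + qform D (y - Z *\<^sub>v x)"
    if x: "x \<in> carrier_vec k" and y: "y \<in> carrier_vec l" for x y
  proof -
    let ?z = "E *\<^sub>v (C *\<^sub>v x)"
    have z: "?z \<in> carrier_vec l" using E c x by auto
    have Dz: "D *\<^sub>v ?z = C *\<^sub>v x" using c E x by (intro inverse_mult_mat_vec) auto
    have yz: "y - Z *\<^sub>v x = y + ?z"
      using x y E c z by (auto simp: Z_def)
    have "qform S (x @\<^sub>v y) = x \<bullet> (A *\<^sub>v x + B *\<^sub>v y) + y \<bullet> (C *\<^sub>v x + D *\<^sub>v y)"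
      unfolding qform_def S_eq using c x y
      by (simp add: four_block_mat_mult_vec[of _ k k _ l _ l] scalar_prod_append[of _ k _ l])
    also have "\<dots> = qform A x + x \<bullet> (B *\<^sub>v y) + y \<bullet> (C *\<^sub>v x) + qform D y"
      using c x y by (simp add: qform_def scalar_prod_add_distrib[of _ k] scalar_prod_add_distrib[of _ l])
    also have "x \<bullet> (B *\<^sub>v y) = y \<bullet> (C *\<^sub>v x)"
      using scalar_prod_transpose[OF c(2) x y] Bt c x y
      by (metis comm_scalar_prod mult_mat_vec_carrier)
    finally have 1: "qform S (x @\<^sub>v y) = qform A x + 2 * (y \<bullet> (C *\<^sub>v x)) + qform D y" by simp
    have "qform (B * E * C) x = qform E (C *\<^sub>v x)"
      using qform_congruence[OF c(3) E(1) x] Bt by (metis transpose_transpose)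
    also have "\<dots> = qform D ?z"
      unfolding qform_def Dz using c E x
      by (intro comm_scalar_prod[of _ l]) auto
    finally have 2: "qform (schur_compl k S) x = qform A x - qform D ?z"
      using schur qform_minus_mat[OF c(1) sym_matsD(1)[OF BEC] x] by simp
    have 3: "qform D (y - Z *\<^sub>v x) = qform D y + 2 * (y \<bullet> (C *\<^sub>v x)) + qform D ?z"
      unfolding yz using qform_add[OF Ds y z] Dz by simp
    show ?thesis using 1 2 3 by simp
  qed
  moreover have "schur_compl k S \<in> sym_mats k"
    unfolding schur using minus_sym_mats[OF _ BEC] At c by (auto simp: sym_mats_def)
  ultimately show ?thesis using that Z c D_eq by auto
qed

section \<open>The strict S-lemma\<close>

text \<open>The heart of the S-lemma. As \<open>qform G\<close> is positive at \<open>a\<close> and negative at \<open>b\<close>, it vanishes at two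
points \<open>a + t\<^sub>1 b\<close> and \<open>a + t\<^sub>2 b\<close> with \<open>t\<^sub>2 < 0 < t\<^sub>1\<close>. There \<open>qform F\<close> is positive, and a positive
combination of these two inequalities cancels the mixed term \<open>a \<bullet> F b\<close>. What remains compares the
quotients \<open>F / G\<close> at \<open>a\<close> and \<open>b\<close>.\<close>

lemma strict_S_lemma_two_vectors:
  assumes F: "F \<in> sym_mats n" and G: "G \<in> sym_mats n"
    and imp: "\<And>v. v \<in> carrier_vec n \<Longrightarrow> v \<noteq> 0\<^sub>v n \<Longrightarrow> qform G v \<ge> 0 \<Longrightarrow> qform F v > 0"
    and a: "a \<in> carrier_vec n" "qform G a > 0" and b: "b \<in> carrier_vec n" "qform G b < 0"
  shows "qform F b / qform G b < qform F a / qform G a"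
proof -
  define \<beta> where "\<beta> = - qform G b"
  define h where "h = a \<bullet> (G *\<^sub>v b)"
  define s where "s = sqrt (h\<^sup>2 + qform G a * \<beta>)"
  have \<beta>: "\<beta> > 0" using b by (simp add: \<beta>_def)
  have s2: "s\<^sup>2 = h\<^sup>2 + qform G a * \<beta>"
    unfolding s_def using a \<beta> by (intro real_sqrt_pow2) (simp add: less_imp_le)
  have "\<bar>h\<bar> < s"
    unfolding s_def using a \<beta> by (intro real_less_rsqrt) simp
  define t1 t2 where "t1 = (h + s) / \<beta>" and "t2 = (h - s) / \<beta>"
  have t: "t1 > 0" "t2 < 0" using \<open>\<bar>h\<bar> < s\<close> \<beta> by (auto simp: t1_def t2_def divide_simps)
  have prod: "t1 * t2 = - qform G a / \<beta>"
  proof -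
    have "t1 * t2 = (h\<^sup>2 - s\<^sup>2) / \<beta>\<^sup>2"
      by (simp add: t1_def t2_def power2_eq_square algebra_simps)
    thus ?thesis using \<beta> s2 by (simp add: power2_eq_square)
  qed
  have qf: "qform M (a + t \<cdot>\<^sub>v b) = qform M a + 2 * t * (a \<bullet> (M *\<^sub>v b)) + t\<^sup>2 * qform M b"
    if M: "M \<in> sym_mats n" for M t
    using qform_add[OF M a(1), of "t \<cdot>\<^sub>v b"] qform_smult[OF sym_matsD(1)[OF M] b(1)] b a
    using sym_matsD(1)[OF M] by (simp add: mult_mat_vec[OF _ b(1)])
  have pos: "qform F (a + t \<cdot>\<^sub>v b) > 0" if root: "qform G a + 2 * t * h - t\<^sup>2 * \<beta> = 0" for t
  proof (rule imp)
    have g0: "qform G (a + t \<cdot>\<^sub>v b) = 0"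
      using root unfolding qf[OF G] h_def \<beta>_def by simp
    thus "qform G (a + t \<cdot>\<^sub>v b) \<ge> 0" by simp
    show "a + t \<cdot>\<^sub>v b \<noteq> 0\<^sub>v n"
    proof
      assume eq: "a + t \<cdot>\<^sub>v b = 0\<^sub>v n"
      have "a $ i = ((- t) \<cdot>\<^sub>v b) $ i" if "i < n" for i
        using arg_cong[OF eq, of "\<lambda>v. v $ i"] that a b by simp
      hence "a = (- t) \<cdot>\<^sub>v b" using a b by (intro eq_vecI) auto
      hence "qform G a = t\<^sup>2 * qform G b"
        using qform_smult[OF sym_matsD(1)[OF G] b(1), of "- t"] by simp
      also have "\<dots> \<le> 0" using b by (simp add: mult_nonneg_nonpos)
      finally show False using a by simp
    qed
  qed (use a b in auto)
  have "qform G a + 2 * t1 * h - t1\<^sup>2 * \<beta> = (qform G a * \<beta> + h\<^sup>2 - s\<^sup>2) / \<beta>"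
    using \<beta> by (simp add: t1_def field_simps power2_eq_square)
  hence "qform F (a + t1 \<cdot>\<^sub>v b) > 0" using s2 by (intro pos) simp
  hence 1: "qform F a + 2 * t1 * (a \<bullet> (F *\<^sub>v b)) + t1\<^sup>2 * qform F b > 0" by (simp add: qf[OF F])
  have "qform G a + 2 * t2 * h - t2\<^sup>2 * \<beta> = (qform G a * \<beta> + h\<^sup>2 - s\<^sup>2) / \<beta>"
    using \<beta> by (simp add: t2_def field_simps power2_eq_square)
  hence "qform F (a + t2 \<cdot>\<^sub>v b) > 0" using s2 by (intro pos) simp
  hence 2: "qform F a + 2 * t2 * (a \<bullet> (F *\<^sub>v b)) + t2\<^sup>2 * qform F b > 0" by (simp add: qf[OF F])
  have "0 < (- t2) * (qform F a + 2 * t1 * (a \<bullet> (F *\<^sub>v b)) + t1\<^sup>2 * qform F b)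
      + t1 * (qform F a + 2 * t2 * (a \<bullet> (F *\<^sub>v b)) + t2\<^sup>2 * qform F b)"
    by (rule add_pos_pos[OF mult_pos_pos[OF _ 1] mult_pos_pos[OF _ 2]]) (use t in auto)
  also have "\<dots> = (t1 - t2) * (qform F a - t1 * t2 * qform F b)"
    by (simp add: algebra_simps power2_eq_square)
  finally have "qform F a + qform G a / \<beta> * qform F b > 0"
    using t prod by (simp add: zero_less_mult_iff)
  hence "0 < (qform F a + qform G a / \<beta> * qform F b) / qform G a"
    using a by simp
  also have "\<dots> = qform F a / qform G a + qform F b / \<beta>"
    using a by (simp add: add_divide_distrib)
  finally show ?thesis using \<beta>_def by simp
qed

text \<open>Bolzano-Weierstrass, one coordinate at a time.\<close>

lemma bounded_vec_sequence_convergent_subsequence: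
  fixes x :: "nat \<Rightarrow> real vec"
  assumes "\<And>k i. i < n \<Longrightarrow> \<bar>x k $ i\<bar> \<le> c"
  shows "\<exists>r l. strict_mono r \<and> l \<in> carrier_vec n \<and> (\<forall>i<n. (\<lambda>k. x (r k) $ i) \<longlonglongrightarrow> l $ i)"
  using assms
proof (induction n)
  case 0
  have "strict_mono (id :: nat \<Rightarrow> nat)" by (simp add: strict_mono_def)
  thus ?case by (intro exI[of _ "id :: nat \<Rightarrow> nat"] exI[of _ "0\<^sub>v 0"]) (simp del: id_apply)
next
  case (Suc n)
  have "\<exists>r l. strict_mono r \<and> l \<in> carrier_vec n \<and> (\<forall>i<n. (\<lambda>k. x (r k) $ i) \<longlonglongrightarrow> l $ i)"
    by (rule Suc.IH) (use Suc.prems in auto)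
  then obtain r l where r: "strict_mono r" "l \<in> carrier_vec n"
    and lim: "\<And>i. i < n \<Longrightarrow> (\<lambda>k. x (r k) $ i) \<longlonglongrightarrow> l $ i" by auto
  obtain r' where r': "strict_mono r'" "monoseq (\<lambda>k. x (r (r' k)) $ n)"
    using seq_monosub[of "\<lambda>k. x (r k) $ n"] by auto
  have "Bseq (\<lambda>k. x (r (r' k)) $ n)"
    using Suc.prems[of n] by (intro BseqI'[of _ c]) auto
  then obtain z where z: "(\<lambda>k. x (r (r' k)) $ n) \<longlonglongrightarrow> z"
    using r' Bseq_monoseq_convergent by (auto simp: convergent_def)
  show ?case
  proof (intro exI conjI allI impI)
    show "strict_mono (r \<circ> r')" using r r' by (intro strict_mono_o)
    show "vec (Suc n) (\<lambda>i. if i = n then z else l $ i) \<in> carrier_vec (Suc n)" by simp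
    fix i assume i: "i < Suc n"
    show "(\<lambda>k. x ((r \<circ> r') k) $ i) \<longlonglongrightarrow> vec (Suc n) (\<lambda>i. if i = n then z else l $ i) $ i"
    proof (cases "i = n")
      case False
      hence "i < n" using i by simp
      from LIMSEQ_subseq_LIMSEQ[OF lim[OF this] r'(1)] show ?thesis
        using False i by (simp add: o_def)
    qed (use z in \<open>simp add: o_def\<close>)
  qed
qed

lemma tendsto_qform:
  assumes A: "A \<in> carrier_mat n n" and x: "\<And>k. x k \<in> carrier_vec n" "l \<in> carrier_vec n"
    and lim: "\<And>i. i < n \<Longrightarrow> (\<lambda>k. x k $ i) \<longlonglongrightarrow> l $ i"
  shows "(\<lambda>k. qform A (x k)) \<longlonglongrightarrow> qform A l"
proof -
  have *: "qform A v = (\<Sum>i<n. v $ i * (\<Sum>j<n. A $$ (i, j) * v $ j))" if "v \<in> carrier_vec n" for v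
    using that A by (simp add: qform_def scalar_prod_def lessThan_atLeast0)
  show ?thesis
    unfolding *[OF x(1)] *[OF x(2)] by (intro tendsto_intros lim) auto
qed

lemma qform_one: "x \<in> carrier_vec n \<Longrightarrow> qform (1\<^sub>m n) x = x \<bullet> x"
  by (simp add: qform_def)

text \<open>Compactness of the unit sphere makes a strict implication between quadratic forms robust. If every
margin failed, unit vectors violating smaller and smaller margins would accumulate at a unit vector
where the implication itself fails.\<close>

lemma qform_implication_margin:
  assumes F: "F \<in> sym_mats n" and G: "G \<in> sym_mats n"
    and imp: "\<And>v. v \<in> carrier_vec n \<Longrightarrow> v \<noteq> 0\<^sub>v n \<Longrightarrow> qform G v \<ge> 0 \<Longrightarrow> qform F v > 0"
  obtains \<epsilon> where "\<epsilon> > 0"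
    "\<And>v. v \<in> carrier_vec n \<Longrightarrow> v \<noteq> 0\<^sub>v n \<Longrightarrow> qform G v \<ge> - \<epsilon> * (v \<bullet> v) \<Longrightarrow> qform F v > \<epsilon> * (v \<bullet> v)"
proof (rule ccontr)
  note Fc = sym_matsD(1)[OF F] and Gc = sym_matsD(1)[OF G]
  assume no: "\<not> thesis"
  note choose_margin = that
  have "\<exists>v. v \<in> carrier_vec n \<and> v \<bullet> v = 1 \<and> qform G v \<ge> - inverse (real (Suc k)) \<and>
      qform F v \<le> inverse (real (Suc k))" for k
  proof -
    define e where "e = inverse (real (Suc k))"
    have "e > 0" by (simp add: e_def)
    then obtain v where v: "v \<in> carrier_vec n" "v \<noteq> 0\<^sub>v n"
      "qform G v \<ge> - e * (v \<bullet> v)" "qform F v \<le> e * (v \<bullet> v)"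
      using no choose_margin[of e] by (meson not_le)
    define c where "c = v \<bullet> v"
    have c: "c > 0" using scalar_prod_self_pos v by (simp add: c_def)
    define w where "w = inverse (sqrt c) \<cdot>\<^sub>v v"
    have w: "w \<in> carrier_vec n" using v by (simp add: w_def)
    have qw: "qform M w = qform M v / c" if "M \<in> carrier_mat n n" for M
      using qform_smult[OF that v(1), of "inverse (sqrt c)"] c
      by (simp add: w_def power_inverse divide_inverse mult.commute)
    have "w \<bullet> w = 1" using qw[of "1\<^sub>m n"] c w v by (simp add: qform_one c_def)
    moreover have "qform G w \<ge> - e" "qform F w \<le> e"
      using v(3,4) c unfolding qw[OF Fc] qw[OF Gc] c_def[symmetric] by (auto simp: field_simps)
    ultimately show ?thesis using w unfolding e_def by blast
  qed
  then obtain w where w: "\<And>k. w k \<in> carrier_vec n" "\<And>k. w k \<bullet> w k = 1"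
    "\<And>k. qform G (w k) \<ge> - inverse (real (Suc k))" "\<And>k. qform F (w k) \<le> inverse (real (Suc k))"
    by metis
  have "\<bar>w k $ i\<bar> \<le> 1" if "i < n" for k i
  proof -
    have "(w k $ i)\<^sup>2 \<le> (\<Sum>j\<in>{0..<n}. (w k $ j)\<^sup>2)"
      by (rule member_le_sum) (use that in auto)
    also have "\<dots> = 1" using w(2)[of k] w(1)[of k] by (simp add: scalar_prod_def power2_eq_square)
    finally show ?thesis by (simp add: abs_square_le_1)
  qed
  from bounded_vec_sequence_convergent_subsequence[of n w 1, OF this] obtain r l where
    r: "strict_mono r" "l \<in> carrier_vec n" "\<And>i. i < n \<Longrightarrow> (\<lambda>k. w (r k) $ i) \<longlonglongrightarrow> l $ i"
    by blast
  have lim: "(\<lambda>k. qform M (w (r k))) \<longlonglongrightarrow> qform M l" if "M \<in> carrier_mat n n" for M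
    by (rule tendsto_qform[OF that]) (use r w in auto)
  have inv0: "(\<lambda>k. inverse (real (Suc (r k)))) \<longlonglongrightarrow> 0"
    using LIMSEQ_subseq_LIMSEQ[OF LIMSEQ_inverse_real_of_nat r(1)] by (simp add: o_def)
  have "qform (1\<^sub>m n) l = 1"
    using lim[of "1\<^sub>m n"] w by (simp add: qform_one LIMSEQ_const_iff)
  hence "l \<noteq> 0\<^sub>v n" by auto
  moreover have "0 \<le> qform G l"
    using tendsto_minus[OF inv0] lim[OF Gc] w(3) by (intro LIMSEQ_le) auto
  moreover have "qform F l \<le> 0"
    using inv0 lim[OF Fc] w(4) by (intro LIMSEQ_le) auto
  ultimately show False using imp[of l] r by auto
qed

text \<open>By the comparison of two vectors, the quotients \<open>F / G\<close> on \<open>{G < 0}\<close> lie below those on \<open>{G > 0}\<close>,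
so any nonnegative number in between serves as multiplier, which gives a weak inequality. Running this for the
perturbed forms \<open>F - \<epsilon>\<close> and \<open>G + \<epsilon>\<close> from the compactness argument turns it into a strict one. The
vector \<open>v0\<close> guarantees that the perturbed \<open>G\<close> is positive somewhere, so that the supremum of the
lower quotients is finite.\<close>

lemma strict_S_lemma:
  assumes F: "F \<in> sym_mats n" and G: "G \<in> sym_mats n"
    and imp: "\<And>v. v \<in> carrier_vec n \<Longrightarrow> v \<noteq> 0\<^sub>v n \<Longrightarrow> qform G v \<ge> 0 \<Longrightarrow> qform F v > 0"
    and v0: "v0 \<in> carrier_vec n" "v0 \<noteq> 0\<^sub>v n" "qform G v0 \<ge> 0"
  obtains \<alpha> where "\<alpha> \<ge> 0"
    "\<And>v. v \<in> carrier_vec n \<Longrightarrow> v \<noteq> 0\<^sub>v n \<Longrightarrow> qform F v - \<alpha> * qform G v > 0"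
proof -
  note Fc = sym_matsD(1)[OF F] and Gc = sym_matsD(1)[OF G]
  obtain \<epsilon> where \<epsilon>: "\<epsilon> > 0" and margin:
    "\<And>v. v \<in> carrier_vec n \<Longrightarrow> v \<noteq> 0\<^sub>v n \<Longrightarrow> qform G v \<ge> - \<epsilon> * (v \<bullet> v) \<Longrightarrow> qform F v > \<epsilon> * (v \<bullet> v)"
    using qform_implication_margin[OF F G imp] by metis
  \<comment> \<open>\<open>G'\<close> is \<open>G\<close> plus \<open>\<epsilon>\<close> times the identity, written as a difference for \<open>qform_minus_mat\<close>.\<close>
  define F' G' where "F' = F - \<epsilon> \<cdot>\<^sub>m 1\<^sub>m n" and "G' = G - (- \<epsilon>) \<cdot>\<^sub>m 1\<^sub>m n"
  have one: "1\<^sub>m n \<in> sym_mats n" by (simp add: sym_mats_def)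
  have sym: "F' \<in> sym_mats n" "G' \<in> sym_mats n"
    unfolding F'_def G'_def using F G one by (auto intro: minus_sym_mats smult_sym_mats)
  have qF: "qform F' v = qform F v - \<epsilon> * (v \<bullet> v)" and qG: "qform G' v = qform G v + \<epsilon> * (v \<bullet> v)"
    if "v \<in> carrier_vec n" for v
    using that Fc Gc unfolding F'_def G'_def
    by (simp_all add: qform_minus_mat[of _ n] qform_smult_mat[of _ n] qform_one)
  have imp': "qform F' v > 0" if "v \<in> carrier_vec n" "v \<noteq> 0\<^sub>v n" "qform G' v \<ge> 0" for v
    using margin[of v] that by (simp add: qF qG)
  have v0': "qform G' v0 > 0"
    using v0 \<epsilon> scalar_prod_self_pos[OF v0(1,2)] by (simp add: qG add_nonneg_pos)
  define S where "S = insert 0 {qform F' b / qform G' b | b. b \<in> carrier_vec n \<and> qform G' b < 0}"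
  have upper: "x \<le> qform F' a / qform G' a"
    if "x \<in> S" "a \<in> carrier_vec n" "qform G' a > 0" for x a
  proof -
    have "a \<noteq> 0\<^sub>v n" using that sym_matsD(1)[OF sym(2)] by auto
    hence "qform F' a > 0" using imp'[of a] that by auto
    thus ?thesis
      using that strict_S_lemma_two_vectors[OF sym imp', of a]
      by (auto simp: S_def intro: less_imp_le)
  qed
  define \<alpha> where "\<alpha> = Sup S"
  have bdd: "bdd_above S" by (rule bdd_aboveI[OF upper[OF _ v0(1) v0']])
  have "0 \<in> S" by (simp add: S_def)
  have \<alpha>0: "\<alpha> \<ge> 0" unfolding \<alpha>_def by (rule cSup_upper[OF \<open>0 \<in> S\<close> bdd])
  have nonneg: "qform F' v - \<alpha> * qform G' v \<ge> 0" if v: "v \<in> carrier_vec n" for v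
  proof (cases "qform G' v" "0 :: real" rule: linorder_cases)
    case less
    hence "qform F' v / qform G' v \<in> S" using v by (auto simp: S_def)
    hence "qform F' v / qform G' v \<le> \<alpha>" unfolding \<alpha>_def using bdd by (rule cSup_upper)
    thus ?thesis using less by (simp add: field_simps)
  next
    case equal
    thus ?thesis using imp'[OF v] sym_matsD(1)[OF sym(1)]
      by (cases "v = 0\<^sub>v n") (auto simp: less_imp_le)
  next
    case greater
    have "\<alpha> \<le> qform F' v / qform G' v"
      unfolding \<alpha>_def using \<open>0 \<in> S\<close> upper[OF _ v greater] by (intro cSup_least) auto
    thus ?thesis using greater by (simp add: field_simps)
  qed
  have "qform F v - \<alpha> * qform G v > 0" if v: "v \<in> carrier_vec n" "v \<noteq> 0\<^sub>v n" for v
  proof -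
    have "v \<bullet> v > 0" using scalar_prod_self_pos v by blast
    hence "\<epsilon> * (v \<bullet> v) > 0" "\<alpha> * (\<epsilon> * (v \<bullet> v)) \<ge> 0" using \<epsilon> \<alpha>0 by auto
    thus ?thesis using nonneg[OF v(1)] v by (simp add: qF qG algebra_simps)
  qed
  thus ?thesis using that \<alpha>0 by blast
qed

section \<open>Cauchy-Schwarz, coercivity and full row rank\<close>

text \<open>For a form that is only semidefinite the case \<open>qform A y = 0\<close> needs its own argument: then
\<open>qform A (x - t y)\<close> is affine in \<open>t\<close> and bounded below, hence constant.\<close>

lemma qform_Cauchy_Schwarz:
  assumes A: "A \<in> sym_mats n" and nonneg: "\<And>z. z \<in> carrier_vec n \<Longrightarrow> qform A z \<ge> 0"
    and x: "x \<in> carrier_vec n" and y: "y \<in> carrier_vec n"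
  shows "(x \<bullet> (A *\<^sub>v y))\<^sup>2 \<le> qform A x * qform A y"
proof -
  note Ac = sym_matsD(1)[OF A]
  have q: "qform A (s \<cdot>\<^sub>v x - t \<cdot>\<^sub>v y) = s\<^sup>2 * qform A x - 2 * s * t * (x \<bullet> (A *\<^sub>v y)) + t\<^sup>2 * qform A y" for s t
    using qform_diff[OF A, of "s \<cdot>\<^sub>v x" "t \<cdot>\<^sub>v y"] x y Ac
    by (simp add: qform_smult[OF Ac] mult_mat_vec[OF Ac])
  show ?thesis
  proof (cases "qform A y = 0")
    case True
    have "x \<bullet> (A *\<^sub>v y) = 0"
    proof (rule ccontr)
      assume h: "x \<bullet> (A *\<^sub>v y) \<noteq> 0"
      have "0 \<le> qform A (1 \<cdot>\<^sub>v x - ((qform A x + 1) / (2 * (x \<bullet> (A *\<^sub>v y)))) \<cdot>\<^sub>v y)"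
        using x y by (intro nonneg) auto
      also have "\<dots> = -1" unfolding q using True h by (simp add: field_simps)
      finally show False by simp
    qed
    thus ?thesis using True by simp
  next
    case False
    hence pos: "qform A y > 0" using nonneg[OF y] by simp
    have "0 \<le> qform A (qform A y \<cdot>\<^sub>v x - (x \<bullet> (A *\<^sub>v y)) \<cdot>\<^sub>v y)"
      using x y by (intro nonneg) auto
    also have "\<dots> = qform A y * (qform A x * qform A y - (x \<bullet> (A *\<^sub>v y))\<^sup>2)"
      unfolding q by (simp add: power2_eq_square algebra_simps)
    finally show ?thesis using pos by (simp add: zero_le_mult_iff)
  qed
qed

lemma pos_def_coercive:
  assumes pd: "pos_def A" and A: "A \<in> carrier_mat n n"
  obtains \<epsilon> where "\<epsilon> > 0" "\<And>x. x \<in> carrier_vec n \<Longrightarrow> qform A x \<ge> \<epsilon> * (x \<bullet> x)"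
proof -
  have As: "A \<in> sym_mats n" using pd A by (simp add: pos_def_iff)
  have zero: "0\<^sub>m n n \<in> sym_mats n" by (simp add: sym_mats_def)
  have "qform A v > 0" if "v \<in> carrier_vec n" "v \<noteq> 0\<^sub>v n" for v
    using pd that A by (auto simp: pos_def_iff)
  then obtain \<epsilon> where \<epsilon>: "\<epsilon> > 0" "\<And>v. v \<in> carrier_vec n \<Longrightarrow> v \<noteq> 0\<^sub>v n \<Longrightarrow>
      qform (0\<^sub>m n n) v \<ge> - \<epsilon> * (v \<bullet> v) \<Longrightarrow> qform A v > \<epsilon> * (v \<bullet> v)"
    using qform_implication_margin[OF As zero] by blast
  have "qform A x \<ge> \<epsilon> * (x \<bullet> x)" if x: "x \<in> carrier_vec n" for x
  proof (cases "x = 0\<^sub>v n")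
    case False
    have "qform (0\<^sub>m n n) x = 0" using x by (simp add: qform_def)
    thus ?thesis using \<epsilon>(2)[OF x False] \<epsilon>(1) scalar_prod_self_nonneg[of x] by simp
  qed (use A in auto)
  thus ?thesis using that \<epsilon> by blast
qed

text \<open>Among the columns of \<open>H\<close> there are \<open>n\<close> linearly independent ones. They form an invertible matrix
\<open>B\<close>, and a vector in the kernel of the transpose of \<open>H\<close> is in the kernel of the transpose of \<open>B\<close>.\<close>

lemma full_row_rank_transpose_injective:
  fixes H :: "real mat"
  assumes H: "H \<in> carrier_mat n k" and rank: "vec_space.rank n H = n"
    and x: "x \<in> carrier_vec n" "H\<^sup>T *\<^sub>v x = 0\<^sub>v k"
  shows "x = 0\<^sub>v n"
proof -
  interpret vec_space "TYPE(real)" n .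
  have "\<exists>U. maximal U (\<lambda>T. T \<subseteq> set (cols H) \<and> lin_indpt T)"
    using maximal_exists_superset[of "set (cols H)" "\<lambda>T. T \<subseteq> set (cols H) \<and> lin_indpt T" "{}"]
    by (auto simp: lin_dep_def)
  then obtain U where U: "maximal U (\<lambda>T. T \<subseteq> set (cols H) \<and> lin_indpt T)" by auto
  hence sub: "U \<subseteq> set (cols H)" "lin_indpt U" by (auto simp: maximal_def)
  have card: "card U = n" using rank_card_indpt[OF H U] rank by simp
  have fin: "finite U" using sub finite_subset by auto
  then obtain us where us: "set us = U" "distinct us" using finite_distinct_list by auto
  have len: "length us = n" using us card distinct_card by metis
  have uc: "set us \<subseteq> carrier_vec n" using us sub H cols_dim[of H] by auto
  define B where "B = mat_of_cols n us"
  have B: "B \<in> carrier_mat n n" using len by (auto simp: B_def)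
  have cols: "cols B = us" unfolding B_def using uc by simp
  have "rank B = n"
    by (rule lin_indpt_full_rank[OF B]) (use cols us sub in auto)
  hence "det B \<noteq> 0" using det_rank_iff[OF B] by simp
  hence det: "det B\<^sup>T \<noteq> 0" using det_transpose[OF B] by simp
  have "B\<^sup>T *\<^sub>v x = 0\<^sub>v n"
  proof (rule eq_vecI)
    fix i assume "i < dim_vec (0\<^sub>v n :: real vec)"
    hence i: "i < n" by simp
    have "col B i \<in> set (cols H)"
      using i B len cols us sub by (metis cols_length cols_nth nth_mem subsetD carrier_matD(2))
    then obtain j where j: "j < k" "col B i = col H j"
      using H by (auto simp: cols_def)
    have "(B\<^sup>T *\<^sub>v x) $ i = col H j \<bullet> x" using i B j by simp
    also have "\<dots> = (H\<^sup>T *\<^sub>v x) $ j" using j H by simp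
    finally show "(B\<^sup>T *\<^sub>v x) $ i = 0\<^sub>v n $ i" using x j i by simp
  qed (use B in auto)
  thus ?thesis using det det_0_iff_vec_prod_zero_field[of "B\<^sup>T" n] B x by auto
qed

section \<open>Duality of the Lyapunov inequality\<close>

text \<open>For \<open>\<Psi> = \<Phi>\<^sup>-\<^sup>1\<close>, the inequality \<open>A \<Phi> A\<^sup>T < \<Phi>\<close> implies \<open>A\<^sup>T \<Psi> A < \<Psi>\<close>; exchanging \<open>\<Phi>\<close> with \<open>\<Psi>\<close> and
\<open>A\<close> with \<open>A\<^sup>T\<close> gives the converse. Instead of Schur complements, the proof expands \<open>0 \<le> qform \<Phi> (A\<^sup>T z - \<Psi> x)\<close> for \<open>z = \<Psi> A x\<close>; its mixed term is
\<open>qform \<Psi> (A x)\<close>.\<close>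

lemma lyapunov_inequality_dual:
  assumes \<Phi>: "\<Phi> \<in> sym_mats n" and \<Psi>: "\<Psi> \<in> carrier_mat n n" "\<Phi> * \<Psi> = 1\<^sub>m n" "\<Psi> * \<Phi> = 1\<^sub>m n"
    and nonneg: "\<And>x. x \<in> carrier_vec n \<Longrightarrow> qform \<Phi> x \<ge> 0"
    and A: "A \<in> carrier_mat n n"
    and decr: "\<And>x. x \<in> carrier_vec n \<Longrightarrow> x \<noteq> 0\<^sub>v n \<Longrightarrow> qform \<Phi> (A\<^sup>T *\<^sub>v x) < qform \<Phi> x"
    and x: "x \<in> carrier_vec n" "x \<noteq> 0\<^sub>v n"
  shows "qform \<Psi> (A *\<^sub>v x) < qform \<Psi> x"
proof -
  note \<Phi>c = sym_matsD(1)[OF \<Phi>]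
  have \<Phi>\<Psi>: "\<Phi> *\<^sub>v (\<Psi> *\<^sub>v w) = w" if "w \<in> carrier_vec n" for w
    by (rule inverse_mult_mat_vec[OF \<Phi>c \<Psi>(1,2) that])
  have qform_\<Psi>: "qform \<Psi> w = qform \<Phi> (\<Psi> *\<^sub>v w)" if "w \<in> carrier_vec n" for w
    using that \<Psi>(1) by (simp add: qform_def \<Phi>\<Psi> comm_scalar_prod[of w n])
  define y where "y = A *\<^sub>v x"
  define z where "z = \<Psi> *\<^sub>v y"
  have y: "y \<in> carrier_vec n" using A x by (simp add: y_def)
  have z: "z \<in> carrier_vec n" using \<Psi> y by (simp add: z_def)
  have x': "\<Psi> *\<^sub>v x \<in> carrier_vec n" using \<Psi> x by simp
  have az: "A\<^sup>T *\<^sub>v z \<in> carrier_vec n" using A z by simp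
  have pos_x: "qform \<Psi> x > 0"
  proof -
    have "\<Psi> *\<^sub>v x \<noteq> 0\<^sub>v n" using \<Phi>\<Psi>[OF x(1)] x \<Phi>c by (metis mult_mat_zero_vec)
    hence "qform \<Phi> (A\<^sup>T *\<^sub>v (\<Psi> *\<^sub>v x)) < qform \<Phi> (\<Psi> *\<^sub>v x)" by (intro decr x')
    moreover have "0 \<le> qform \<Phi> (A\<^sup>T *\<^sub>v (\<Psi> *\<^sub>v x))" by (rule nonneg) (use A x' in auto)
    ultimately show ?thesis using qform_\<Psi>[OF x(1)] by simp
  qed
  show ?thesis
  proof (cases "z = 0\<^sub>v n")
    case True
    hence "qform \<Psi> y = 0" using y by (simp add: qform_def z_def[symmetric])
    thus ?thesis using pos_x by (simp add: y_def)
  next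
    case False
    have "0 \<le> qform \<Phi> (A\<^sup>T *\<^sub>v z - \<Psi> *\<^sub>v x)" using az x' by (intro nonneg) auto
    also have "\<dots> = qform \<Phi> (A\<^sup>T *\<^sub>v z) - 2 * ((A\<^sup>T *\<^sub>v z) \<bullet> x) + qform \<Psi> x"
      using qform_diff[OF \<Phi> az x'] by (simp add: \<Phi>\<Psi> x qform_\<Psi>)
    also have "(A\<^sup>T *\<^sub>v z) \<bullet> x = z \<bullet> y"
      using scalar_prod_transpose[OF A z x(1)] by (simp add: y_def)
    also have "z \<bullet> y = qform \<Psi> y"
      using y z by (simp add: qform_def z_def comm_scalar_prod[of _ n])
    finally have "2 * qform \<Psi> y \<le> qform \<Phi> (A\<^sup>T *\<^sub>v z) + qform \<Psi> x" by simp
    moreover have "qform \<Phi> (A\<^sup>T *\<^sub>v z) < qform \<Psi> y"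
      using decr[OF z False] qform_\<Psi>[OF y] by (simp add: z_def)
    ultimately show ?thesis by (simp add: y_def)
  qed
qed

section \<open>The set of compatible systems\<close>

text \<open>The systems compatible with the data are so many that they reach every admissible pair of vectors: a
pair at which the form of \<open>N\<close> is nonnegative lies on the graph of some compatible \<open>R\<^sup>T\<close>. This is why
a condition on all compatible systems is the same as a condition on vectors, to which the S-lemma for
a single pair of quadratic forms applies. Write the form of \<open>N\<close> at \<open>(a, y)\<close> as
\<open>a \<bullet> D a - |y - Z a|\<^sup>2\<close>, the norm being that of the negated lower right block. The solution is a rank-one correction of the centre, \<open>R\<^sup>T = Z + s (D a)\<^sup>T / (a \<bullet> D a)\<close> with \<open>s = y - Z a\<close>;
Cauchy-Schwarz for \<open>D\<close> shows that it is compatible.\<close>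

lemma compatible_interpolation:
  assumes N: "N \<in> sym_mats (k + n)" and neg: "neg_def (block22 k N)"
    and R0: "R0 \<in> carrier_mat k n" "\<And>a. a \<in> carrier_vec k \<Longrightarrow> qform N (a @\<^sub>v R0\<^sup>T *\<^sub>v a) \<ge> 0"
    and a: "a \<in> carrier_vec k" and y: "y \<in> carrier_vec n" and nonneg: "qform N (a @\<^sub>v y) \<ge> 0"
  obtains R where "R \<in> carrier_mat k n" "R\<^sup>T *\<^sub>v a = y"
    "\<And>b. b \<in> carrier_vec k \<Longrightarrow> qform N (b @\<^sub>v R\<^sup>T *\<^sub>v b) \<ge> 0"
proof -
  obtain Z where Z: "Z \<in> carrier_mat n k" and N22: "block22 k N \<in> carrier_mat n n"
    and D: "schur_compl k N \<in> sym_mats k"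
    and square: "\<And>x y. x \<in> carrier_vec k \<Longrightarrow> y \<in> carrier_vec n \<Longrightarrow>
       qform N (x @\<^sub>v y) = qform (schur_compl k N) x + qform (block22 k N) (y - Z *\<^sub>v x)"
    using schur_complete_square[OF N neg] by metis
  let ?D = "schur_compl k N" and ?P = "block22 k N"
  note Dc = sym_matsD(1)[OF D]
  have P_neg: "qform ?P w < 0" if "w \<in> carrier_vec n" "w \<noteq> 0\<^sub>v n" for w
    using neg that N22 by (auto simp: neg_def_iff)
  have P_nonpos: "qform ?P w \<le> 0" if "w \<in> carrier_vec n" for w
    using P_neg[OF that] N22 by (cases "w = 0\<^sub>v n") (auto simp: less_imp_le)
  have D_nonneg: "qform ?D b \<ge> 0" if b: "b \<in> carrier_vec k" for b
  proof -
    have "0 \<le> qform N (b @\<^sub>v R0\<^sup>T *\<^sub>v b)" by (rule R0(2)[OF b])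
    also have "\<dots> \<le> qform ?D b"
      using square[OF b, of "R0\<^sup>T *\<^sub>v b"] P_nonpos[of "R0\<^sup>T *\<^sub>v b - Z *\<^sub>v b"] R0 Z b by simp
    finally show ?thesis .
  qed
  define s where "s = y - Z *\<^sub>v a"
  have s: "s \<in> carrier_vec n" using y Z a by (simp add: s_def)
  have y_eq: "y = Z *\<^sub>v a + s" using y Z a by (intro eq_vecI) (auto simp: s_def)
  have sP: "qform ?D a + qform ?P s \<ge> 0" using nonneg square[OF a y] by (simp add: s_def)
  define d where "d = qform ?D a"
  define f where "f = ?D *\<^sub>v a"
  have f: "f \<in> carrier_vec k" using Dc a by (simp add: f_def)
  \<comment> \<open>If \<open>d = 0\<close>, then \<open>s = 0\<close>, and the convention \<open>x / 0 = 0\<close> makes the correction vanish as it should.\<close>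
  define Y where "Y = mat n k (\<lambda>(i, j). Z $$ (i, j) + (s $ i / d) * f $ j)"
  have Y: "Y \<in> carrier_mat n k" by (simp add: Y_def)
  have Yb: "Y *\<^sub>v b = Z *\<^sub>v b + ((f \<bullet> b) / d) \<cdot>\<^sub>v s" if b: "b \<in> carrier_vec k" for b
  proof (rule eq_vecI)
    fix i assume "i < dim_vec (Z *\<^sub>v b + ((f \<bullet> b) / d) \<cdot>\<^sub>v s)"
    hence i: "i < n" using s by simp
    have "(Y *\<^sub>v b) $ i = (\<Sum>j\<in>{0..<k}. (Z $$ (i, j) + (s $ i / d) * f $ j) * b $ j)"
      using i b by (simp add: Y_def scalar_prod_def)
    also have "\<dots> = (\<Sum>j\<in>{0..<k}. Z $$ (i, j) * b $ j) + (s $ i / d) * (\<Sum>j\<in>{0..<k}. f $ j * b $ j)"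
      by (simp add: sum.distrib sum_distrib_left algebra_simps)
    also have "\<dots> = (Z *\<^sub>v b + ((f \<bullet> b) / d) \<cdot>\<^sub>v s) $ i"
      using i b Z s by (simp add: scalar_prod_def)
    finally show "(Y *\<^sub>v b) $ i = (Z *\<^sub>v b + ((f \<bullet> b) / d) \<cdot>\<^sub>v s) $ i" .
  qed (use Y s in auto)
  have Ya: "Y *\<^sub>v a = y"
  proof (cases "d = 0")
    case True
    hence "s = 0\<^sub>v n" using sP P_neg[OF s] by (force simp: d_def)
    thus ?thesis unfolding Yb[OF a] y_eq using Z a by (intro eq_vecI) auto
  next
    case False
    have "f \<bullet> a = d" using f a by (simp add: d_def f_def qform_def comm_scalar_prod[of _ k])
    thus ?thesis unfolding Yb[OF a] y_eq using False s by simp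
  qed
  have "qform N (b @\<^sub>v Y *\<^sub>v b) \<ge> 0" if b: "b \<in> carrier_vec k" for b
  proof -
    define c where "c = f \<bullet> b"
    have cb: "c = b \<bullet> (?D *\<^sub>v a)" using f b by (simp add: c_def f_def comm_scalar_prod[of _ k])
    have CS: "c\<^sup>2 \<le> qform ?D b * d"
      unfolding cb d_def using D_nonneg by (intro qform_Cauchy_Schwarz[OF D _ b a])
    have "Y *\<^sub>v b - Z *\<^sub>v b = (c / d) \<cdot>\<^sub>v s"
      unfolding Yb[OF b] c_def using Z b s by (intro eq_vecI) auto
    hence "qform N (b @\<^sub>v Y *\<^sub>v b) = qform ?D b + (c / d)\<^sup>2 * qform ?P s"
      using square[OF b, of "Y *\<^sub>v b"] Y b qform_smult[OF N22 s] by simp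
    also have "\<dots> \<ge> 0"
    proof (cases "d = 0")
      case False
      hence d: "d > 0" using D_nonneg[OF a] by (simp add: d_def)
      have "(c / d)\<^sup>2 * (- qform ?P s) \<le> (c / d)\<^sup>2 * d"
        using sP by (intro mult_left_mono) (auto simp: d_def)
      also have "\<dots> = c\<^sup>2 / d" using d by (simp add: power2_eq_square)
      also have "\<dots> \<le> qform ?D b" using CS d by (simp add: field_simps)
      finally show ?thesis by simp
    qed (use D_nonneg[OF b] in simp)
    finally show ?thesis .
  qed
  thus ?thesis using that[of "Y\<^sup>T"] Y Ya by simp
qed

section \<open>Elimination of a free block column\<close>

text \<open>The projection step that removes the controller. The idea is to restrict \<open>M\<close> to the range of \<open>W\<close>: as
\<open>W z\<close> for \<open>z = V W\<^sup>T M x\<close> is the \<open>M\<close>-orthogonal projection of \<open>x\<close> onto this range, \<open>qform M x\<close> splits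
into the parts of \<open>W z\<close> and of the remainder. The linear map whose form is subtracted depends on \<open>z\<close>
only, so the inequality on the range of \<open>W\<close> and the positivity of \<open>M\<close> add up.\<close>

lemma elimination_sufficient:
  assumes M: "M \<in> sym_mats d" and M_pos: "\<And>x. x \<in> carrier_vec d \<Longrightarrow> x \<noteq> 0\<^sub>v d \<Longrightarrow> qform M x > 0"
    and W: "W \<in> carrier_mat d k"
    and V: "V \<in> carrier_mat k k" "W\<^sup>T * M * W * V = 1\<^sub>m k"
    and P: "P \<in> carrier_mat n n" and K: "K \<in> carrier_mat n k"
    and LMI: "\<And>z. z \<in> carrier_vec k \<Longrightarrow> z \<noteq> 0\<^sub>v k \<Longrightarrow> qform M (W *\<^sub>v z) - qform P (K *\<^sub>v z) > 0"
    and x: "x \<in> carrier_vec d" "x \<noteq> 0\<^sub>v d"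
  shows "qform M x - qform P (K *\<^sub>v (V *\<^sub>v (W\<^sup>T *\<^sub>v (M *\<^sub>v x)))) > 0"
proof -
  note Mc = sym_matsD(1)[OF M]
  define h where "h = W\<^sup>T *\<^sub>v (M *\<^sub>v x)"
  define z where "z = V *\<^sub>v h"
  define r where "r = x - W *\<^sub>v z"
  have h: "h \<in> carrier_vec k" using W Mc x by (simp add: h_def)
  have z: "z \<in> carrier_vec k" using V h by (simp add: z_def)
  have Wz: "W *\<^sub>v z \<in> carrier_vec d" using W z by simp
  have r: "r \<in> carrier_vec d" using x Wz by (simp add: r_def)
  have x_eq: "x = W *\<^sub>v z + r" using x Wz W by (intro eq_vecI) (auto simp: r_def)
  have WMWz: "W\<^sup>T *\<^sub>v (M *\<^sub>v (W *\<^sub>v z)) = h"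
  proof -
    have "W\<^sup>T *\<^sub>v (M *\<^sub>v (W *\<^sub>v z)) = (W\<^sup>T * M * W) *\<^sub>v z"
      using W Mc z assoc_mult_mat_vec[of "W\<^sup>T * M" k d W k z] assoc_mult_mat_vec[of "W\<^sup>T" k d M d "W *\<^sub>v z"]
      by auto
    also have "\<dots> = h"
      unfolding z_def by (rule inverse_mult_mat_vec[OF _ V h]) (use W Mc in auto)
    finally show ?thesis .
  qed
  have "W\<^sup>T *\<^sub>v (M *\<^sub>v r) = 0\<^sub>v k"
  proof -
    have "M *\<^sub>v r = M *\<^sub>v x - M *\<^sub>v (W *\<^sub>v z)"
      unfolding r_def by (rule mult_minus_distrib_mat_vec[OF Mc x(1) Wz])
    moreover have "W\<^sup>T *\<^sub>v (M *\<^sub>v x - M *\<^sub>v (W *\<^sub>v z)) = h - h"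
      using mult_minus_distrib_mat_vec[of "W\<^sup>T" k d "M *\<^sub>v x" "M *\<^sub>v (W *\<^sub>v z)"] W Mc x Wz WMWz h_def
      by simp
    ultimately show ?thesis using h by simp
  qed
  hence "z \<bullet> (W\<^sup>T *\<^sub>v (M *\<^sub>v r)) = 0" using z by simp
  hence orth: "(W *\<^sub>v z) \<bullet> (M *\<^sub>v r) = 0"
    using scalar_prod_transpose[of "W\<^sup>T" k d z "M *\<^sub>v r"] W Mc z r by simp
  have split: "qform M x = qform M (W *\<^sub>v z) + qform M r"
    using qform_add[OF M Wz r] orth x_eq by simp
  have "qform M (W *\<^sub>v z) - qform P (K *\<^sub>v z) + qform M r > 0"
  proof (cases "z = 0\<^sub>v k")
    case True
    hence "r = x" using x W by (simp add: r_def)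
    thus ?thesis using True M_pos[OF x] W Mc K P by simp
  next
    case False
    have "qform M r \<ge> 0" using M_pos[OF r] Mc by (cases "r = 0\<^sub>v d") (auto simp: less_imp_le)
    thus ?thesis using LMI[OF z False] by simp
  qed
  thus ?thesis using split by (simp add: z_def h_def)
qed

section \<open>From robust decrease to one matrix inequality\<close>

text \<open>The step from all compatible systems to one matrix inequality. By interpolation, the decrease for all
\<open>R\<close> says that the form of \<open>Nb\<close> being nonnegative at a nonzero \<open>(x, y)\<close> forces
\<open>qform \<Phi> x > qform \<Phi> (A\<^sup>T x + y)\<close>; the S-lemma provides the multiplier \<open>\<alpha>\<close>. It is not zero, because
\<open>qform \<Phi> x - qform \<Phi> (A\<^sup>T x + y)\<close> is negative at \<open>x = 0\<close> and \<open>y \<noteq> 0\<close>.\<close>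

lemma robust_decrease_imp_LMI:
  assumes N: "N \<in> sym_mats (k + n)" and neg: "neg_def (block22 k N)"
    and R0: "R0 \<in> carrier_mat k n" "\<And>a. a \<in> carrier_vec k \<Longrightarrow> qform N (a @\<^sub>v R0\<^sup>T *\<^sub>v a) \<ge> 0"
    and E: "E \<in> carrier_mat k n"
    and Nb: "Nb \<in> sym_mats (n + n)"
      "\<And>x y. x \<in> carrier_vec n \<Longrightarrow> y \<in> carrier_vec n \<Longrightarrow> qform Nb (x @\<^sub>v y) = qform N (E *\<^sub>v x @\<^sub>v y)"
    and A: "A \<in> carrier_mat n n"
    and \<Phi>: "\<Phi> \<in> sym_mats n" "\<And>x. x \<in> carrier_vec n \<Longrightarrow> x \<noteq> 0\<^sub>v n \<Longrightarrow> qform \<Phi> x > 0"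
    and n: "n > 0"
    and decr: "\<And>R x. R \<in> carrier_mat k n \<Longrightarrow>
       (\<And>a. a \<in> carrier_vec k \<Longrightarrow> qform N (a @\<^sub>v R\<^sup>T *\<^sub>v a) \<ge> 0) \<Longrightarrow>
       x \<in> carrier_vec n \<Longrightarrow> x \<noteq> 0\<^sub>v n \<Longrightarrow> qform \<Phi> (A\<^sup>T *\<^sub>v x + R\<^sup>T *\<^sub>v (E *\<^sub>v x)) < qform \<Phi> x"
  obtains \<alpha> where "\<alpha> > 0"
    "\<And>x y. x \<in> carrier_vec n \<Longrightarrow> y \<in> carrier_vec n \<Longrightarrow> \<not> (x = 0\<^sub>v n \<and> y = 0\<^sub>v n) \<Longrightarrow>
       qform \<Phi> x - qform \<Phi> (A\<^sup>T *\<^sub>v x + y) - \<alpha> * qform Nb (x @\<^sub>v y) > 0"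
proof -
  note \<Phi>c = sym_matsD(1)[OF \<Phi>(1)]
  define B where "B = A\<^sup>T @\<^sub>c 1\<^sub>m n"
  have B: "B \<in> carrier_mat n (n + n)" using A by (auto simp: B_def)
  define F where "F = diag_block_mat [\<Phi>, 0\<^sub>m n n] - B\<^sup>T * \<Phi> * B"
  have zs: "0\<^sub>m n n \<in> sym_mats n" by (simp add: sym_mats_def)
  note diag = diag_block_sym_mats[OF \<Phi>(1) zs] and BB = congruence_sym_mats[OF B \<Phi>(1)]
  have F: "F \<in> sym_mats (n + n)" unfolding F_def by (rule minus_sym_mats[OF diag BB])
  have qF: "qform F (x @\<^sub>v y) = qform \<Phi> x - qform \<Phi> (A\<^sup>T *\<^sub>v x + y)"
    if x: "x \<in> carrier_vec n" and y: "y \<in> carrier_vec n" for x y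
  proof -
    have xy: "x @\<^sub>v y \<in> carrier_vec (n + n)" using x y by simp
    have "B *\<^sub>v (x @\<^sub>v y) = A\<^sup>T *\<^sub>v x + y"
      unfolding B_def using append_cols_mult_vec[of "A\<^sup>T" n n "1\<^sub>m n" n x y] A x y by simp
    moreover have "qform (0\<^sub>m n n) y = 0" using y by (simp add: qform_def)
    ultimately show ?thesis
      unfolding F_def qform_minus_mat[OF sym_matsD(1)[OF diag] sym_matsD(1)[OF BB] xy]
      using qform_congruence[OF B \<Phi>c xy] qform_diag_block[OF \<Phi>c _ x y, of "0\<^sub>m n n"] by simp
  qed
  have imp: "qform F v > 0" if v: "v \<in> carrier_vec (n + n)" "v \<noteq> 0\<^sub>v (n + n)" "qform Nb v \<ge> 0" for v
  proof -
    obtain x y where xy: "x \<in> carrier_vec n" "y \<in> carrier_vec n" "v = x @\<^sub>v y"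
      using vec_split[OF v(1)] by metis
    have Ex: "E *\<^sub>v x \<in> carrier_vec k" using E xy by simp
    have "qform N (E *\<^sub>v x @\<^sub>v y) \<ge> 0" using v Nb(2) xy by simp
    have "x \<noteq> 0\<^sub>v n"
    proof
      assume x0: "x = 0\<^sub>v n"
      hence "y \<noteq> 0\<^sub>v n" using v xy append_vec_0[of n n] by auto
      hence "qform N (0\<^sub>v k @\<^sub>v y) < 0" using neg neg_def_block22_iff[OF N] xy by auto
      thus False using \<open>qform N (E *\<^sub>v x @\<^sub>v y) \<ge> 0\<close> x0 E by simp
    qed
    obtain R where R: "R \<in> carrier_mat k n" "R\<^sup>T *\<^sub>v (E *\<^sub>v x) = y"
      "\<And>b. b \<in> carrier_vec k \<Longrightarrow> qform N (b @\<^sub>v R\<^sup>T *\<^sub>v b) \<ge> 0"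
      using compatible_interpolation[OF N neg R0 Ex xy(2) \<open>qform N (E *\<^sub>v x @\<^sub>v y) \<ge> 0\<close>] by metis
    show ?thesis
      using decr[OF R(1,3) xy(1) \<open>x \<noteq> 0\<^sub>v n\<close>] R(2) qF[OF xy(1,2)] xy(3) by simp
  qed
  define e where "e = (unit_vec n 0 :: real vec)"
  have e: "e \<in> carrier_vec n" "e \<noteq> 0\<^sub>v n"
    using n by (auto simp: e_def dest: arg_cong[of _ _ "\<lambda>v. v $ 0"])
  define v0 where "v0 = e @\<^sub>v R0\<^sup>T *\<^sub>v (E *\<^sub>v e)"
  have v0: "v0 \<in> carrier_vec (n + n)" "v0 \<noteq> 0\<^sub>v (n + n)" "qform Nb v0 \<ge> 0"
  proof -
    have c: "R0\<^sup>T *\<^sub>v (E *\<^sub>v e) \<in> carrier_vec n" using R0 E e by simp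
    show "v0 \<in> carrier_vec (n + n)" using e c by (simp add: v0_def)
    show "v0 \<noteq> 0\<^sub>v (n + n)" unfolding v0_def using append_vec_eq_0_iff[OF e(1) c] e by simp
    show "qform Nb v0 \<ge> 0" unfolding v0_def Nb(2)[OF e(1) c] by (rule R0(2)) (use E e in simp)
  qed
  obtain \<alpha> where \<alpha>: "\<alpha> \<ge> 0"
    "\<And>v. v \<in> carrier_vec (n + n) \<Longrightarrow> v \<noteq> 0\<^sub>v (n + n) \<Longrightarrow> qform F v - \<alpha> * qform Nb v > 0"
    using strict_S_lemma[OF F Nb(1) imp v0] by metis
  have main: "qform \<Phi> x - qform \<Phi> (A\<^sup>T *\<^sub>v x + y) - \<alpha> * qform Nb (x @\<^sub>v y) > 0"
    if "x \<in> carrier_vec n" "y \<in> carrier_vec n" "\<not> (x = 0\<^sub>v n \<and> y = 0\<^sub>v n)" for x y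
    using \<alpha>(2)[of "x @\<^sub>v y"] qF[OF that(1,2)] append_vec_eq_0_iff[OF that(1,2)] that by simp
  have "\<alpha> \<noteq> 0"
  proof
    assume "\<alpha> = 0"
    hence "- qform \<Phi> e > 0" using main[of "0\<^sub>v n" e] e A \<Phi>c by simp
    thus False using \<Phi>(2)[OF e] by simp
  qed
  thus ?thesis using that[of \<alpha>] \<alpha>(1) main by simp
qed

section \<open>The block matrices of the LMIs\<close>

text \<open>Block diagonal matrices are only ever unfolded into pairs, hence the defining equation leaves the
simplifier.\<close>

lemma diag_block_mat_Cons2:
  "diag_block_mat [A, B, C] = diag_block_mat [A, diag_block_mat [B, C]]"
  unfolding diag_block_mat.simps(2)[of A "[B, C]"] diag_block_mat.simps(2)[of A "[diag_block_mat [B, C]]"]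
    diag_block_mat_singleton ..

declare diag_block_mat.simps(2) [simp del]

text \<open>The dimensions of the problem: \<open>n = q L\<close> is the length of the state \<open>(w(t), \<dots>, w(t + L - 1))\<close>, and
\<open>r = q (L - 1)\<close> is the length of the part that it shares with the next state.\<close>

locale io_dimensions =
  fixes p m L q n :: nat
  assumes p_pos: "p > 0" and m_pos: "m > 0" and L_pos: "L > 0"
    and q_def: "q = p + m" and n_def: "n = q * L"
begin

abbreviation "J \<equiv> J_mat p m L"
abbreviation "W \<equiv> W_mat p m L"
abbreviation "K \<equiv> K_mat p m L"

abbreviation "r \<equiv> q * (L - 1)"

text \<open>The matrix \<open>[0, 0, -I]\<close> through which the coefficient matrix \<open>R\<close> enters the closed loop: the
transition matrix is affine in \<open>R\<close> with linear part \<open>selection\<^sup>T * R\<close>.\<close>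

definition selection :: "real mat" where
  "selection = 0\<^sub>m p r @\<^sub>c 0\<^sub>m p m @\<^sub>c (- 1\<^sub>m p)"

text \<open>Its columns span a complement of the range of \<open>W\<close>: the coordinates that belong to the input in the
last sample of the first half of the vector.\<close>

definition input_embedding :: "real mat" where
  "input_embedding = 0\<^sub>m r m @\<^sub>r 1\<^sub>m m @\<^sub>r 0\<^sub>m (p + n) m"

lemma n_eq_last: "n = r + (m + p)"
  using L_pos by (cases L) (auto simp: n_def q_def algebra_simps)

lemma n_eq_first: "n = q + r"
  using L_pos by (cases L) (auto simp: n_def q_def algebra_simps)

lemma n_pos: "n > 0"
  using n_eq_last m_pos by simp

lemma J_carrier: "J \<in> carrier_mat r n"
  by (simp add: J_mat_def Let_def n_eq_first q_def[symmetric] append_cols_carrier)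

lemma J_mult_vec:
  assumes "x \<in> carrier_vec q" "y \<in> carrier_vec r"
  shows "J *\<^sub>v (x @\<^sub>v y) = y"
  using assms append_cols_mult_vec[of "0\<^sub>m r q" r q "1\<^sub>m r" r x y]
  by (simp add: J_mat_def Let_def q_def[symmetric])

lemma selection_carrier: "selection \<in> carrier_mat p n"
  unfolding selection_def n_eq_last by (intro append_cols_carrier) auto

lemma selection_mult_vec:
  assumes "x \<in> carrier_vec r" "u \<in> carrier_vec m" "y \<in> carrier_vec p"
  shows "selection *\<^sub>v (x @\<^sub>v u @\<^sub>v y) = - y"
proof -
  have "selection *\<^sub>v (x @\<^sub>v u @\<^sub>v y) = 0\<^sub>v p + (0\<^sub>v p + - y)"
    unfolding selection_def using assms
    by (simp add: append_cols_mult_vec[of _ p r _ "m + p"] append_cols_mult_vec[of _ p m _ p]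
        append_cols_carrier[of _ p m _ p])
  thus ?thesis using assms by simp
qed

lemma W_carrier: "W \<in> carrier_mat (n + n) (r + (p + n))"
proof -
  have "0\<^sub>m m p @\<^sub>r 1\<^sub>m p \<in> carrier_mat (m + p) p" by auto
  hence "diag_block_mat [0\<^sub>m m p @\<^sub>r 1\<^sub>m p, 1\<^sub>m n] \<in> carrier_mat ((m + p) + n) (p + n)"
    by (rule diag_block_carrier) auto
  hence "diag_block_mat [1\<^sub>m r, diag_block_mat [0\<^sub>m m p @\<^sub>r 1\<^sub>m p, 1\<^sub>m n]] \<in> carrier_mat (r + ((m + p) + n)) (r + (p + n))"
    by (intro diag_block_carrier) auto
  moreover have "r + ((m + p) + n) = n + n" by (subst (2) n_eq_last) simp
  ultimately show ?thesis
    unfolding W_mat_def Let_def q_def[symmetric] n_def[symmetric] diag_block_mat_Cons2 by (simp only:)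
qed

lemma W_mult_vec:
  assumes "x \<in> carrier_vec r" "y \<in> carrier_vec p" "z \<in> carrier_vec n"
  shows "W *\<^sub>v (x @\<^sub>v y @\<^sub>v z) = x @\<^sub>v (0\<^sub>v m @\<^sub>v y) @\<^sub>v z"
proof -
  have U: "0\<^sub>m m p @\<^sub>r 1\<^sub>m p \<in> carrier_mat (m + p) p" by auto
  have "diag_block_mat [0\<^sub>m m p @\<^sub>r 1\<^sub>m p, 1\<^sub>m n] \<in> carrier_mat ((m + p) + n) (p + n)"
    by (rule diag_block_carrier[OF U]) auto
  hence "W *\<^sub>v (x @\<^sub>v y @\<^sub>v z) =
      (1\<^sub>m r *\<^sub>v x) @\<^sub>v (diag_block_mat [0\<^sub>m m p @\<^sub>r 1\<^sub>m p, 1\<^sub>m n] *\<^sub>v (y @\<^sub>v z))"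
    unfolding W_mat_def Let_def q_def[symmetric] n_def[symmetric] diag_block_mat_Cons2
    using assms by (intro diag_block_mult_vec[of _ r r _ "(m + p) + n" "p + n"]) auto
  also have "diag_block_mat [0\<^sub>m m p @\<^sub>r 1\<^sub>m p, 1\<^sub>m n] *\<^sub>v (y @\<^sub>v z) =
      ((0\<^sub>m m p @\<^sub>r 1\<^sub>m p) *\<^sub>v y) @\<^sub>v (1\<^sub>m n *\<^sub>v z)"
    using assms by (intro diag_block_mult_vec[OF U]) auto
  also have "(0\<^sub>m m p @\<^sub>r 1\<^sub>m p) *\<^sub>v y = 0\<^sub>v m @\<^sub>v y"
    using assms by (simp add: mat_mult_append[of _ m p _ p])
  finally show ?thesis using assms by simp
qed

lemma K_carrier: "K \<in> carrier_mat n (r + (p + n))"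
proof -
  have "0\<^sub>m n p @\<^sub>c 1\<^sub>m n \<in> carrier_mat n (p + n)" by auto
  hence "J\<^sup>T @\<^sub>c (0\<^sub>m n p @\<^sub>c 1\<^sub>m n) \<in> carrier_mat n (r + (p + n))"
    by (intro append_cols_carrier) (use J_carrier in auto)
  thus ?thesis unfolding K_mat_def Let_def q_def[symmetric] n_def[symmetric] .
qed

lemma K_mult_vec:
  assumes "x \<in> carrier_vec r" "y \<in> carrier_vec p" "z \<in> carrier_vec n"
  shows "K *\<^sub>v (x @\<^sub>v y @\<^sub>v z) = J\<^sup>T *\<^sub>v x + z"
proof -
  have "0\<^sub>m n p @\<^sub>c 1\<^sub>m n \<in> carrier_mat n (p + n)" by auto
  hence "K *\<^sub>v (x @\<^sub>v y @\<^sub>v z) = J\<^sup>T *\<^sub>v x + (0\<^sub>m n p @\<^sub>c 1\<^sub>m n) *\<^sub>v (y @\<^sub>v z)"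
    unfolding K_mat_def Let_def q_def[symmetric] n_def[symmetric]
    using assms J_carrier by (intro append_cols_mult_vec[of _ n r _ "p + n"]) auto
  also have "(0\<^sub>m n p @\<^sub>c 1\<^sub>m n) *\<^sub>v (y @\<^sub>v z) = z"
    using assms by (simp add: append_cols_mult_vec[of _ n p _ n])
  finally show ?thesis .
qed

lemma input_embedding_carrier: "input_embedding \<in> carrier_mat (n + n) m"
proof -
  have "n + n = r + (m + (p + n))" by (subst (1) n_eq_last) simp
  thus ?thesis unfolding input_embedding_def by (metis carrier_append_rows one_carrier_mat zero_carrier_mat)
qed

lemma input_embedding_mult_vec:
  assumes u: "u \<in> carrier_vec m"
  shows "input_embedding *\<^sub>v u = (0\<^sub>v r @\<^sub>v u @\<^sub>v 0\<^sub>v p) @\<^sub>v 0\<^sub>v n"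
proof -
  have "1\<^sub>m m @\<^sub>r 0\<^sub>m (p + n) m \<in> carrier_mat (m + (p + n)) m" by auto
  hence "input_embedding *\<^sub>v u = 0\<^sub>v r @\<^sub>v (u @\<^sub>v 0\<^sub>v (p + n))"
    unfolding input_embedding_def using u
    by (simp add: mat_mult_append[of _ r m _ "m + (p + n)"] mat_mult_append[of _ m m _ "p + n"])
  thus ?thesis by (simp add: append_vec_assoc append_vec_0)
qed

text \<open>With \<open>v = 0\<close> the closed loop moves the state \<open>(w(t), \<dots>, w(t + L - 1))\<close> by this block companion
matrix: \<open>J\<close> drops \<open>w(t)\<close>, and the last rows compute \<open>u(t + L) = - C x\<close> and \<open>y(t + L) = - R x\<close>.\<close>

definition transition :: "real mat \<Rightarrow> real mat \<Rightarrow> real mat" where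
  "transition C R = J @\<^sub>r (- C) @\<^sub>r (- R)"

context
  fixes C R :: "real mat"
  assumes C: "C \<in> carrier_mat m n" and R: "R \<in> carrier_mat p n"
begin

lemma CR_carrier: "(- C) @\<^sub>r (- R) \<in> carrier_mat (m + p) n"
  using C R by (intro carrier_append_rows) auto

lemma transition_carrier: "transition C R \<in> carrier_mat n n"
  unfolding transition_def using J_carrier CR_carrier by (subst (1) n_eq_last) auto

lemma transition_mult_vec:
  assumes "x \<in> carrier_vec n"
  shows "transition C R *\<^sub>v x = J *\<^sub>v x @\<^sub>v (- (C *\<^sub>v x)) @\<^sub>v (- (R *\<^sub>v x))"
  unfolding transition_def using assms C R J_carrier
  by (simp add: mat_mult_append[OF J_carrier CR_carrier] mat_mult_append[of _ m n _ p])

lemma transition_transpose_mult_vec: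
  assumes "x \<in> carrier_vec r" "u \<in> carrier_vec m" "y \<in> carrier_vec p"
  shows "(transition C R)\<^sup>T *\<^sub>v (x @\<^sub>v u @\<^sub>v y) = J\<^sup>T *\<^sub>v x + (- (C\<^sup>T *\<^sub>v u) + - (R\<^sup>T *\<^sub>v y))"
proof -
  have "(transition C R)\<^sup>T *\<^sub>v (x @\<^sub>v u @\<^sub>v y) =
      J\<^sup>T *\<^sub>v x + ((- C) @\<^sub>r (- R))\<^sup>T *\<^sub>v (u @\<^sub>v y)"
    unfolding transition_def using assms
    by (intro append_rows_transpose_mult_vec[OF J_carrier CR_carrier]) auto
  also have "((- C) @\<^sub>r (- R))\<^sup>T *\<^sub>v (u @\<^sub>v y) = (- C)\<^sup>T *\<^sub>v u + (- R)\<^sup>T *\<^sub>v y"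
    using assms C R by (intro append_rows_transpose_mult_vec) auto
  also have "\<dots> = - (C\<^sup>T *\<^sub>v u) + - (R\<^sup>T *\<^sub>v y)"
    using assms C R by (simp add: transpose_uminus)
  finally show ?thesis .
qed

end

lemma transition_transpose_split:
  assumes C: "C \<in> carrier_mat m n" and R: "R \<in> carrier_mat p n" and x: "x \<in> carrier_vec n"
  shows "(transition C R)\<^sup>T *\<^sub>v x =
    (transition C (0\<^sub>m p n))\<^sup>T *\<^sub>v x + R\<^sup>T *\<^sub>v (selection *\<^sub>v x)"
proof -
  obtain a b where ab: "a \<in> carrier_vec r" "b \<in> carrier_vec (m + p)" "x = a @\<^sub>v b"
    using vec_split[of x r "m + p"] x n_eq_last by metis
  obtain u y where uy: "u \<in> carrier_vec m" "y \<in> carrier_vec p" "b = u @\<^sub>v y"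
    using vec_split[OF ab(2)] by metis
  have x_eq: "x = a @\<^sub>v u @\<^sub>v y" using ab uy by simp
  have R': "R\<^sup>T *\<^sub>v (- y) = - (R\<^sup>T *\<^sub>v y)"
    using mult_mat_vec[of "R\<^sup>T" n p y "-1"] R uy by (simp flip: uminus_mult_mat_vec) (intro eq_vecI, auto)
  have z: "(0\<^sub>m p n)\<^sup>T *\<^sub>v y = 0\<^sub>v n" using uy by simp
  show ?thesis
    unfolding x_eq transition_transpose_mult_vec[OF C R ab(1) uy(1,2)]
      transition_transpose_mult_vec[OF C zero_carrier_mat ab(1) uy(1,2)]
      selection_mult_vec[OF ab(1) uy(1,2)] R' z
    using J_carrier C R ab uy by (intro eq_vecI) auto
qed

text \<open>The matrix inequality in the definition of informativity is the decrease of \<open>\<Psi>\<close> along the closed loop: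
\<open>(x, - C x, - R x)\<close> is also \<open>w(t)\<close> followed by the next state.\<close>

lemma quadratic_stabilization_form:
  assumes C: "C \<in> carrier_mat m n" and R: "R \<in> carrier_mat p n" and \<Psi>: "\<Psi> \<in> sym_mats n"
  shows "neg_def ((1\<^sub>m n @\<^sub>r (- C) @\<^sub>r (- R))\<^sup>T * (diag_block_mat [0\<^sub>m q q, \<Psi>] - diag_block_mat [\<Psi>, 0\<^sub>m q q])
      * (1\<^sub>m n @\<^sub>r (- C) @\<^sub>r (- R))) \<longleftrightarrow>
    (\<forall>x\<in>carrier_vec n. x \<noteq> 0\<^sub>v n \<longrightarrow> qform \<Psi> (transition C R *\<^sub>v x) < qform \<Psi> x)"
proof -
  define X where "X = 1\<^sub>m n @\<^sub>r (- C) @\<^sub>r (- R)"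
  have mp: "m + p = q" by (simp add: q_def)
  have X: "X \<in> carrier_mat (n + q) n"
    unfolding X_def using carrier_append_rows[OF one_carrier_mat CR_carrier[OF C R]] mp by simp
  note \<Psi>c = sym_matsD(1)[OF \<Psi>]
  have z: "0\<^sub>m q q \<in> sym_mats q" by (simp add: sym_mats_def)
  have D1: "diag_block_mat [0\<^sub>m q q, \<Psi>] \<in> sym_mats (n + q)"
    using diag_block_sym_mats[OF z \<Psi>] by (simp add: add.commute)
  have D2: "diag_block_mat [\<Psi>, 0\<^sub>m q q] \<in> sym_mats (n + q)"
    by (rule diag_block_sym_mats[OF \<Psi> z])
  define S where "S = diag_block_mat [0\<^sub>m q q, \<Psi>] - diag_block_mat [\<Psi>, 0\<^sub>m q q]"
  have S: "S \<in> sym_mats (n + q)" unfolding S_def by (rule minus_sym_mats[OF D1 D2])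
  note XSX = congruence_sym_mats[OF X S]
  have "qform (X\<^sup>T * S * X) x = qform \<Psi> (transition C R *\<^sub>v x) - qform \<Psi> x" if x: "x \<in> carrier_vec n" for x
  proof -
    obtain a b where ab: "a \<in> carrier_vec q" "b \<in> carrier_vec r" "x = a @\<^sub>v b"
      using vec_split[of x q r] x n_eq_first by metis
    define c where "c = (- (C *\<^sub>v x)) @\<^sub>v (- (R *\<^sub>v x))"
    have c: "c \<in> carrier_vec q" using C R x mp unfolding c_def
      by (metis append_carrier_vec mult_mat_vec_carrier uminus_carrier_vec)
    have Xx: "X *\<^sub>v x = x @\<^sub>v c"
      unfolding X_def c_def using x C R
      by (simp add: mat_mult_append[OF one_carrier_mat CR_carrier[OF C R]] mat_mult_append[of _ m n _ p])
    have Tx: "transition C R *\<^sub>v x = b @\<^sub>v c"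
      unfolding transition_mult_vec[OF C R x] c_def using J_mult_vec[OF ab(1,2)] ab(3) by simp
    have bc: "b @\<^sub>v c \<in> carrier_vec n"
      using transition_carrier[OF C R] x Tx by (metis mult_mat_vec_carrier)
    have qz: "qform (0\<^sub>m q q) v = 0" if "v \<in> carrier_vec q" for v using that by (simp add: qform_def)
    have "qform (diag_block_mat [0\<^sub>m q q, \<Psi>]) (x @\<^sub>v c) = qform \<Psi> (b @\<^sub>v c)"
      unfolding ab(3) append_vec_assoc using qform_diag_block[OF _ \<Psi>c ab(1) bc, of "0\<^sub>m q q"] qz ab by simp
    moreover have "qform (diag_block_mat [\<Psi>, 0\<^sub>m q q]) (x @\<^sub>v c) = qform \<Psi> x"
      using qform_diag_block[OF \<Psi>c _ x c, of "0\<^sub>m q q"] qz c by simp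
    moreover have "x @\<^sub>v c \<in> carrier_vec (n + q)" using x c by simp
    ultimately show ?thesis
      unfolding qform_congruence[OF X sym_matsD(1)[OF S] x] Xx Tx
      using qform_minus_mat[OF sym_matsD(1)[OF D1] sym_matsD(1)[OF D2]] by (simp add: S_def)
  qed
  thus ?thesis
    using XSX unfolding X_def[symmetric] S_def[symmetric] neg_def_iff[OF sym_matsD(1)[OF XSX]] by auto
qed

text \<open>The last property is the reason why the controller formula contains \<open>[\<Phi>, 0; 0, 0]\<close>
instead of \<open>[\<Phi>, 0; 0, 0] - Nbar\<close>: the input directions are in the kernel of \<open>Nbar\<close>.\<close>

lemma Nbar_sym_and_form:
  assumes N: "N \<in> sym_mats (p + n)"
  shows "Nbar p m L N \<in> sym_mats (n + n)"
    and "\<And>x y. x \<in> carrier_vec n \<Longrightarrow> y \<in> carrier_vec n \<Longrightarrow>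
      qform (Nbar p m L N) (x @\<^sub>v y) = qform N (selection *\<^sub>v x @\<^sub>v y)"
    and "\<And>v. v \<in> carrier_vec m \<Longrightarrow> Nbar p m L N *\<^sub>v (input_embedding *\<^sub>v v) = 0\<^sub>v (n + n)"
proof -
  define E where "E = diag_block_mat [selection, 1\<^sub>m n]"
  have E: "E \<in> carrier_mat (p + n) (n + n)"
    unfolding E_def by (intro diag_block_carrier selection_carrier) auto
  have eq: "Nbar p m L N = E\<^sup>T * N * E"
    unfolding Nbar_def Let_def E_def selection_def q_def[symmetric] n_def[symmetric] ..
  note Nc = sym_matsD(1)[OF N]
  show "Nbar p m L N \<in> sym_mats (n + n)" unfolding eq by (rule congruence_sym_mats[OF E N])
  have Exy: "E *\<^sub>v (x @\<^sub>v y) = selection *\<^sub>v x @\<^sub>v y" if "x \<in> carrier_vec n" "y \<in> carrier_vec n" for x y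
    using diag_block_mult_vec[OF selection_carrier one_carrier_mat that] that by (simp add: E_def)
  show "qform (Nbar p m L N) (x @\<^sub>v y) = qform N (selection *\<^sub>v x @\<^sub>v y)"
    if "x \<in> carrier_vec n" "y \<in> carrier_vec n" for x y
    unfolding eq using qform_congruence[OF E Nc, of "x @\<^sub>v y"] Exy that by simp
  show "Nbar p m L N *\<^sub>v (input_embedding *\<^sub>v v) = 0\<^sub>v (n + n)" if v: "v \<in> carrier_vec m" for v
  proof -
    have x: "0\<^sub>v r @\<^sub>v v @\<^sub>v 0\<^sub>v p \<in> carrier_vec n" using v unfolding n_eq_last by simp
    have "E *\<^sub>v (input_embedding *\<^sub>v v) = (- 0\<^sub>v p) @\<^sub>v 0\<^sub>v n"
      unfolding input_embedding_mult_vec[OF v] using Exy[OF x, of "0\<^sub>v n"] selection_mult_vec[of "0\<^sub>v r" v "0\<^sub>v p"] v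
      by simp
    also have "\<dots> = 0\<^sub>v (p + n)" by (simp add: append_vec_0)
    finally have Ev: "E *\<^sub>v (input_embedding *\<^sub>v v) = 0\<^sub>v (p + n)" .
    have iv: "input_embedding *\<^sub>v v \<in> carrier_vec (n + n)" using input_embedding_carrier v by simp
    have EN: "E\<^sup>T * N \<in> carrier_mat (n + n) (p + n)" using E Nc by auto
    show ?thesis unfolding eq assoc_mult_mat_vec[OF EN E iv] Ev using EN by simp
  qed
qed

end

section \<open>Closed loop trajectories\<close>

lemma block_row_mult_stacked:
  assumes B: "\<And>j. j < L \<Longrightarrow> B j \<in> carrier_mat k q"
    and w: "\<And>j. j < L \<Longrightarrow> w (t + j) \<in> carrier_vec q"
  shows "block_row k q L B *\<^sub>v stacked q L w t = vec k (\<lambda>i. \<Sum>j<L. (B j *\<^sub>v w (t + j)) $ i)"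
proof (rule eq_vecI)
  fix i assume "i < dim_vec (vec k (\<lambda>i. \<Sum>j<L. (B j *\<^sub>v w (t + j)) $ i))"
  hence i: "i < k" by simp
  define f where "f c = B (c div q) $$ (i, c mod q) * w (t + c div q) $ (c mod q)" for c
  have "(block_row k q L B *\<^sub>v stacked q L w t) $ i = sum f {..<L * q}"
    using i by (simp add: block_row_def stacked_def scalar_prod_def f_def lessThan_atLeast0 mult.commute)
  also have "\<dots> = (\<Sum>j<L. sum f {j * q..<j * q + q})"
    by (rule sum.nat_group[symmetric])
  also have "\<dots> = (\<Sum>j<L. (B j *\<^sub>v w (t + j)) $ i)"
  proof (rule sum.cong)
    fix j assume "j \<in> {..<L}"
    hence j: "j < L" by simp
    have "sum f {j * q..<j * q + q} = (\<Sum>c\<in>{0..<q}. f (j * q + c))"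
      using sum.atLeastLessThan_shift_0[of f "j * q" "j * q + q"] by simp
    also have "\<dots> = (\<Sum>c\<in>{0..<q}. B j $$ (i, c) * w (t + j) $ c)"
      by (rule sum.cong) (auto simp: f_def)
    also have "\<dots> = (B j *\<^sub>v w (t + j)) $ i"
      using i B[OF j] w[OF j] by (simp add: scalar_prod_def)
    finally show "sum f {j * q..<j * q + q} = (B j *\<^sub>v w (t + j)) $ i" .
  qed simp
  finally show "(block_row k q L B *\<^sub>v stacked q L w t) $ i = vec k (\<lambda>i. \<Sum>j<L. (B j *\<^sub>v w (t + j)) $ i) $ i"
    using i by simp
qed (simp add: block_row_def)

text \<open>The noise that a system needs in order to explain a trajectory, expressed by its coefficient matrix.
With zero noise this is the closed loop equation for \<open>y(t + L)\<close>; over the data samples it is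
\<open>V = H\<^sub>2 + R H\<^sub>1\<close>.\<close>

lemma system_noise:
  assumes sys: "system p m L P Q" and eq: "system_eq p L P Q u v y t"
    and c: "\<And>j. j \<le> L \<Longrightarrow> u (t + j) \<in> carrier_vec m \<and> y (t + j) \<in> carrier_vec p"
    and v: "v t \<in> carrier_vec p"
  shows "v t = y (t + L) + system_coeff_mat p m L P Q *\<^sub>v stacked (p + m) L (\<lambda>s. u s @\<^sub>v y s) t"
proof -
  have PQ: "P j \<in> carrier_mat p p" "Q j \<in> carrier_mat p m" if "j < L" for j
    using sys that by (auto simp: system_def)
  have PL: "P L = 1\<^sub>m p" using sys by (simp add: system_def)
  have B: "(- Q j) @\<^sub>c P j \<in> carrier_mat p (p + m)" if "j < L" for j
    using append_cols_carrier[of "- Q j" p m "P j" p] PQ[OF that] by (simp add: add.commute)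
  have Rs: "system_coeff_mat p m L P Q *\<^sub>v stacked (p + m) L (\<lambda>s. u s @\<^sub>v y s) t =
      vec p (\<lambda>i. \<Sum>j<L. (((- Q j) @\<^sub>c P j) *\<^sub>v (u (t + j) @\<^sub>v y (t + j))) $ i)"
    unfolding system_coeff_mat_def
    by (rule block_row_mult_stacked[OF B]) (use c in \<open>auto simp: add.commute[of p m]\<close>)
  have entry: "(((- Q j) @\<^sub>c P j) *\<^sub>v (u (t + j) @\<^sub>v y (t + j))) $ i =
      (P j *\<^sub>v y (t + j)) $ i - (Q j *\<^sub>v u (t + j)) $ i" if "j < L" "i < p" for i j
    using append_cols_mult_vec[of "- Q j" p m "P j" p "u (t + j)" "y (t + j)"] PQ[OF that(1)] c[of j] that
    by simp
  show ?thesis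
  proof (rule eq_vecI)
    fix i assume "i < dim_vec (y (t + L) + system_coeff_mat p m L P Q *\<^sub>v stacked (p + m) L (\<lambda>s. u s @\<^sub>v y s) t)"
    hence i: "i < p" unfolding Rs by simp
    have "(\<Sum>j<Suc L. (P j *\<^sub>v y (t + j)) $ i) = (\<Sum>j<L. (Q j *\<^sub>v u (t + j)) $ i) + v t $ i"
      using arg_cong[OF eq[unfolded system_eq_def shift_op_def], of "\<lambda>z. z $ i"] i v by simp
    thus "v t $ i = (y (t + L) + system_coeff_mat p m L P Q *\<^sub>v stacked (p + m) L (\<lambda>s. u s @\<^sub>v y s) t) $ i"
      unfolding Rs using i c[of L] PL by (simp add: entry sum_subtractf)
  qed (use v Rs in simp)
qed

lemma controller_input:
  assumes con: "controller p m L G F" and eq: "controller_eq m L G F u y t"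
    and c: "\<And>j. j \<le> L \<Longrightarrow> u (t + j) \<in> carrier_vec m \<and> y (t + j) \<in> carrier_vec p"
  shows "u (t + L) = - (controller_coeff_mat p m L G F *\<^sub>v stacked (p + m) L (\<lambda>s. u s @\<^sub>v y s) t)"
proof -
  have GF: "G j \<in> carrier_mat m m" "F j \<in> carrier_mat m p" if "j < L" for j
    using con that by (auto simp: controller_def)
  have GL: "G L = 1\<^sub>m m" using con by (simp add: controller_def)
  have B: "G j @\<^sub>c (- F j) \<in> carrier_mat m (p + m)" if "j < L" for j
    using append_cols_carrier[of "G j" m m "- F j" p] GF[OF that] by (simp add: add.commute)
  have Cs: "controller_coeff_mat p m L G F *\<^sub>v stacked (p + m) L (\<lambda>s. u s @\<^sub>v y s) t =
      vec m (\<lambda>i. \<Sum>j<L. ((G j @\<^sub>c (- F j)) *\<^sub>v (u (t + j) @\<^sub>v y (t + j))) $ i)"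
    unfolding controller_coeff_mat_def
    by (rule block_row_mult_stacked[OF B]) (use c in \<open>auto simp: add.commute[of p m]\<close>)
  have entry: "((G j @\<^sub>c (- F j)) *\<^sub>v (u (t + j) @\<^sub>v y (t + j))) $ i =
      (G j *\<^sub>v u (t + j)) $ i - (F j *\<^sub>v y (t + j)) $ i" if "j < L" "i < m" for i j
    using append_cols_mult_vec[of "G j" m m "- F j" p "u (t + j)" "y (t + j)"] GF[OF that(1)] c[of j] that
    by simp
  show ?thesis
  proof (rule eq_vecI)
    fix i assume "i < dim_vec (- (controller_coeff_mat p m L G F *\<^sub>v stacked (p + m) L (\<lambda>s. u s @\<^sub>v y s) t))"
    hence i: "i < m" unfolding Cs by simp
    have "(\<Sum>j<Suc L. (G j *\<^sub>v u (t + j)) $ i) = (\<Sum>j<L. (F j *\<^sub>v y (t + j)) $ i)"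
      using arg_cong[OF eq[unfolded controller_eq_def shift_op_def], of "\<lambda>z. z $ i"] i by simp
    thus "u (t + L) $ i = (- (controller_coeff_mat p m L G F *\<^sub>v stacked (p + m) L (\<lambda>s. u s @\<^sub>v y s) t)) $ i"
      unfolding Cs using i c[of L] GL by (simp add: entry sum_subtractf)
  qed (use Cs c[of L] in simp)
qed

context io_dimensions
begin

lemma q_pos: "q > 0"
  using p_pos by (simp add: q_def)

lemma stacked_carrier: "stacked q L w t \<in> carrier_vec n"
  by (simp add: stacked_def n_def)

lemma coeff_mat_carrier:
  "system_coeff_mat p m L P Q \<in> carrier_mat p n" "controller_coeff_mat p m L G F \<in> carrier_mat m n"
  by (simp_all add: system_coeff_mat_def controller_coeff_mat_def block_row_def n_def q_def)

lemma J_mult_stacked: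
  assumes k: "k < r"
  shows "(J *\<^sub>v stacked q L w t) $ k = stacked q L w (t + 1) $ k"
proof -
  obtain a b where ab: "a \<in> carrier_vec q" "b \<in> carrier_vec r" "stacked q L w t = a @\<^sub>v b"
    using vec_split[of "stacked q L w t" q r] stacked_carrier[of w t] n_eq_first by metis
  have "(J *\<^sub>v stacked q L w t) $ k = (a @\<^sub>v b) $ (q + k)"
    using J_mult_vec[OF ab(1,2)] ab k by simp
  also have "\<dots> = stacked q L w t $ (q + k)" using ab(3) by simp
  also have "\<dots> = stacked q L w (t + 1) $ k"
    using k n_eq_first q_pos by (simp add: stacked_def n_def)
  finally show ?thesis .
qed

lemma stacked_transition:
  assumes sys: "system p m L P Q" and con: "controller p m L G F"
    and sol: "closed_loop_solution p m L P Q G F (\<lambda>_. 0\<^sub>v p) w"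
  shows "stacked q L w (t + 1) =
    transition (controller_coeff_mat p m L G F) (system_coeff_mat p m L P Q) *\<^sub>v stacked q L w t"
proof -
  let ?C = "controller_coeff_mat p m L G F" and ?R = "system_coeff_mat p m L P Q"
  obtain u y where c: "\<And>t. u t \<in> carrier_vec m \<and> y t \<in> carrier_vec p"
    and w: "w = (\<lambda>t. u t @\<^sub>v y t)"
    and eqs: "controller_eq m L G F u y t" "system_eq p L P Q u (\<lambda>_. 0\<^sub>v p) y t"
    using sol unfolding closed_loop_solution_def by blast
  let ?s = "stacked q L w t"
  have Rs: "?R *\<^sub>v ?s \<in> carrier_vec p" and Cs: "?C *\<^sub>v ?s \<in> carrier_vec m"
    by (rule mult_mat_vec_carrier[OF coeff_mat_carrier(1) stacked_carrier],
        rule mult_mat_vec_carrier[OF coeff_mat_carrier(2) stacked_carrier])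
  have zero: "0\<^sub>v p = y (t + L) + ?R *\<^sub>v ?s"
    using system_noise[OF sys eqs(2)] c by (simp add: w q_def)
  have yL: "y (t + L) = - (?R *\<^sub>v ?s)"
  proof (rule eq_vecI)
    fix i assume "i < dim_vec (- (?R *\<^sub>v ?s))"
    thus "y (t + L) $ i = (- (?R *\<^sub>v ?s)) $ i"
      using arg_cong[OF zero, of "\<lambda>z. z $ i"] Rs c[of "t + L"] coeff_mat_carrier(1)[of P Q] by simp
  qed (use Rs c[of "t + L"] coeff_mat_carrier(1)[of P Q] in auto)
  have uL: "u (t + L) = - (?C *\<^sub>v ?s)"
    using controller_input[OF con eqs(1)] c by (simp add: w q_def)
  have Js: "J *\<^sub>v ?s \<in> carrier_vec r" using J_carrier stacked_carrier by simp
  have T: "transition ?C ?R *\<^sub>v ?s = J *\<^sub>v ?s @\<^sub>v w (t + L)"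
    unfolding transition_mult_vec[OF coeff_mat_carrier(2,1) stacked_carrier] w yL uL ..
  have wL: "w (t + L) \<in> carrier_vec q" using c[of "t + L"] by (simp add: w q_def add.commute[of p m])
  show ?thesis unfolding T
  proof (rule eq_vecI)
    fix k assume "k < dim_vec (J *\<^sub>v ?s @\<^sub>v w (t + L))"
    hence k: "k < r + q" using Js J_carrier wL by simp
    show "stacked q L w (t + 1) $ k = (J *\<^sub>v ?s @\<^sub>v w (t + L)) $ k"
    proof (cases "k < r")
      case True
      thus ?thesis using J_mult_stacked[OF True, of w t] Js J_carrier wL k by simp
    next
      case False
      define k' where "k' = k - r"
      have k': "k = q * (L - 1) + k'" "k' < q" using False k by (auto simp: k'_def)
      have kn: "k < q * L" using k n_eq_first n_def by simp
      have "stacked q L w (t + 1) $ k = w (t + 1 + k div q) $ (k mod q)"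
        using kn by (simp add: stacked_def)
      also have "k div q = L - 1" using k' by simp
      also have "k mod q = k'" using k' by simp
      also have "t + 1 + (L - 1) = t + L" using L_pos by simp
      finally show ?thesis using Js J_carrier wL k False by (simp add: k'_def)
    qed
  qed (use Js J_carrier wL n_eq_first stacked_carrier[of w "t + 1"] in simp)
qed

lemma closed_loop_state_0:
  assumes "k < q"
  shows "w t $ k = stacked q L w t $ k"
proof -
  have "k < q * L" using assms L_pos by (metis less_le_trans mult_le_mono2 nat_mult_1_right One_nat_def Suc_leI)
  thus ?thesis using assms by (simp add: stacked_def)
qed

text \<open>Strict decrease in every nonzero state means that \<open>D = \<Psi> - A\<^sup>T \<Psi> A\<close> is positive definite, hence bounded
below by a multiple of the squared norm. The values of \<open>D\<close> along a trajectory telescope to at most the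
initial value of \<open>\<Psi>\<close>, so the squared norms of the states are summable and tend to zero.\<close>

lemma decrease_imp_lyapunov_and_stable:
  assumes sys: "system p m L P Q" and con: "controller p m L G F"
    and \<Psi>: "\<Psi> \<in> carrier_mat n n" "pos_def \<Psi>"
    and decr: "\<And>x. x \<in> carrier_vec n \<Longrightarrow> x \<noteq> 0\<^sub>v n \<Longrightarrow>
      qform \<Psi> (transition (controller_coeff_mat p m L G F) (system_coeff_mat p m L P Q) *\<^sub>v x) < qform \<Psi> x"
  shows "lyapunov_function p m L P Q G F \<Psi>" "stabilizes p m L G F P Q"
proof -
  let ?A = "transition (controller_coeff_mat p m L G F) (system_coeff_mat p m L P Q)"
  have A: "?A \<in> carrier_mat n n" by (intro transition_carrier coeff_mat_carrier)
  have \<Psi>s: "\<Psi> \<in> sym_mats n" using \<Psi> by (simp add: pos_def_iff)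
  note nonneg = pos_def_imp_qform_nonneg[OF \<Psi>(2,1)]
  define D where "D = \<Psi> - ?A\<^sup>T * \<Psi> * ?A"
  note AA = congruence_sym_mats[OF A \<Psi>s]
  have D: "D \<in> sym_mats n" unfolding D_def by (rule minus_sym_mats[OF \<Psi>s AA])
  have qD: "qform D x = qform \<Psi> x - qform \<Psi> (?A *\<^sub>v x)" if "x \<in> carrier_vec n" for x
    unfolding D_def using qform_minus_mat[OF \<Psi>(1) sym_matsD(1)[OF AA] that] qform_congruence[OF A \<Psi>(1) that]
    by simp
  have "pos_def D" using D decr by (auto simp: pos_def_iff[OF sym_matsD(1)[OF D]] qD)
  then obtain \<epsilon> where \<epsilon>: "\<epsilon> > 0" "\<And>x. x \<in> carrier_vec n \<Longrightarrow> \<epsilon> * (x \<bullet> x) \<le> qform D x"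
    using pos_def_coercive[OF _ sym_matsD(1)[OF D]] by metis
  have step: "qform D (stacked q L w t) = qform \<Psi> (stacked q L w t) - qform \<Psi> (stacked q L w (t + 1))"
    if "closed_loop_solution p m L P Q G F (\<lambda>_. 0\<^sub>v p) w" for w t
    unfolding stacked_transition[OF sys con that] by (rule qD[OF stacked_carrier])
  have D_nonneg: "qform D x \<ge> 0" if "x \<in> carrier_vec n" for x
    using \<epsilon>(2)[OF that] \<epsilon>(1) scalar_prod_self_nonneg[of x] by (meson less_imp_le mult_nonneg_nonneg order_trans)
  have qdf: "qdf (p + m) L \<Psi> w t = qform \<Psi> (stacked q L w t)" for w t
    by (simp add: qdf_def qform_def q_def)
  show "lyapunov_function p m L P Q G F \<Psi>"
    unfolding lyapunov_function_def
  proof (intro conjI allI impI)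
    show "\<Psi> \<in> sym_mats ((p + m) * L)" using \<Psi>s by (simp add: n_def q_def)
    fix w t
    assume sol: "closed_loop_solution p m L P Q G F (\<lambda>_. 0\<^sub>v p) w"
    show "0 \<le> qdf (p + m) L \<Psi> w t" unfolding qdf by (rule nonneg[OF stacked_carrier])
    show "qdf_diff (p + m) L \<Psi> w t \<le> 0"
      unfolding qdf_diff_def qdf using step[OF sol, of t] D_nonneg[OF stacked_carrier, of w t] by simp
  next
    fix w t
    assume sol: "closed_loop_solution p m L P Q G F (\<lambda>_. 0\<^sub>v p) w"
      and zero: "\<forall>t. qdf_diff (p + m) L \<Psi> w t = 0"
    have "qform D (stacked q L w t) = 0"
      using zero step[OF sol, of t] unfolding qdf_diff_def qdf by (metis diff_eq_eq diff_self eq_iff_diff_eq_0)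
    hence s0: "stacked q L w t = 0\<^sub>v n"
      using decr[OF stacked_carrier, of w t] qD[OF stacked_carrier, of w t] by force
    have "w t \<in> carrier_vec q"
      using sol unfolding closed_loop_solution_def by (metis append_carrier_vec add.commute q_def)
    moreover have "w t $ k = 0" if "k < q" for k
      using closed_loop_state_0[OF that, of w t] s0 that n_eq_first by simp
    ultimately show "w t = 0\<^sub>v (p + m)" unfolding q_def[symmetric] by (intro eq_vecI) auto
  qed
  show "stabilizes p m L G F P Q"
    unfolding stabilizes_def
  proof (intro allI impI)
    fix w k
    assume sol: "closed_loop_solution p m L P Q G F (\<lambda>_. 0\<^sub>v p) w" and k: "k < p + m"
    let ?s = "\<lambda>t. stacked q L w t"
    define f where "f t = ?s t \<bullet> ?s t" for t
    have f_nonneg: "f t \<ge> 0" for t unfolding f_def by (rule scalar_prod_self_nonneg)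
    have "(\<Sum>t<N. f t) \<le> qform \<Psi> (?s 0) / \<epsilon>" for N
    proof -
      have "\<epsilon> * (\<Sum>t<N. f t) \<le> (\<Sum>t<N. qform D (?s t))"
        unfolding sum_distrib_left f_def by (intro sum_mono \<epsilon>(2) stacked_carrier)
      also have "\<dots> = (\<Sum>t<N. qform \<Psi> (?s t) - qform \<Psi> (?s (Suc t)))"
        using step[OF sol] by simp
      also have "\<dots> = qform \<Psi> (?s 0) - qform \<Psi> (?s N)"
        by (rule sum_lessThan_telescope')
      also have "\<dots> \<le> qform \<Psi> (?s 0)" using nonneg[OF stacked_carrier] by simp
      finally show ?thesis using \<epsilon>(1) by (simp add: field_simps)
    qed
    hence "summable f" by (intro summableI_nonneg_bounded f_nonneg)
    hence f0: "f \<longlonglongrightarrow> 0" by (rule summable_LIMSEQ_zero)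
    have le: "(w t $ k)\<^sup>2 \<le> f t" for t
    proof -
      have kq: "k < q" using k by (simp add: q_def)
      have "(?s t $ k)\<^sup>2 \<le> (\<Sum>j\<in>{0..<n}. (?s t $ j)\<^sup>2)"
        by (rule member_le_sum) (use kq n_eq_first in auto)
      also have "\<dots> = f t" using stacked_carrier[of w t] by (simp add: f_def scalar_prod_def power2_eq_square)
      finally show ?thesis using closed_loop_state_0[OF kq, of w t] by simp
    qed
    have "(\<lambda>t. (w t $ k)\<^sup>2) \<longlonglongrightarrow> 0"
      by (rule tendsto_sandwich[OF _ _ tendsto_const f0]) (use le in auto)
    thus "(\<lambda>t. w t $ k) \<longlonglongrightarrow> 0" by (simp add: power_tendsto_0_iff)
  qed
qed

section \<open>The data\<close>

lemma N_mat_sym_and_form: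
  assumes PI: "PI \<in> sym_mats (p + (T - L + 1))" and T: "T \<ge> L"
  shows "N_mat p m L T PI u y \<in> sym_mats (p + n)"
    and "\<And>a b. a \<in> carrier_vec p \<Longrightarrow> b \<in> carrier_vec n \<Longrightarrow>
      qform (N_mat p m L T PI u y) (a @\<^sub>v b) =
      qform PI (a @\<^sub>v ((hankel2 p L T y)\<^sup>T *\<^sub>v a + (hankel1 p m L T u y)\<^sup>T *\<^sub>v b))"
proof -
  define k where "k = T - L + 1"
  let ?H2 = "hankel2 p L T y" and ?H1 = "hankel1 p m L T u y"
  have H2: "?H2 \<in> carrier_mat p k" using T by (auto simp: hankel2_def k_def)
  have H1: "?H1 \<in> carrier_mat n k" by (simp add: hankel1_def k_def n_def q_def)
  define S where "S = four_block_mat (1\<^sub>m p) ?H2 (0\<^sub>m n p) ?H1"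
  have S: "S \<in> carrier_mat (p + n) (p + k)" unfolding S_def using H1 by auto
  have St: "S\<^sup>T = four_block_mat (1\<^sub>m p) (0\<^sub>m p n) ?H2\<^sup>T ?H1\<^sup>T"
    unfolding S_def using transpose_four_block_mat[OF one_carrier_mat H2 zero_carrier_mat H1] by simp
  have eq: "N_mat p m L T PI u y = (S\<^sup>T)\<^sup>T * PI * S\<^sup>T"
    by (simp add: N_mat_def Let_def S_def n_def q_def)
  have PI': "PI \<in> sym_mats (p + k)" using PI by (simp add: k_def)
  have Stc: "S\<^sup>T \<in> carrier_mat (p + k) (p + n)" using S by simp
  show "N_mat p m L T PI u y \<in> sym_mats (p + n)"
    unfolding eq by (rule congruence_sym_mats[OF Stc PI'])
  show "qform (N_mat p m L T PI u y) (a @\<^sub>v b) = qform PI (a @\<^sub>v (?H2\<^sup>T *\<^sub>v a + ?H1\<^sup>T *\<^sub>v b))"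
    if a: "a \<in> carrier_vec p" and b: "b \<in> carrier_vec n" for a b
  proof -
    have "S\<^sup>T *\<^sub>v (a @\<^sub>v b) = a @\<^sub>v (?H2\<^sup>T *\<^sub>v a + ?H1\<^sup>T *\<^sub>v b)"
      unfolding St using H1 H2 a b
      by (subst four_block_mat_mult_vec[of _ p p _ n _ k]) auto
    thus ?thesis unfolding eq using qform_congruence[OF Stc sym_matsD(1)[OF PI'], of "a @\<^sub>v b"] a b by simp
  qed
qed

lemma quad_form_pos_semidef_iff:
  assumes S: "S \<in> sym_mats (p + k)" and V: "V \<in> carrier_mat p k"
  shows "pos_semidef (quad_form p S V) \<longleftrightarrow> (\<forall>a\<in>carrier_vec p. qform S (a @\<^sub>v V\<^sup>T *\<^sub>v a) \<ge> 0)"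
proof -
  have X: "1\<^sub>m p @\<^sub>r V\<^sup>T \<in> carrier_mat (p + k) p" using V by auto
  note XSX = congruence_sym_mats[OF X S]
  have "qform (quad_form p S V) a = qform S (a @\<^sub>v V\<^sup>T *\<^sub>v a)" if a: "a \<in> carrier_vec p" for a
    unfolding quad_form_def qform_congruence[OF X sym_matsD(1)[OF S] a]
    using a V by (simp add: mat_mult_append[of _ p p _ k])
  thus ?thesis
    using XSX pos_semidef_iff[OF sym_matsD(1)[OF XSX]] by (auto simp: quad_form_def)
qed

lemma compatible_iff:
  assumes PI: "PI \<in> sym_mats (p + (T - L + 1))" and T: "T \<ge> L"
  shows "compatible p m L T PI u y R \<longleftrightarrow> R \<in> carrier_mat p n \<and>
    (\<forall>a\<in>carrier_vec p. qform (N_mat p m L T PI u y) (a @\<^sub>v R\<^sup>T *\<^sub>v a) \<ge> 0)"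
  unfolding compatible_def q_def[symmetric] n_def[symmetric]
  using quad_form_pos_semidef_iff[OF N_mat_sym_and_form(1)[OF PI T]] by blast

text \<open>The noise samples are \<open>V = H\<^sub>2 + R H\<^sub>1\<close>, so the form of \<open>N\<close> on the graph of \<open>R\<^sup>T\<close> is the form of \<open>PI\<close> on
the graph of \<open>V\<^sup>T\<close>. In particular the set of compatible systems is nonempty.\<close>

lemma generating_system_compatible:
  assumes PI: "PI \<in> sym_mats (p + (T - L + 1))" and T: "T \<ge> L"
    and data: "\<forall>t\<le>T. u t \<in> carrier_vec m \<and> y t \<in> carrier_vec p"
    and sys: "system p m L P Q" and gen: "generates_data p L T PI u y P Q"
  shows "compatible p m L T PI u y (system_coeff_mat p m L P Q)"
proof -
  let ?R = "system_coeff_mat p m L P Q" and ?H2 = "hankel2 p L T y" and ?H1 = "hankel1 p m L T u y"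
  define k where "k = T - L + 1"
  define w where "w = (\<lambda>s. u s @\<^sub>v y s)"
  obtain v where v: "\<And>t. t \<le> T - L \<Longrightarrow> v t \<in> carrier_vec p \<and> system_eq p L P Q u v y t"
    and psd: "pos_semidef (quad_form p PI (mat_of_cols p (map v [0..<T - L + 1])))"
    using gen unfolding generates_data_def by blast
  define V where "V = mat_of_cols p (map v [0..<k])"
  have V: "V \<in> carrier_mat p k" by (auto simp: V_def)
  have PI': "PI \<in> sym_mats (p + k)" using PI by (simp add: k_def)
  have H2: "?H2 \<in> carrier_mat p k" using T by (auto simp: hankel2_def k_def)
  have H1: "?H1 \<in> carrier_mat n k" by (simp add: hankel1_def k_def n_def q_def)
  have R: "?R \<in> carrier_mat p n" by (rule coeff_mat_carrier)
  have RH: "?R * ?H1 \<in> carrier_mat p k" using R H1 by simp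
  have V_eq: "V = ?H2 + ?R * ?H1"
  proof (rule eq_matI)
    fix i j assume "i < dim_row (?H2 + ?R * ?H1)" "j < dim_col (?H2 + ?R * ?H1)"
    hence ij: "i < p" "j < k" using RH by auto
    have jT: "j \<le> T - L" using ij by (simp add: k_def)
    have data': "u (j + i) \<in> carrier_vec m \<and> y (j + i) \<in> carrier_vec p" if "i \<le> L" for i
      using data jT that T by auto
    have vj: "v j = y (j + L) + ?R *\<^sub>v stacked q L w j"
      using system_noise[OF sys, where u = u and v = v and y = y and t = j] v[OF jT] data'
      by (simp add: w_def q_def)
    have col: "col ?H1 j = stacked q L w j"
      using ij by (intro eq_vecI)
        (auto simp: hankel1_def stacked_def w_def k_def q_def add.commute)
    have "?H2 $$ (i, j) = y (j + L) $ i"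
      using ij T by (simp add: hankel2_def mat_of_cols_index k_def add.commute nth_append del: upt_Suc)
    moreover have "V $$ (i, j) = v j $ i" using ij by (simp add: V_def mat_of_cols_index)
    moreover have "(?R * ?H1) $$ (i, j) = (?R *\<^sub>v stacked q L w j) $ i"
      using ij R H1 by (simp add: col)
    ultimately show "V $$ (i, j) = (?H2 + ?R * ?H1) $$ (i, j)"
      using ij vj R H1 data'[of L] by simp
  qed (use V RH in auto)
  have "qform (N_mat p m L T PI u y) (a @\<^sub>v ?R\<^sup>T *\<^sub>v a) = qform PI (a @\<^sub>v V\<^sup>T *\<^sub>v a)" if a: "a \<in> carrier_vec p" for a
  proof -
    have "V\<^sup>T = ?H2\<^sup>T + ?H1\<^sup>T * ?R\<^sup>T"
      unfolding V_eq using transpose_add[OF H2 RH] transpose_mult[OF R H1] by simp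
    hence "V\<^sup>T *\<^sub>v a = ?H2\<^sup>T *\<^sub>v a + (?H1\<^sup>T * ?R\<^sup>T) *\<^sub>v a"
      using add_mult_distrib_mat_vec[of "?H2\<^sup>T" k p "?H1\<^sup>T * ?R\<^sup>T" a] H2 H1 R a by simp
    also have "(?H1\<^sup>T * ?R\<^sup>T) *\<^sub>v a = ?H1\<^sup>T *\<^sub>v (?R\<^sup>T *\<^sub>v a)"
      by (rule assoc_mult_mat_vec[of _ k n _ p]) (use H1 R a in auto)
    finally show ?thesis
      using N_mat_sym_and_form(2)[OF PI T a, of "?R\<^sup>T *\<^sub>v a" u y] R a by simp
  qed
  moreover have "\<forall>a\<in>carrier_vec p. qform PI (a @\<^sub>v V\<^sup>T *\<^sub>v a) \<ge> 0"
    using psd quad_form_pos_semidef_iff[OF PI' V] by (simp add: V_def k_def)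
  ultimately show ?thesis using compatible_iff[OF PI T] R by simp
qed

text \<open>The lower right block of \<open>N\<close> is \<open>H\<^sub>1 \<Pi>\<^sub>2\<^sub>2 H\<^sub>1\<^sup>T\<close>; full row rank of \<open>H\<^sub>1\<close> keeps it negative definite.\<close>

lemma N_mat_block22_neg_def:
  assumes PI: "PI \<in> sym_mats (p + (T - L + 1))" and T: "T \<ge> L"
    and neg: "neg_def (block22 p PI)"
    and rank: "vec_space.rank n (hankel1 p m L T u y) = n"
  shows "neg_def (block22 p (N_mat p m L T PI u y))"
  unfolding neg_def_block22_iff[OF N_mat_sym_and_form(1)[OF PI T]]
proof (intro ballI impI)
  fix b :: "real vec" assume b: "b \<in> carrier_vec n" "b \<noteq> 0\<^sub>v n"
  let ?H2 = "hankel2 p L T y" and ?H1 = "hankel1 p m L T u y"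
  have H2: "?H2 \<in> carrier_mat p (T - L + 1)" using T by (auto simp: hankel2_def)
  have H1: "?H1 \<in> carrier_mat n (T - L + 1)" by (simp add: hankel1_def n_def q_def)
  have c: "?H1\<^sup>T *\<^sub>v b \<in> carrier_vec (T - L + 1)" using H1 b by simp
  have "?H1\<^sup>T *\<^sub>v b \<noteq> 0\<^sub>v (T - L + 1)"
    using full_row_rank_transpose_injective[OF H1 rank b(1)] b(2) by blast
  hence "qform PI (0\<^sub>v p @\<^sub>v ?H1\<^sup>T *\<^sub>v b) < 0"
    using neg c unfolding neg_def_block22_iff[OF PI] by blast
  moreover have "?H2\<^sup>T *\<^sub>v 0\<^sub>v p = 0\<^sub>v (T - L + 1)" using H2 by (intro mult_mat_zero_vec) simp
  ultimately show "qform (N_mat p m L T PI u y) (0\<^sub>v p @\<^sub>v b) < 0"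
    using N_mat_sym_and_form(2)[OF PI T, of "0\<^sub>v p" b u y] b c by simp
qed

end

section \<open>Robust stabilization by matrix inequalities\<close>

text \<open>Of the data only three properties of \<open>N\<close> matter from here on: it is symmetric, its lower right block
is negative definite, and some system is compatible with it.\<close>

locale io_data = io_dimensions +
  fixes N :: "real mat"
  assumes N_sym: "N \<in> sym_mats (p + n)"
    and N22_neg: "neg_def (block22 p N)"
    and consistent: "\<exists>R\<in>carrier_mat p n. \<forall>a\<in>carrier_vec p. qform N (a @\<^sub>v R\<^sup>T *\<^sub>v a) \<ge> 0"
begin

abbreviation "Nb \<equiv> Nbar p m L N"

definition "consistent_system R \<longleftrightarrow>
  R \<in> carrier_mat p n \<and> (\<forall>a\<in>carrier_vec p. qform N (a @\<^sub>v R\<^sup>T *\<^sub>v a) \<ge> 0)"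

abbreviation "M \<Phi> \<equiv> diag_block_mat [\<Phi>, 0\<^sub>m n n] - Nb"

text \<open>The hub of the proof: the matrix inequality that the designed controller has to satisfy, evaluated
at vectors. It is obtained from the robust decrease of \<open>\<Phi>\<^sup>-\<^sup>1\<close> by the S-lemma, with the multiplier
normalized to \<open>1\<close>.\<close>

definition "robust_LMI \<Phi> C \<longleftrightarrow>
  (\<forall>x\<in>carrier_vec n. \<forall>y\<in>carrier_vec n. \<not> (x = 0\<^sub>v n \<and> y = 0\<^sub>v n) \<longrightarrow>
     qform \<Phi> x - qform \<Phi> ((transition C (0\<^sub>m p n))\<^sup>T *\<^sub>v x + y) - qform Nb (x @\<^sub>v y) > 0)"

lemma Nb_sym: "Nb \<in> sym_mats (n + n)"
  by (rule Nbar_sym_and_form(1)[OF N_sym])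

lemmas Nb_form = Nbar_sym_and_form(2)[OF N_sym]

lemma M_sym:
  assumes "\<Phi> \<in> sym_mats n"
  shows "M \<Phi> \<in> sym_mats (n + n)"
  by (intro minus_sym_mats diag_block_sym_mats Nb_sym assms) (simp add: sym_mats_def)

lemma M_form:
  assumes \<Phi>: "\<Phi> \<in> sym_mats n" and x: "x \<in> carrier_vec n" and y: "y \<in> carrier_vec n"
  shows "qform (M \<Phi>) (x @\<^sub>v y) = qform \<Phi> x - qform Nb (x @\<^sub>v y)"
proof -
  have "qform (0\<^sub>m n n) y = 0" using y by (simp add: qform_def)
  moreover have "diag_block_mat [\<Phi>, 0\<^sub>m n n] \<in> carrier_mat (n + n) (n + n)"
    by (rule diag_block_carrier[OF sym_matsD(1)[OF \<Phi>]]) simp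
  ultimately show ?thesis
    using qform_minus_mat[OF _ sym_matsD(1)[OF Nb_sym], of "diag_block_mat [\<Phi>, 0\<^sub>m n n]" "x @\<^sub>v y"] x y
      qform_diag_block[OF sym_matsD(1)[OF \<Phi>] _ x y, of "0\<^sub>m n n"] by simp
qed

lemma Nb_block22_neg_def: "neg_def (block22 n Nb)"
  unfolding neg_def_block22_iff[OF Nb_sym]
proof (intro ballI impI)
  fix y :: "real vec" assume y: "y \<in> carrier_vec n" "y \<noteq> 0\<^sub>v n"
  have "qform Nb (0\<^sub>v n @\<^sub>v y) = qform N (0\<^sub>v p @\<^sub>v y)"
    using Nb_form[of "0\<^sub>v n" y] y selection_carrier by simp
  also have "\<dots> < 0" using N22_neg y unfolding neg_def_block22_iff[OF N_sym] by blast
  finally show "qform Nb (0\<^sub>v n @\<^sub>v y) < 0" .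
qed

text \<open>The first LMI says that \<open>M \<Phi>\<close> is positive definite: after completing the square for \<open>Nbar\<close>, the
\<open>y\<close>-part of \<open>M \<Phi>\<close> is positive definite anyway, and the \<open>x\<close>-part is \<open>\<Phi>\<close> minus the Schur complement.
As a compatible system exists, this Schur complement is positive semidefinite, which makes \<open>\<Phi>\<close>
positive definite.\<close>

lemma schur_LMI_iff:
  assumes \<Phi>: "\<Phi> \<in> sym_mats n"
  shows "pos_def (\<Phi> - schur_compl n Nb) \<longleftrightarrow> pos_def (M \<Phi>)"
    and "pos_def (\<Phi> - schur_compl n Nb) \<Longrightarrow> pos_def \<Phi>"
proof -
  obtain Z where Z: "Z \<in> carrier_mat n n" and B: "block22 n Nb \<in> carrier_mat n n"
    and S: "schur_compl n Nb \<in> sym_mats n"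
    and sq: "\<And>x y. x \<in> carrier_vec n \<Longrightarrow> y \<in> carrier_vec n \<Longrightarrow>
       qform Nb (x @\<^sub>v y) = qform (schur_compl n Nb) x + qform (block22 n Nb) (y - Z *\<^sub>v x)"
    using schur_complete_square[OF Nb_sym Nb_block22_neg_def] by metis
  note \<Phi>c = sym_matsD(1)[OF \<Phi>]
  have D: "\<Phi> - schur_compl n Nb \<in> sym_mats n" by (rule minus_sym_mats[OF \<Phi> S])
  have qD: "qform (\<Phi> - schur_compl n Nb) x = qform \<Phi> x - qform (schur_compl n Nb) x"
    if "x \<in> carrier_vec n" for x
    by (rule qform_minus_mat[OF \<Phi>c sym_matsD(1)[OF S] that])
  have B_neg: "qform (block22 n Nb) w < 0" if "w \<in> carrier_vec n" "w \<noteq> 0\<^sub>v n" for w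
    using Nb_block22_neg_def that B by (auto simp: neg_def_iff)
  have B_nonpos: "qform (block22 n Nb) w \<le> 0" if "w \<in> carrier_vec n" for w
    using B_neg[OF that] B by (cases "w = 0\<^sub>v n") (auto simp: less_imp_le)
  have M_eq: "qform (M \<Phi>) (x @\<^sub>v y) =
      qform (\<Phi> - schur_compl n Nb) x - qform (block22 n Nb) (y - Z *\<^sub>v x)"
    if "x \<in> carrier_vec n" "y \<in> carrier_vec n" for x y
    using M_form[OF \<Phi> that] sq[OF that] qD[OF that(1)] by simp
  show "pos_def (\<Phi> - schur_compl n Nb) \<longleftrightarrow> pos_def (M \<Phi>)"
  proof
    assume pd: "pos_def (\<Phi> - schur_compl n Nb)"
    have "qform (M \<Phi>) v > 0" if v: "v \<in> carrier_vec (n + n)" "v \<noteq> 0\<^sub>v (n + n)" for v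
    proof -
      obtain x y where xy: "x \<in> carrier_vec n" "y \<in> carrier_vec n" "v = x @\<^sub>v y"
        using vec_split[OF v(1)] by metis
      have yZ: "y - Z *\<^sub>v x \<in> carrier_vec n" using xy Z by simp
      show ?thesis
      proof (cases "x = 0\<^sub>v n")
        case True
        hence "y \<noteq> 0\<^sub>v n" using v xy by (simp add: append_vec_eq_0_iff)
        moreover have "y - Z *\<^sub>v x = y" using True Z xy by (intro eq_vecI) auto
        ultimately show ?thesis
          using M_eq[OF xy(1,2)] B_neg[OF xy(2)] True sym_matsD(1)[OF D] xy(3) by simp
      next
        case False
        hence "qform (\<Phi> - schur_compl n Nb) x > 0"
          using pd xy unfolding pos_def_iff[OF sym_matsD(1)[OF D]] by blast
        thus ?thesis using M_eq[OF xy(1,2)] B_nonpos[OF yZ] xy(3) by simp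
      qed
    qed
    thus "pos_def (M \<Phi>)" using M_sym[OF \<Phi>] by (simp add: pos_def_iff[OF sym_matsD(1)[OF M_sym[OF \<Phi>]]])
  next
    assume pd: "pos_def (M \<Phi>)"
    have "qform (\<Phi> - schur_compl n Nb) x > 0" if x: "x \<in> carrier_vec n" "x \<noteq> 0\<^sub>v n" for x
    proof -
      have Zx: "Z *\<^sub>v x \<in> carrier_vec n" using Z x by simp
      have "x @\<^sub>v Z *\<^sub>v x \<noteq> 0\<^sub>v (n + n)" using x append_vec_eq_0_iff[OF x(1) Zx] by simp
      moreover have "x @\<^sub>v Z *\<^sub>v x \<in> carrier_vec (n + n)" using x Zx by simp
      ultimately have "qform (M \<Phi>) (x @\<^sub>v Z *\<^sub>v x) > 0"
        using pd unfolding pos_def_iff[OF sym_matsD(1)[OF M_sym[OF \<Phi>]]] by blast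
      moreover have "Z *\<^sub>v x - Z *\<^sub>v x = 0\<^sub>v n" using Zx by simp
      ultimately show ?thesis using M_eq[OF x(1) Zx] B by simp
    qed
    thus "pos_def (\<Phi> - schur_compl n Nb)" using D by (simp add: pos_def_iff[OF sym_matsD(1)[OF D]])
  qed
  show "pos_def \<Phi>" if pd: "pos_def (\<Phi> - schur_compl n Nb)"
  proof -
    obtain R0 where R0: "R0 \<in> carrier_mat p n" "\<And>a. a \<in> carrier_vec p \<Longrightarrow> qform N (a @\<^sub>v R0\<^sup>T *\<^sub>v a) \<ge> 0"
      using consistent by blast
    have "qform \<Phi> x > 0" if x: "x \<in> carrier_vec n" "x \<noteq> 0\<^sub>v n" for x
    proof -
      have sx: "selection *\<^sub>v x \<in> carrier_vec p" using selection_carrier x by simp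
      have y: "R0\<^sup>T *\<^sub>v (selection *\<^sub>v x) \<in> carrier_vec n" using R0 sx by simp
      have "0 \<le> qform (schur_compl n Nb) x"
        using Nb_form[OF x(1) y] R0(2)[OF sx] sq[OF x(1) y] B_nonpos[of "R0\<^sup>T *\<^sub>v (selection *\<^sub>v x) - Z *\<^sub>v x"] y Z x
        by simp
      moreover have "qform (\<Phi> - schur_compl n Nb) x > 0"
        using pd x unfolding pos_def_iff[OF sym_matsD(1)[OF D]] by blast
      ultimately show ?thesis using qD[OF x(1)] by simp
    qed
    thus ?thesis using \<Phi> by (simp add: pos_def_iff[OF \<Phi>c])
  qed
qed

lemma controller_LMI_iff_robust:
  assumes \<Phi>: "\<Phi> \<in> sym_mats n" and C: "C \<in> carrier_mat m n"
  shows "pos_def ((1\<^sub>m (n + n) @\<^sub>r ((J @\<^sub>r (- C) @\<^sub>r 0\<^sub>m p n)\<^sup>T @\<^sub>c 1\<^sub>m n))\<^sup>T * diag_block_mat [M \<Phi>, - \<Phi>]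
      * (1\<^sub>m (n + n) @\<^sub>r ((J @\<^sub>r (- C) @\<^sub>r 0\<^sub>m p n)\<^sup>T @\<^sub>c 1\<^sub>m n))) \<longleftrightarrow> robust_LMI \<Phi> C"
proof -
  have T_eq: "J @\<^sub>r (- C) @\<^sub>r 0\<^sub>m p n = transition C (0\<^sub>m p n)"
  proof -
    have "- 0\<^sub>m p n = (0\<^sub>m p n :: real mat)" by (intro eq_matI) auto
    thus ?thesis by (simp add: transition_def)
  qed
  have T: "(transition C (0\<^sub>m p n))\<^sup>T \<in> carrier_mat n n" using transition_carrier[OF C] by simp
  define B where "B = (transition C (0\<^sub>m p n))\<^sup>T @\<^sub>c 1\<^sub>m n"
  have B: "B \<in> carrier_mat n (n + n)" unfolding B_def by (rule append_cols_carrier[OF T]) simp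
  have eq: "qform (M \<Phi>) (1\<^sub>m (n + n) *\<^sub>v (x @\<^sub>v y)) - qform \<Phi> (B *\<^sub>v (x @\<^sub>v y)) =
      qform \<Phi> x - qform \<Phi> ((transition C (0\<^sub>m p n))\<^sup>T *\<^sub>v x + y) - qform Nb (x @\<^sub>v y)"
    if x: "x \<in> carrier_vec n" and y: "y \<in> carrier_vec n" for x y
    using M_form[OF \<Phi> x y] append_cols_mult_vec[OF T one_carrier_mat x y] x y by (simp add: B_def)
  show ?thesis
    unfolding T_eq B_def[symmetric] pos_def_stacked_congruence_iff[OF M_sym[OF \<Phi>] \<Phi> one_carrier_mat B]
      robust_LMI_def all_vec_append
    by (intro ball_cong refl) (simp only: eq append_vec_eq_0_iff)
qed

lemma eliminated_LMI_iff:
  assumes \<Phi>: "\<Phi> \<in> sym_mats n"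
  shows "pos_def ((W @\<^sub>r K)\<^sup>T * diag_block_mat [M \<Phi>, - \<Phi>] * (W @\<^sub>r K)) \<longleftrightarrow>
    (\<forall>z\<in>carrier_vec (r + (p + n)). z \<noteq> 0\<^sub>v (r + (p + n)) \<longrightarrow>
       qform (M \<Phi>) (W *\<^sub>v z) - qform \<Phi> (K *\<^sub>v z) > 0)"
  by (rule pos_def_stacked_congruence_iff[OF M_sym[OF \<Phi>] \<Phi> W_carrier K_carrier])

lemma W_split:
  assumes z: "z \<in> carrier_vec (r + (p + n))"
  obtains a b c where "a \<in> carrier_vec r" "b \<in> carrier_vec p" "c \<in> carrier_vec n" "z = a @\<^sub>v b @\<^sub>v c"
    "W *\<^sub>v z = (a @\<^sub>v 0\<^sub>v m @\<^sub>v b) @\<^sub>v c" "K *\<^sub>v z = J\<^sup>T *\<^sub>v a + c"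
    "a @\<^sub>v 0\<^sub>v m @\<^sub>v b \<in> carrier_vec n"
proof -
  obtain a bc where abc: "a \<in> carrier_vec r" "bc \<in> carrier_vec (p + n)" "z = a @\<^sub>v bc"
    using vec_split[OF z] by metis
  obtain b c where bc: "b \<in> carrier_vec p" "c \<in> carrier_vec n" "bc = b @\<^sub>v c"
    using vec_split[OF abc(2)] by metis
  have "a @\<^sub>v 0\<^sub>v m @\<^sub>v b \<in> carrier_vec n" unfolding n_eq_last using abc bc by simp
  thus ?thesis
    using that[of a b c] abc bc W_mult_vec[of a b c] K_mult_vec[of a b c] by (simp add: append_vec_assoc)
qed

text \<open>Both LMIs are weaker than the inequality with the controller: the first drops the subtracted
nonnegative form of \<open>\<Phi>\<close>, and the second restricts to vectors whose input component is zero, which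
the controller does not see.\<close>

lemma robust_imp_LMIs:
  assumes \<Phi>: "\<Phi> \<in> sym_mats n" "pos_def \<Phi>" and C: "C \<in> carrier_mat m n" and rob: "robust_LMI \<Phi> C"
  shows "pos_def (\<Phi> - schur_compl n Nb)"
    and "pos_def ((W @\<^sub>r K)\<^sup>T * diag_block_mat [M \<Phi>, - \<Phi>] * (W @\<^sub>r K))"
proof -
  let ?A = "transition C (0\<^sub>m p n)"
  have A: "?A \<in> carrier_mat n n" using transition_carrier[OF C] by simp
  have "qform (M \<Phi>) v > 0" if v: "v \<in> carrier_vec (n + n)" "v \<noteq> 0\<^sub>v (n + n)" for v
  proof -
    obtain x y where xy: "x \<in> carrier_vec n" "y \<in> carrier_vec n" "v = x @\<^sub>v y"
      using vec_split[OF v(1)] by metis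
    have "\<not> (x = 0\<^sub>v n \<and> y = 0\<^sub>v n)" using v xy append_vec_eq_0_iff[OF xy(1,2)] by blast
    hence "qform \<Phi> x - qform \<Phi> (?A\<^sup>T *\<^sub>v x + y) - qform Nb (x @\<^sub>v y) > 0"
      using rob xy unfolding robust_LMI_def by blast
    moreover have "qform \<Phi> (?A\<^sup>T *\<^sub>v x + y) \<ge> 0"
      by (rule pos_def_imp_qform_nonneg[OF \<Phi>(2) sym_matsD(1)[OF \<Phi>(1)]]) (use A xy in simp)
    ultimately show ?thesis using M_form[OF \<Phi>(1) xy(1,2)] xy(3) by simp
  qed
  hence "pos_def (M \<Phi>)" using M_sym[OF \<Phi>(1)] by (simp add: pos_def_iff[OF sym_matsD(1)[OF M_sym[OF \<Phi>(1)]]])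
  thus "pos_def (\<Phi> - schur_compl n Nb)" using schur_LMI_iff(1)[OF \<Phi>(1)] by simp
  show "pos_def ((W @\<^sub>r K)\<^sup>T * diag_block_mat [M \<Phi>, - \<Phi>] * (W @\<^sub>r K))"
    unfolding eliminated_LMI_iff[OF \<Phi>(1)]
  proof (intro ballI impI)
    fix z :: "real vec" assume z: "z \<in> carrier_vec (r + (p + n))" "z \<noteq> 0\<^sub>v (r + (p + n))"
    obtain a b c where abc: "a \<in> carrier_vec r" "b \<in> carrier_vec p" "c \<in> carrier_vec n" "z = a @\<^sub>v b @\<^sub>v c"
      and Wz: "W *\<^sub>v z = (a @\<^sub>v 0\<^sub>v m @\<^sub>v b) @\<^sub>v c" and Kz: "K *\<^sub>v z = J\<^sup>T *\<^sub>v a + c"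
      and x: "a @\<^sub>v 0\<^sub>v m @\<^sub>v b \<in> carrier_vec n"
      using W_split[OF z(1)] by metis
    have JTa: "J\<^sup>T *\<^sub>v a \<in> carrier_vec n" using J_carrier abc by simp
    have "?A\<^sup>T *\<^sub>v (a @\<^sub>v 0\<^sub>v m @\<^sub>v b) = J\<^sup>T *\<^sub>v a + (- (C\<^sup>T *\<^sub>v 0\<^sub>v m) + - ((0\<^sub>m p n)\<^sup>T *\<^sub>v b))"
      by (rule transition_transpose_mult_vec[OF C]) (use abc in auto)
    also have "(0\<^sub>m p n)\<^sup>T *\<^sub>v b = 0\<^sub>v n" using abc by simp
    also have "C\<^sup>T *\<^sub>v 0\<^sub>v m = 0\<^sub>v n" by (rule mult_mat_zero_vec) (use C in simp)
    finally have Ax: "?A\<^sup>T *\<^sub>v (a @\<^sub>v 0\<^sub>v m @\<^sub>v b) = J\<^sup>T *\<^sub>v a" using JTa by simp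
    have "\<not> (a @\<^sub>v 0\<^sub>v m @\<^sub>v b = 0\<^sub>v n \<and> c = 0\<^sub>v n)"
    proof
      assume 0: "a @\<^sub>v 0\<^sub>v m @\<^sub>v b = 0\<^sub>v n \<and> c = 0\<^sub>v n"
      hence "a = 0\<^sub>v r" "b = 0\<^sub>v p"
        using append_vec_eq_0_iff[of a r "0\<^sub>v m @\<^sub>v b" "m + p"] append_vec_eq_0_iff[of "0\<^sub>v m" m b p] abc
        unfolding n_eq_last by auto
      thus False using z abc 0 by (simp add: append_vec_0)
    qed
    hence "qform \<Phi> (a @\<^sub>v 0\<^sub>v m @\<^sub>v b) - qform \<Phi> (J\<^sup>T *\<^sub>v a + c) - qform Nb ((a @\<^sub>v 0\<^sub>v m @\<^sub>v b) @\<^sub>v c) > 0"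
      using rob x abc(3) unfolding robust_LMI_def Ax[symmetric] by blast
    thus "qform (M \<Phi>) (W *\<^sub>v z) - qform \<Phi> (K *\<^sub>v z) > 0"
      unfolding Wz Kz M_form[OF \<Phi>(1) x abc(3)] by simp
  qed
qed

text \<open>The controller is chosen such that \<open>[A\<^sup>T, I] = K (W\<^sup>T M W)\<^sup>-\<^sup>1 W\<^sup>T M\<close>, where \<open>A\<close> is the transition matrix
with \<open>R = 0\<close>; then the projection step applies. Both sides agree on the range of \<open>W\<close> for every \<open>C\<close>.
On the complementary input directions the left side is \<open>- C\<^sup>T\<close>, and this defines \<open>C\<close>.\<close>

lemma LMIs_imp_robust:
  assumes \<Phi>: "\<Phi> \<in> sym_mats n" and LMI1: "pos_def (\<Phi> - schur_compl n Nb)"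
    and LMI2: "pos_def ((W @\<^sub>r K)\<^sup>T * diag_block_mat [M \<Phi>, - \<Phi>] * (W @\<^sub>r K))"
  shows "invertible_mat (W\<^sup>T * M \<Phi> * W)"
    and "\<And>C. C\<^sup>T = - (K * mat_inv (W\<^sup>T * M \<Phi> * W) * W\<^sup>T * diag_block_mat [\<Phi>, 0\<^sub>m n n] * input_embedding) \<Longrightarrow>
      C \<in> carrier_mat m n \<and> robust_LMI \<Phi> C"
proof -
  let ?k = "r + (p + n)"
  note \<Phi>c = sym_matsD(1)[OF \<Phi>] and Ms = M_sym[OF \<Phi>]
  note Mc = sym_matsD(1)[OF Ms]
  have "pos_def (M \<Phi>)" using LMI1 schur_LMI_iff(1)[OF \<Phi>] by simp
  hence M_pos: "qform (M \<Phi>) x > 0" if "x \<in> carrier_vec (n + n)" "x \<noteq> 0\<^sub>v (n + n)" for x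
    using that unfolding pos_def_iff[OF Mc] by blast
  have \<Phi>_pd: "pos_def \<Phi>" by (rule schur_LMI_iff(2)[OF \<Phi> LMI1])
  have LMI: "qform (M \<Phi>) (W *\<^sub>v z) - qform \<Phi> (K *\<^sub>v z) > 0"
    if "z \<in> carrier_vec ?k" "z \<noteq> 0\<^sub>v ?k" for z
    using LMI2 that unfolding eliminated_LMI_iff[OF \<Phi>] by blast
  define Y where "Y = W\<^sup>T * M \<Phi> * W"
  have Ys: "Y \<in> sym_mats ?k" unfolding Y_def by (rule congruence_sym_mats[OF W_carrier Ms])
  note Yc = sym_matsD(1)[OF Ys]
  have "qform Y z > 0" if z: "z \<in> carrier_vec ?k" "z \<noteq> 0\<^sub>v ?k" for z
  proof -
    have "K *\<^sub>v z \<in> carrier_vec n" using K_carrier z by simp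
    hence "qform \<Phi> (K *\<^sub>v z) \<ge> 0" by (rule pos_def_imp_qform_nonneg[OF \<Phi>_pd \<Phi>c])
    thus ?thesis unfolding Y_def qform_congruence[OF W_carrier Mc z(1)] using LMI[OF z] by simp
  qed
  hence "pos_def Y" using Ys by (simp add: pos_def_iff[OF Yc])
  note V = pos_def_mat_inv[OF this Yc]
  show "invertible_mat (W\<^sup>T * M \<Phi> * W)" using V(4) by (simp add: Y_def)
  fix C assume "C\<^sup>T = - (K * mat_inv (W\<^sup>T * M \<Phi> * W) * W\<^sup>T * diag_block_mat [\<Phi>, 0\<^sub>m n n] * input_embedding)"
  hence CT: "C\<^sup>T = - (K * mat_inv Y * W\<^sup>T * diag_block_mat [\<Phi>, 0\<^sub>m n n] * input_embedding)"
    by (simp add: Y_def)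
  have Dc: "diag_block_mat [\<Phi>, 0\<^sub>m n n] \<in> carrier_mat (n + n) (n + n)"
    by (rule diag_block_carrier[OF \<Phi>c]) simp
  have WT: "W\<^sup>T \<in> carrier_mat ?k (n + n)" using W_carrier by simp
  have c1: "K * mat_inv Y \<in> carrier_mat n ?k" by (rule mult_carrier_mat[OF K_carrier V(1)])
  have c2: "K * mat_inv Y * W\<^sup>T \<in> carrier_mat n (n + n)" by (rule mult_carrier_mat[OF c1 WT])
  have c3: "K * mat_inv Y * W\<^sup>T * diag_block_mat [\<Phi>, 0\<^sub>m n n] \<in> carrier_mat n (n + n)"
    by (rule mult_carrier_mat[OF c2 Dc])
  have "C\<^sup>T \<in> carrier_mat n m"
    unfolding CT by (intro uminus_carrier_mat mult_carrier_mat[OF c3 input_embedding_carrier])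
  hence C: "C \<in> carrier_mat m n" by (metis transpose_carrier_mat transpose_transpose)
  define B where "B v = K *\<^sub>v (mat_inv Y *\<^sub>v (W\<^sup>T *\<^sub>v (M \<Phi> *\<^sub>v v)))" for v
  have B_add: "B (v + w) = B v + B w" if v: "v \<in> carrier_vec (n + n)" and w: "w \<in> carrier_vec (n + n)" for v w
  proof -
    have 1: "M \<Phi> *\<^sub>v (v + w) = M \<Phi> *\<^sub>v v + M \<Phi> *\<^sub>v w" by (rule mult_add_distrib_mat_vec[OF Mc v w])
    have Mv: "M \<Phi> *\<^sub>v v \<in> carrier_vec (n + n)" "M \<Phi> *\<^sub>v w \<in> carrier_vec (n + n)"
      using Mc v w by (auto intro: mult_mat_vec_carrier)
    have 2: "W\<^sup>T *\<^sub>v (M \<Phi> *\<^sub>v v + M \<Phi> *\<^sub>v w) = W\<^sup>T *\<^sub>v (M \<Phi> *\<^sub>v v) + W\<^sup>T *\<^sub>v (M \<Phi> *\<^sub>v w)"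
      by (rule mult_add_distrib_mat_vec[OF WT Mv])
    have Wv: "W\<^sup>T *\<^sub>v (M \<Phi> *\<^sub>v v) \<in> carrier_vec ?k" "W\<^sup>T *\<^sub>v (M \<Phi> *\<^sub>v w) \<in> carrier_vec ?k"
      using WT Mv by (auto intro: mult_mat_vec_carrier)
    have Vv: "mat_inv Y *\<^sub>v (W\<^sup>T *\<^sub>v (M \<Phi> *\<^sub>v v)) \<in> carrier_vec ?k"
      "mat_inv Y *\<^sub>v (W\<^sup>T *\<^sub>v (M \<Phi> *\<^sub>v w)) \<in> carrier_vec ?k"
      using V(1) Wv by (auto intro: mult_mat_vec_carrier)
    show ?thesis
      unfolding B_def 1 2 mult_add_distrib_mat_vec[OF V(1) Wv] mult_add_distrib_mat_vec[OF K_carrier Vv] ..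
  qed
  have B_W: "B (W *\<^sub>v z) = K *\<^sub>v z" if z: "z \<in> carrier_vec ?k" for z
  proof -
    have Wz: "W *\<^sub>v z \<in> carrier_vec (n + n)" using W_carrier z by (rule mult_mat_vec_carrier)
    have "W\<^sup>T *\<^sub>v (M \<Phi> *\<^sub>v (W *\<^sub>v z)) = (W\<^sup>T * M \<Phi>) *\<^sub>v (W *\<^sub>v z)"
      by (rule assoc_mult_mat_vec[symmetric, OF WT Mc Wz])
    also have "\<dots> = Y *\<^sub>v z"
      unfolding Y_def by (rule assoc_mult_mat_vec[symmetric, OF mult_carrier_mat[OF WT Mc] W_carrier z])
    finally show ?thesis
      unfolding B_def using inverse_mult_mat_vec[OF V(1) Yc V(3) z] by simp
  qed
  have B_input: "B (input_embedding *\<^sub>v u) = - (C\<^sup>T *\<^sub>v u)" if u: "u \<in> carrier_vec m" for u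
  proof -
    let ?e = "input_embedding *\<^sub>v u"
    have e: "?e \<in> carrier_vec (n + n)" using input_embedding_carrier u by (rule mult_mat_vec_carrier)
    have De: "diag_block_mat [\<Phi>, 0\<^sub>m n n] *\<^sub>v ?e \<in> carrier_vec (n + n)" using Dc e by (rule mult_mat_vec_carrier)
    have Me: "M \<Phi> *\<^sub>v ?e = diag_block_mat [\<Phi>, 0\<^sub>m n n] *\<^sub>v ?e"
      using minus_mult_distrib_mat_vec[OF Dc sym_matsD(1)[OF Nb_sym] e] Nbar_sym_and_form(3)[OF N_sym u] De
      by simp
    have WDe: "W\<^sup>T *\<^sub>v (diag_block_mat [\<Phi>, 0\<^sub>m n n] *\<^sub>v ?e) \<in> carrier_vec ?k"
      using WT De by (rule mult_mat_vec_carrier)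
    have "B ?e = (K * mat_inv Y) *\<^sub>v (W\<^sup>T *\<^sub>v (diag_block_mat [\<Phi>, 0\<^sub>m n n] *\<^sub>v ?e))"
      unfolding B_def Me by (rule assoc_mult_mat_vec[symmetric, OF K_carrier V(1) WDe])
    also have "\<dots> = (K * mat_inv Y * W\<^sup>T) *\<^sub>v (diag_block_mat [\<Phi>, 0\<^sub>m n n] *\<^sub>v ?e)"
      by (rule assoc_mult_mat_vec[symmetric, OF c1 WT De])
    also have "\<dots> = (K * mat_inv Y * W\<^sup>T * diag_block_mat [\<Phi>, 0\<^sub>m n n]) *\<^sub>v ?e"
      by (rule assoc_mult_mat_vec[symmetric, OF c2 Dc e])
    also have "\<dots> = (K * mat_inv Y * W\<^sup>T * diag_block_mat [\<Phi>, 0\<^sub>m n n] * input_embedding) *\<^sub>v u"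
      by (rule assoc_mult_mat_vec[symmetric, OF c3 input_embedding_carrier u])
    also have "\<dots> = - (C\<^sup>T *\<^sub>v u)"
    proof -
      define G where "G = K * mat_inv Y * W\<^sup>T * diag_block_mat [\<Phi>, 0\<^sub>m n n] * input_embedding"
      have "G \<in> carrier_mat n m" unfolding G_def by (rule mult_carrier_mat[OF c3 input_embedding_carrier])
      thus ?thesis unfolding CT G_def[symmetric] using u by simp
    qed
    finally show ?thesis .
  qed
  let ?A = "transition C (0\<^sub>m p n)"
  have B_eq: "B (x @\<^sub>v y) = ?A\<^sup>T *\<^sub>v x + y" if x: "x \<in> carrier_vec n" and y: "y \<in> carrier_vec n" for x y
  proof -
    obtain a b where ab: "a \<in> carrier_vec r" "b \<in> carrier_vec (m + p)" "x = a @\<^sub>v b"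
      using vec_split[of x r "m + p"] x n_eq_last by metis
    obtain u c where uc: "u \<in> carrier_vec m" "c \<in> carrier_vec p" "b = u @\<^sub>v c"
      using vec_split[OF ab(2)] by metis
    have z: "a @\<^sub>v c @\<^sub>v y \<in> carrier_vec ?k" using ab uc y by simp
    have Wz: "W *\<^sub>v (a @\<^sub>v c @\<^sub>v y) \<in> carrier_vec (n + n)" using W_carrier z by (rule mult_mat_vec_carrier)
    have e: "input_embedding *\<^sub>v u \<in> carrier_vec (n + n)"
      using input_embedding_carrier uc(1) by (rule mult_mat_vec_carrier)
    have "x @\<^sub>v y = W *\<^sub>v (a @\<^sub>v c @\<^sub>v y) + input_embedding *\<^sub>v u"
      unfolding W_mult_vec[OF ab(1) uc(2) y] input_embedding_mult_vec[OF uc(1)] ab(3) uc(3)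
      using ab uc y by (intro eq_vecI) auto
    hence "B (x @\<^sub>v y) = K *\<^sub>v (a @\<^sub>v c @\<^sub>v y) + - (C\<^sup>T *\<^sub>v u)"
      using B_add[OF Wz e] B_W[OF z] B_input[OF uc(1)] by simp
    moreover have "K *\<^sub>v (a @\<^sub>v c @\<^sub>v y) = J\<^sup>T *\<^sub>v a + y" by (rule K_mult_vec[OF ab(1) uc(2) y])
    moreover have "?A\<^sup>T *\<^sub>v x = J\<^sup>T *\<^sub>v a + (- (C\<^sup>T *\<^sub>v u) + - ((0\<^sub>m p n)\<^sup>T *\<^sub>v c))"
      unfolding ab(3) uc(3) by (rule transition_transpose_mult_vec[OF C]) (use ab uc in auto)
    ultimately show ?thesis using J_carrier C ab uc y by (intro eq_vecI) auto
  qed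
  have "robust_LMI \<Phi> C"
    unfolding robust_LMI_def
  proof (intro ballI impI)
    fix x y :: "real vec"
    assume x: "x \<in> carrier_vec n" and y: "y \<in> carrier_vec n" and nz: "\<not> (x = 0\<^sub>v n \<and> y = 0\<^sub>v n)"
    have xy: "x @\<^sub>v y \<in> carrier_vec (n + n)" "x @\<^sub>v y \<noteq> 0\<^sub>v (n + n)"
      using x y nz append_vec_eq_0_iff[OF x y] by auto
    have "qform (M \<Phi>) (x @\<^sub>v y) - qform \<Phi> (B (x @\<^sub>v y)) > 0"
      unfolding B_def
      by (rule elimination_sufficient[OF Ms M_pos W_carrier V(1) _ \<Phi>c K_carrier LMI xy])
        (use V(2) in \<open>auto simp: Y_def\<close>)
    thus "qform \<Phi> x - qform \<Phi> (?A\<^sup>T *\<^sub>v x + y) - qform Nb (x @\<^sub>v y) > 0"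
      unfolding B_eq[OF x y] M_form[OF \<Phi> x y] by simp
  qed
  thus "C \<in> carrier_mat m n \<and> robust_LMI \<Phi> C" using C by simp
qed

text \<open>Evaluate the robust inequality at \<open>y = R\<^sup>T [0, 0, -I] x\<close>, where the form of \<open>Nbar\<close> is nonnegative by
compatibility, and dualize.\<close>

lemma robust_imp_decrease:
  assumes \<Phi>: "\<Phi> \<in> sym_mats n" "pos_def \<Phi>" and C: "C \<in> carrier_mat m n" and rob: "robust_LMI \<Phi> C"
    and R: "consistent_system R" and x: "x \<in> carrier_vec n" "x \<noteq> 0\<^sub>v n"
  shows "qform (mat_inv \<Phi>) (transition C R *\<^sub>v x) < qform (mat_inv \<Phi>) x"
proof -
  note \<Phi>c = sym_matsD(1)[OF \<Phi>(1)]
  note inv = pos_def_mat_inv[OF \<Phi>(2) \<Phi>c]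
  have Rc: "R \<in> carrier_mat p n" using R by (simp add: consistent_system_def)
  show ?thesis
  proof (rule lyapunov_inequality_dual[OF \<Phi>(1) inv(1-3) _ transition_carrier[OF C Rc] _ x])
    show "qform \<Phi> z \<ge> 0" if "z \<in> carrier_vec n" for z
      by (rule pos_def_imp_qform_nonneg[OF \<Phi>(2) \<Phi>c that])
    fix z :: "real vec" assume z: "z \<in> carrier_vec n" "z \<noteq> 0\<^sub>v n"
    have sz: "selection *\<^sub>v z \<in> carrier_vec p" using selection_carrier z by simp
    have y: "R\<^sup>T *\<^sub>v (selection *\<^sub>v z) \<in> carrier_vec n" using Rc sz by simp
    have "qform \<Phi> z - qform \<Phi> ((transition C (0\<^sub>m p n))\<^sup>T *\<^sub>v z + R\<^sup>T *\<^sub>v (selection *\<^sub>v z))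
        - qform Nb (z @\<^sub>v R\<^sup>T *\<^sub>v (selection *\<^sub>v z)) > 0"
      using rob z y unfolding robust_LMI_def by blast
    moreover have "qform Nb (z @\<^sub>v R\<^sup>T *\<^sub>v (selection *\<^sub>v z)) \<ge> 0"
      using Nb_form[OF z(1) y] R sz by (simp add: consistent_system_def)
    ultimately show "qform \<Phi> ((transition C R)\<^sup>T *\<^sub>v z) < qform \<Phi> z"
      unfolding transition_transpose_split[OF C Rc z(1)] by simp
  qed
qed

text \<open>A compatible system exists, so the decrease makes \<open>\<Psi>\<close> positive definite. Dualization and the S-lemma
give the robust inequality with some multiplier \<open>\<alpha> > 0\<close>, which is absorbed by scaling \<open>\<Psi>\<^sup>-\<^sup>1\<close>.\<close>

lemma decrease_imp_robust:
  assumes C: "C \<in> carrier_mat m n" and \<Psi>: "\<Psi> \<in> sym_mats n" "pos_semidef \<Psi>"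
    and decrease: "\<forall>R. consistent_system R \<longrightarrow>
      (\<forall>x\<in>carrier_vec n. x \<noteq> 0\<^sub>v n \<longrightarrow> qform \<Psi> (transition C R *\<^sub>v x) < qform \<Psi> x)"
  obtains \<Phi> where "\<Phi> \<in> sym_mats n" "pos_def \<Phi>" "robust_LMI \<Phi> C"
proof -
  note \<Psi>c = sym_matsD(1)[OF \<Psi>(1)]
  have decr: "qform \<Psi> (transition C R *\<^sub>v x) < qform \<Psi> x"
    if "consistent_system R" "x \<in> carrier_vec n" "x \<noteq> 0\<^sub>v n" for R x
    using decrease that by blast
  have \<Psi>_nonneg: "qform \<Psi> x \<ge> 0" if "x \<in> carrier_vec n" for x
    using \<Psi>(2) that unfolding pos_semidef_iff[OF \<Psi>c] by blast
  obtain R0 where R0: "R0 \<in> carrier_mat p n" "\<And>a. a \<in> carrier_vec p \<Longrightarrow> qform N (a @\<^sub>v R0\<^sup>T *\<^sub>v a) \<ge> 0"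
    using consistent by blast
  have "consistent_system R0" using R0 by (simp add: consistent_system_def)
  have "qform \<Psi> x > 0" if x: "x \<in> carrier_vec n" "x \<noteq> 0\<^sub>v n" for x
  proof -
    have "transition C R0 *\<^sub>v x \<in> carrier_vec n"
      using transition_carrier[OF C R0(1)] x(1) by (rule mult_mat_vec_carrier)
    thus ?thesis using decr[OF \<open>consistent_system R0\<close> x] \<Psi>_nonneg by (meson le_less_trans)
  qed
  hence \<Psi>_pd: "pos_def \<Psi>" using \<Psi>(1) by (simp add: pos_def_iff[OF \<Psi>c])
  define \<Phi> where "\<Phi> = mat_inv \<Psi>"
  note inv = pos_def_mat_inv[OF \<Psi>_pd \<Psi>c, folded \<Phi>_def]
  have \<Phi>_pd: "pos_def \<Phi>" unfolding \<Phi>_def by (rule pos_def_inverse[OF \<Psi>_pd \<Psi>c])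
  have \<Phi>: "\<Phi> \<in> sym_mats n" using \<Phi>_pd unfolding pos_def_iff[OF inv(1)] by blast
  have \<Phi>_pos: "qform \<Phi> x > 0" if "x \<in> carrier_vec n" "x \<noteq> 0\<^sub>v n" for x
    using \<Phi>_pd that unfolding pos_def_iff[OF inv(1)] by blast
  let ?A = "transition C (0\<^sub>m p n)"
  have A: "?A \<in> carrier_mat n n" using transition_carrier[OF C] by simp
  have dual: "qform \<Phi> (?A\<^sup>T *\<^sub>v x + R\<^sup>T *\<^sub>v (selection *\<^sub>v x)) < qform \<Phi> x"
    if R: "R \<in> carrier_mat p n" "\<And>a. a \<in> carrier_vec p \<Longrightarrow> qform N (a @\<^sub>v R\<^sup>T *\<^sub>v a) \<ge> 0"
      and x: "x \<in> carrier_vec n" "x \<noteq> 0\<^sub>v n" for R x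
  proof -
    have cs: "consistent_system R" using R by (simp add: consistent_system_def)
    have TT: "(transition C R)\<^sup>T \<in> carrier_mat n n" using transition_carrier[OF C R(1)] by simp
    have "qform \<Phi> ((transition C R)\<^sup>T *\<^sub>v x) < qform \<Phi> x"
      by (rule lyapunov_inequality_dual[OF \<Psi>(1) inv(1-3) \<Psi>_nonneg TT _ x])
        (simp_all add: decr[OF cs])
    thus ?thesis unfolding transition_transpose_split[OF C R(1) x(1)] .
  qed
  obtain \<alpha> where \<alpha>: "\<alpha> > 0"
    "\<And>x y. x \<in> carrier_vec n \<Longrightarrow> y \<in> carrier_vec n \<Longrightarrow> \<not> (x = 0\<^sub>v n \<and> y = 0\<^sub>v n) \<Longrightarrow>
       qform \<Phi> x - qform \<Phi> (?A\<^sup>T *\<^sub>v x + y) - \<alpha> * qform Nb (x @\<^sub>v y) > 0"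
    by (rule robust_decrease_imp_LMI[OF N_sym N22_neg R0 selection_carrier Nb_sym Nb_form A \<Phi> \<Phi>_pos n_pos dual])
      (assumption | blast)+
  define \<Phi>' where "\<Phi>' = (1 / \<alpha>) \<cdot>\<^sub>m \<Phi>"
  have \<Phi>': "\<Phi>' \<in> sym_mats n" unfolding \<Phi>'_def by (rule smult_sym_mats[OF \<Phi>])
  have q': "qform \<Phi>' x = qform \<Phi> x / \<alpha>" if "x \<in> carrier_vec n" for x
    unfolding \<Phi>'_def using qform_smult_mat[OF inv(1) that] by simp
  have "pos_def \<Phi>'" using \<Phi>' \<Phi>_pos \<alpha>(1) by (simp add: pos_def_iff[OF sym_matsD(1)[OF \<Phi>']] q')
  moreover have "robust_LMI \<Phi>' C"
    unfolding robust_LMI_def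
  proof (intro ballI impI)
    fix x y :: "real vec"
    assume x: "x \<in> carrier_vec n" and y: "y \<in> carrier_vec n" and nz: "\<not> (x = 0\<^sub>v n \<and> y = 0\<^sub>v n)"
    have Axy: "?A\<^sup>T *\<^sub>v x + y \<in> carrier_vec n" using A x y by simp
    have "0 < (qform \<Phi> x - qform \<Phi> (?A\<^sup>T *\<^sub>v x + y) - \<alpha> * qform Nb (x @\<^sub>v y)) / \<alpha>"
      using \<alpha>(2)[OF x y nz] \<alpha>(1) by simp
    thus "qform \<Phi>' x - qform \<Phi>' (?A\<^sup>T *\<^sub>v x + y) - qform Nb (x @\<^sub>v y) > 0"
      unfolding q'[OF x] q'[OF Axy] using \<alpha>(1) by (simp add: diff_divide_distrib)
  qed
  ultimately show ?thesis using that \<Phi>' by blast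
qed

end

section \<open>The characterization of informativity\<close>

theorem theorem25:
  fixes p m L T q :: nat
    and PI Nb J W K :: "real mat"
    and u y :: "nat \<Rightarrow> real vec"
    and M :: "real mat \<Rightarrow> real mat"
  assumes "p > 0" and "m > 0" and "L > 0" and "T \<ge> L" and q: "q = p + m"
    and noise: "noise_model p L T PI"
    and data: "\<forall>t \<le> T. u t \<in> carrier_vec m \<and> y t \<in> carrier_vec p"
    and true_system: "\<exists>P Q. system p m L P Q \<and> generates_data p L T PI u y P Q"
    and full_row_rank: "vec_space.rank (q * L) (hankel1 p m L T u y) = q * L"
    and Nb: "Nb = Nbar p m L (N_mat p m L T PI u y)"
    and J: "J = J_mat p m L"
    and W: "W = W_mat p m L"
    and K: "K = K_mat p m L"
    and M: "\<And>\<Phi>. M \<Phi> = diag_block_mat [\<Phi>, 0\<^sub>m (q * L) (q * L)] - Nb"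
  shows
    "(informative_quadratic_stabilization p m L T PI u y \<longleftrightarrow>
        (\<exists>\<Phi> \<in> sym_mats (q * L).
           pos_def (\<Phi> - schur_compl (q * L) Nb) \<and>
           pos_def ((W @\<^sub>r K)\<^sup>T * diag_block_mat [M \<Phi>, - \<Phi>] * (W @\<^sub>r K))))
     \<and>
     (\<forall>\<Phi> \<in> sym_mats (q * L).
        pos_def (\<Phi> - schur_compl (q * L) Nb) \<and>
        pos_def ((W @\<^sub>r K)\<^sup>T * diag_block_mat [M \<Phi>, - \<Phi>] * (W @\<^sub>r K)) \<longrightarrow>
        invertible_mat \<Phi> \<and>
        invertible_mat (W\<^sup>T * M \<Phi> * W) \<and>
        (\<forall>C. C\<^sup>T = - (K * mat_inv (W\<^sup>T * M \<Phi> * W) * W\<^sup>T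
                     * diag_block_mat [\<Phi>, 0\<^sub>m (q * L) (q * L)]
                     * (0\<^sub>m (q * (L - 1)) m @\<^sub>r 1\<^sub>m m @\<^sub>r 0\<^sub>m (p + q * L) m)) \<longrightarrow>
           (let X = 1\<^sub>m (2 * q * L)
                    @\<^sub>r ((J @\<^sub>r (- C) @\<^sub>r 0\<^sub>m p (q * L))\<^sup>T @\<^sub>c 1\<^sub>m (q * L))
            in pos_def (X\<^sup>T * diag_block_mat [M \<Phi>, - \<Phi>] * X)) \<and>
           (\<forall>G F. controller p m L G F \<and> controller_coeff_mat p m L G F = C \<longrightarrow>
              (\<forall>P Q. system p m L P Q \<and>
                 compatible p m L T PI u y (system_coeff_mat p m L P Q) \<longrightarrow>
                 stabilizes p m L G F P Q \<and>
                 lyapunov_function p m L P Q G F (mat_inv \<Phi>)))))"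
proof -
  define n where "n = q * L"
  define N where "N = N_mat p m L T PI u y"
  interpret io_dimensions p m L q n
    by unfold_locales (use assms(1-3) q n_def in auto)
  have PI: "PI \<in> sym_mats (p + (T - L + 1))" and PI22: "neg_def (block22 p PI)"
    using noise by (auto simp: noise_model_def)
  note T = \<open>T \<ge> L\<close>
  have compat: "compatible p m L T PI u y R \<longleftrightarrow> R \<in> carrier_mat p n \<and>
      (\<forall>a\<in>carrier_vec p. qform N (a @\<^sub>v R\<^sup>T *\<^sub>v a) \<ge> 0)" for R
    unfolding N_def by (rule compatible_iff[OF PI T])
  interpret io_data p m L q n N
  proof
    show "N \<in> sym_mats (p + n)" unfolding N_def by (rule N_mat_sym_and_form(1)[OF PI T])
    show "neg_def (block22 p N)"
      unfolding N_def using N_mat_block22_neg_def[OF PI T PI22] full_row_rank by (simp add: n_def)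
    show "\<exists>R\<in>carrier_mat p n. \<forall>a\<in>carrier_vec p. qform N (a @\<^sub>v R\<^sup>T *\<^sub>v a) \<ge> 0"
      using true_system generating_system_compatible[OF PI T data] compat by blast
  qed
  have cons: "consistent_system R \<longleftrightarrow> compatible p m L T PI u y R" for R
    unfolding compat consistent_system_def ..
  have M_eq: "M \<Phi> = diag_block_mat [\<Phi>, 0\<^sub>m n n] - Nbar p m L N" for \<Phi>
    unfolding M Nb N_def n_def ..
  have Nb_eq: "Nb = Nbar p m L N" unfolding Nb N_def ..
  let ?LMIs = "\<lambda>\<Phi>. pos_def (\<Phi> - schur_compl n Nb) \<and>
    pos_def ((W @\<^sub>r K)\<^sup>T * diag_block_mat [M \<Phi>, - \<Phi>] * (W @\<^sub>r K))"
  have informative_iff: "informative_quadratic_stabilization p m L T PI u y \<longleftrightarrow>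
      (\<exists>C\<in>carrier_mat m n. \<exists>\<Psi>\<in>sym_mats n. pos_semidef \<Psi> \<and>
        (\<forall>R. consistent_system R \<longrightarrow>
          (\<forall>x\<in>carrier_vec n. x \<noteq> 0\<^sub>v n \<longrightarrow> qform \<Psi> (transition C R *\<^sub>v x) < qform \<Psi> x)))"
    unfolding informative_quadratic_stabilization_def Let_def q[symmetric] n_def[symmetric] cons[symmetric]
    using quadratic_stabilization_form by (simp add: consistent_system_def cong: conj_cong)
  have emb: "0\<^sub>m (q * (L - 1)) m @\<^sub>r 1\<^sub>m m @\<^sub>r 0\<^sub>m (p + n) m = input_embedding"
    by (simp add: input_embedding_def)
  have nn: "2 * q * L = n + n" by (simp add: n_def)
  have design: "\<Phi> \<in> sym_mats n \<Longrightarrow> ?LMIs \<Phi> \<Longrightarrow>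
      C\<^sup>T = - (K * mat_inv (W\<^sup>T * M \<Phi> * W) * W\<^sup>T * diag_block_mat [\<Phi>, 0\<^sub>m n n] * input_embedding) \<Longrightarrow>
      C \<in> carrier_mat m n \<and> robust_LMI \<Phi> C" for \<Phi> C
    using LMIs_imp_robust(2)[of \<Phi> C] unfolding M_eq Nb_eq W K by blast
  show ?thesis
    unfolding n_def[symmetric] emb nn
  proof (intro conjI ballI impI allI, goal_cases)
    case 1
    show ?case
    proof
      assume "informative_quadratic_stabilization p m L T PI u y"
      then obtain C \<Psi> where C: "C \<in> carrier_mat m n" and \<Psi>: "\<Psi> \<in> sym_mats n" "pos_semidef \<Psi>"
        and decr: "\<forall>R. consistent_system R \<longrightarrow>
          (\<forall>x\<in>carrier_vec n. x \<noteq> 0\<^sub>v n \<longrightarrow> qform \<Psi> (transition C R *\<^sub>v x) < qform \<Psi> x)"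
        unfolding informative_iff by blast
      obtain \<Phi> where \<Phi>: "\<Phi> \<in> sym_mats n" "pos_def \<Phi>" "robust_LMI \<Phi> C"
        using decrease_imp_robust[OF C \<Psi> decr] by metis
      show "\<exists>\<Phi>\<in>sym_mats n. ?LMIs \<Phi>"
        using robust_imp_LMIs[OF \<Phi>(1,2) C \<Phi>(3)] \<Phi>(1) unfolding M_eq Nb_eq W K by blast
    next
      assume "\<exists>\<Phi>\<in>sym_mats n. ?LMIs \<Phi>"
      then obtain \<Phi> where \<Phi>: "\<Phi> \<in> sym_mats n" "?LMIs \<Phi>" by blast
      have pd: "pos_def \<Phi>" using schur_LMI_iff(2)[OF \<Phi>(1)] \<Phi>(2) unfolding Nb_eq by blast
      note \<Phi>c = sym_matsD(1)[OF \<Phi>(1)]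
      define C where
        "C = (- (K * mat_inv (W\<^sup>T * M \<Phi> * W) * W\<^sup>T * diag_block_mat [\<Phi>, 0\<^sub>m n n] * input_embedding))\<^sup>T"
      have C: "C \<in> carrier_mat m n" "robust_LMI \<Phi> C"
        using design[OF \<Phi>, of C] by (auto simp: C_def)
      have inv: "mat_inv \<Phi> \<in> carrier_mat n n" by (rule pos_def_mat_inv(1)[OF pd \<Phi>c])
      have inv_pd: "pos_def (mat_inv \<Phi>)" by (rule pos_def_inverse[OF pd \<Phi>c])
      have inv_sym: "mat_inv \<Phi> \<in> sym_mats n" using inv_pd unfolding pos_def_iff[OF inv] by blast
      moreover have "pos_semidef (mat_inv \<Phi>)"
        using inv_sym pos_def_imp_qform_nonneg[OF inv_pd inv] by (simp add: pos_semidef_iff[OF inv])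
      ultimately show "informative_quadratic_stabilization p m L T PI u y"
        unfolding informative_iff using robust_imp_decrease[OF \<Phi>(1) pd C] C(1) by blast
    qed
  next
    case (2 \<Phi>)
    have "pos_def \<Phi>" using schur_LMI_iff(2)[OF 2(1)] 2(2) unfolding Nb_eq by blast
    from pos_def_mat_inv(4)[OF this sym_matsD(1)[OF 2(1)]] show ?case .
  next
    case (3 \<Phi>)
    thus ?case using LMIs_imp_robust(1)[of \<Phi>] unfolding M_eq Nb_eq W K by blast
  next
    case (4 \<Phi> C)
    have "C \<in> carrier_mat m n" "robust_LMI \<Phi> C" using design[OF 4] by auto
    thus ?case using controller_LMI_iff_robust[OF 4(1)] unfolding M_eq J Let_def by blast
  next
    case (5 \<Phi> C G F P Q)
    have pd: "pos_def \<Phi>" using schur_LMI_iff(2)[OF 5(1)] 5(2) unfolding Nb_eq by blast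
    note \<Phi>c = sym_matsD(1)[OF 5(1)]
    have C: "C \<in> carrier_mat m n" "robust_LMI \<Phi> C" using design[OF 5(1-3)] by auto
    have R: "consistent_system (system_coeff_mat p m L P Q)" using 5 cons by blast
    have "stabilizes p m L G F P Q"
      by (rule decrease_imp_lyapunov_and_stable(2)[OF _ _ pos_def_mat_inv(1)[OF pd \<Phi>c] pos_def_inverse[OF pd \<Phi>c]])
        (use 5 robust_imp_decrease[OF 5(1) pd C R] in auto)
    thus ?case .
  next
    case (6 \<Phi> C G F P Q)
    have pd: "pos_def \<Phi>" using schur_LMI_iff(2)[OF 6(1)] 6(2) unfolding Nb_eq by blast
    note \<Phi>c = sym_matsD(1)[OF 6(1)]
    have C: "C \<in> carrier_mat m n" "robust_LMI \<Phi> C" using design[OF 6(1-3)] by auto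
    have R: "consistent_system (system_coeff_mat p m L P Q)" using 6 cons by blast
    show ?case
      by (rule decrease_imp_lyapunov_and_stable(1)[OF _ _ pos_def_mat_inv(1)[OF pd \<Phi>c] pos_def_inverse[OF pd \<Phi>c]])
        (use 6 robust_imp_decrease[OF 6(1) pd C R] in auto)
  qed
qed

end
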